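(* Let $\sigma\in W^{1,\infty}(\mathbb{T}^N;\mathbb{R}^{N\times N})$, $A=\sigma\sigma^T$, and let $\underline{H},\overline{H}\in C(\mathbb{T}^N\times\mathbb{R}^N)$. Assume: (1) there exists $\nu>0$ such that $A(x)\ge\nu I$ for all $x\in\mathbb{T}^N$; (2) there exists $\underline{C}$ such that $|\underline{H}(x,p)|\le\underline{C}(1+|p|)$ for all $(x,p)\in\mathbb{T}^N\times\mathbb{R}^N$; (3) either (a) there exist $\overline{C}>0$ and $L>1$ such that for all $x,y\in\mathbb{T}^N$, $|p|\ge L$ and $\mu\ge1+L|x-y|$, $\ \overline{H}(x,p)-\mu\overline{H}(y,\frac p\mu)\ge-\overline{C}|p|$; or, more generally, (b) there exist $\overline{C}>0$ and $L,\mu>1$ such that for all $x,y\in\mathbb{T}^N$ and $|p|\ge L$, $\ \overline{H}(x,p)-\mu\overline{H}(y,\frac p\mu)\ge-\overline{C}|p|$. Then there exists a constant $K>0$ (independent of $\epsilon$) such that, for every $\epsilon>0$, if $\phi^\epsilon\in C(\mathbb{T}^N)$ is a continuous viscosity solution of $$\epsilon\phi^\epsilon-\mathrm{trace}(A(x)D^2\phi^\epsilon)+\underline{H}(x,D\phi^\epsilon)+\overline{H}(x,D\phi^\epsilon)=0,\qquad x\in\mathbb{T}^N,$$ then $$\mathrm{osc}(\phi^\epsilon):=\max_{\mathbb{T}^N}\phi^\epsilon-\min_{\mathbb{T}^N}\phi^\epsilon\le K.$$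
   Context: $\mathbb{T}^N=\mathbb{R}^N/\mathbb{Z}^N$ is the flat torus; functions on $\mathbb{T}^N$ are identified with $\mathbb{Z}^N$-periodic functions on $\mathbb{R}^N$, and $|x-y|$ is the distance on the torus (minimum of Euclidean distances over representatives). Solutions are in the viscosity sense. *)

theory Defs
  imports "HOL-Analysis.Analysis"
begin

text \<open>Functions on the flat torus are represented by functions on \<^typ>\<open>real ^ 'n\<close> that are
  periodic with respect to the integer lattice.\<close>

definition int_lattice :: "(real ^ 'n) set" where
  "int_lattice = {k. \<forall>i. k $ i \<in> \<int>}"

definition torus_periodic :: "(real ^ 'n \<Rightarrow> 'b) \<Rightarrow> bool" where
  "torus_periodic f \<longleftrightarrow> (\<forall>x. \<forall>k\<in>int_lattice. f (x + k) = f x)"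

text \<open>The infimum is attained: the lattice is closed and discrete.\<close>

definition torus_dist :: "real ^ 'n \<Rightarrow> real ^ 'n \<Rightarrow> real" where
  "torus_dist x y = (INF k\<in>int_lattice. dist x (y + k))"

definition torus_C :: "(real ^ 'n \<Rightarrow> 'b::topological_space) \<Rightarrow> bool" where
  "torus_C f \<longleftrightarrow> torus_periodic f \<and> continuous_on UNIV f"

definition torus_C_Hamiltonian :: "(real ^ 'n \<Rightarrow> real ^ 'n \<Rightarrow> real) \<Rightarrow> bool" where
  "torus_C_Hamiltonian H \<longleftrightarrow>
     torus_periodic H \<and> continuous_on UNIV (\<lambda>(x, p). H x p)"

definition L_infty :: "(real ^ 'n \<Rightarrow> real) \<Rightarrow> bool" where
  "L_infty f \<longleftrightarrow> f \<in> borel_measurable lebesgue \<and> (\<exists>C. AE x in lebesgue. \<bar>f x\<bar> \<le> C)"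

text \<open>Weak partial derivatives on the whole space, tested against compactly supported
  \<open>C\<^sup>1\<close> functions \<open>\<psi>\<close>, with gradient \<open>D\<psi>\<close> (the convention of Gilbarg and Trudinger).\<close>

definition weak_partial :: "'n \<Rightarrow> (real ^ 'n \<Rightarrow> real) \<Rightarrow> (real ^ 'n \<Rightarrow> real) \<Rightarrow> bool" where
  "weak_partial i f g \<longleftrightarrow>
     (\<forall>\<psi> D\<psi>. (\<forall>x. GDERIV \<psi> x :> D\<psi> x) \<longrightarrow> continuous_on UNIV D\<psi> \<longrightarrow>
        compact (closure {x. \<psi> x \<noteq> 0}) \<longrightarrow>
        (\<integral>x. f x * D\<psi> x $ i \<partial>lebesgue) = - (\<integral>x. g x * \<psi> x \<partial>lebesgue))"

definition W1_infty :: "(real ^ 'n \<Rightarrow> real) \<Rightarrow> bool" where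
  "W1_infty f \<longleftrightarrow> L_infty f \<and> (\<forall>i. \<exists>g. L_infty g \<and> weak_partial i f g)"

text \<open>Matrix fields of class \<open>W\<^sup>1\<^sup>,\<^sup>\<infinity>\<close> on the torus. Their values are used at every point, so the
  class modulo null sets is represented by its (unique) continuous member.\<close>

definition torus_W1_infty :: "(real ^ 'n \<Rightarrow> real ^ 'n ^ 'n) \<Rightarrow> bool" where
  "torus_W1_infty \<sigma> \<longleftrightarrow> torus_C \<sigma> \<and> (\<forall>i j. W1_infty (\<lambda>x. \<sigma> x $ i $ j))"

text \<open>The order on symmetric matrices by comparison of quadratic forms.\<close>

definition mat_le :: "real ^ 'n ^ 'n \<Rightarrow> real ^ 'n ^ 'n \<Rightarrow> bool" where
  "mat_le X Y \<longleftrightarrow> (\<forall>\<xi>. \<xi> \<bullet> (X *v \<xi>) \<le> \<xi> \<bullet> (Y *v \<xi>))"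

text \<open>\<open>\<theta>\<close> is of class \<open>C\<^sup>2\<close> with gradient \<open>D\<close> and Hessian \<open>D2\<close>.\<close>

definition C2_with ::
  "(real ^ 'n \<Rightarrow> real) \<Rightarrow> (real ^ 'n \<Rightarrow> real ^ 'n) \<Rightarrow> (real ^ 'n \<Rightarrow> real ^ 'n ^ 'n) \<Rightarrow> bool" where
  "C2_with \<theta> D D2 \<longleftrightarrow>
     (\<forall>x. GDERIV \<theta> x :> D x) \<and>
     (\<forall>x. (D has_derivative (\<lambda>h. D2 x *v h)) (at x)) \<and>
     continuous_on UNIV D2"

text \<open>Viscosity solutions of \<open>F(x, u, Du, D\<^sup>2u) = 0\<close> on the whole space. The notion is local, so a
  solution on the torus is the same as a periodic solution on the whole space; the test
  functions \<open>\<theta>\<close> need not be periodic.\<close>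

definition viscosity_subsolution ::
  "(real ^ 'n \<Rightarrow> real \<Rightarrow> real ^ 'n \<Rightarrow> real ^ 'n ^ 'n \<Rightarrow> real) \<Rightarrow> (real ^ 'n \<Rightarrow> real) \<Rightarrow> bool" where
  "viscosity_subsolution F u \<longleftrightarrow>
     (\<forall>\<theta> D D2 x0. C2_with \<theta> D D2 \<longrightarrow>
        (\<forall>\<^sub>F x in nhds x0. u x - \<theta> x \<le> u x0 - \<theta> x0) \<longrightarrow>
        F x0 (u x0) (D x0) (D2 x0) \<le> 0)"

definition viscosity_supersolution ::
  "(real ^ 'n \<Rightarrow> real \<Rightarrow> real ^ 'n \<Rightarrow> real ^ 'n ^ 'n \<Rightarrow> real) \<Rightarrow> (real ^ 'n \<Rightarrow> real) \<Rightarrow> bool" where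
  "viscosity_supersolution F u \<longleftrightarrow>
     (\<forall>\<theta> D D2 x0. C2_with \<theta> D D2 \<longrightarrow>
        (\<forall>\<^sub>F x in nhds x0. u x - \<theta> x \<ge> u x0 - \<theta> x0) \<longrightarrow>
        F x0 (u x0) (D x0) (D2 x0) \<ge> 0)"

definition torus_viscosity_solution ::
  "(real ^ 'n \<Rightarrow> real \<Rightarrow> real ^ 'n \<Rightarrow> real ^ 'n ^ 'n \<Rightarrow> real) \<Rightarrow> (real ^ 'n \<Rightarrow> real) \<Rightarrow> bool" where
  "torus_viscosity_solution F u \<longleftrightarrow>
     torus_C u \<and> viscosity_subsolution F u \<and> viscosity_supersolution F u"

text \<open>For continuous periodic \<open>u\<close> supremum and infimum are the maximum and minimum on the torus.\<close>

definition osc :: "(real ^ 'n \<Rightarrow> real) \<Rightarrow> real" where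
  "osc u = (SUP x. u x) - (INF x. u x)"

end

theory Submission
  imports Defs "HOL-Probability.Distributions"
begin

text \<open>
Let \<open>m\<close> be the minimum of the solution \<open>\<phi>\<close> and let \<open>\<mu> > 1\<close> be the factor in the superlinearity
hypothesis; the first alternative of that hypothesis yields the second one, because distances on
the torus are bounded. The proof shows that
\<open>(\<phi> x - m) - \<mu> * (\<phi> y - m) \<le> w (\<bar>x - y\<bar>\<^sup>2) + 1\<close>
for a bounded concave penalty \<open>w\<close> that depends only on the data. Taking for \<open>y\<close> a minimum point of
\<open>\<phi>\<close> bounds the oscillation by \<open>sup w + 1\<close>.

Suppose that this fails. Since \<open>\<mu> > 1\<close>, the left-hand side is at most \<open>0\<close> on the diagonal, so (up to
a small regularisation) the difference of the two sides has a positive maximum at a point with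
\<open>x \<noteq> y\<close>. There \<open>\<phi>\<close> has the gradient \<open>p\<close> at \<open>x\<close> and \<open>\<mu> * \<phi>\<close> has the same gradient \<open>p\<close> at \<open>y\<close>, and
\<open>\<bar>p\<bar>\<close> is large because the penalty is steep. Subtracting the supersolution inequality at \<open>y\<close>, times
\<open>\<mu>\<close>, from the subsolution inequality at \<open>x\<close>, the combination \<open>H_up x p - \<mu> * H_up y (p / \<mu>)\<close> is at least
\<open>- C * \<bar>p\<bar>\<close>, and the remaining terms are at least \<open>- C * (1 + \<bar>p\<bar>)\<close>, uniformly in \<open>\<epsilon>\<close>: the terms
\<open>\<epsilon> * \<phi>\<close> have a good sign except for a multiple of \<open>\<epsilon> * m\<close>, which is bounded by testing at the
maximum of \<open>\<phi>\<close>. On the other hand the second order terms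
are bounded by the trace of \<open>D\<^sup>2w\<close> against \<open>(S\<^sub>1 - S\<^sub>2) (S\<^sub>1 - S\<^sub>2)\<^sup>T\<close>, where \<open>S\<^sub>1\<close> and \<open>S\<^sub>2\<close> are
any square roots of \<open>A x\<close> and \<open>A y\<close>. As in the method of Ishii and Lions, \<open>S\<^sub>2\<close> is chosen so that
\<open>S\<^sub>1 - S\<^sub>2\<close> is large in the direction \<open>x - y\<close> where \<open>w\<close> is concave and, when \<open>x\<close> is close to \<open>y\<close>,
small in the other directions (\<open>reflection_coupling\<close>, \<open>sign_coupling\<close>). Ellipticity then makes the
second order terms so negative that they beat \<open>C * (1 + \<bar>p\<bar>)\<close> (\<open>penalty_constants\<close>).

The bound on the second order terms (\<open>doubling_inequality\<close>) takes the place of the theorem on sums.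
Its proof uses neither Alexandrov's theorem nor Jensen's lemma but a coupling of Gaussian averages.
The sup-convolution \<open>u\<close> of a subsolution is semiconvex. If it is touched from above at a point
by a quadratic function, then near that point its gradients are close to \<open>p\<close> and its
Hessians are bounded from below, so that after a linear change of variables \<open>S\<close> with
\<open>S S\<^sup>T = A\<close> it satisfies \<open>\<Delta>u \<ge> f\<close> near that point, with \<open>f\<close> as close as desired to
the value given by the equation (\<open>laplacian_ge_sup_conv\<close>). Comparison with the heat extension turns this into
the submean inequality \<open>E u (\<surd>(2t) Z) \<ge> u 0 + f * t - o(t)\<close> for a standard Gaussian vector
\<open>Z\<close> (\<open>gaussian_submean\<close>). Driving the two variables \<open>x\<close> and \<open>y\<close> by the same \<open>Z\<close>, through \<open>S\<^sub>1\<close> and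
\<open>S\<^sub>2\<close>, and using that the doubled function is maximal at the starting point leaves exactly the trace
above (\<open>laplacian_sum_le_quadratic\<close>).
\<close>

section \<open>Gaussian averages over a box\<close>

definition cube :: "real \<Rightarrow> (real ^ 'n) set" where
  "cube s = cbox (\<chi> i. - s) (\<chi> i. s)"

lemma mem_cube: "z \<in> cube s \<longleftrightarrow> (\<forall>i. \<bar>z $ i\<bar> \<le> s)"
  by (auto simp: cube_def mem_box_cart abs_le_iff minus_le_iff)

lemma prod_Basis_vec:
  fixes g :: "real ^ 'n \<Rightarrow> real"
  shows "(\<Prod>b\<in>Basis. g b) = (\<Prod>i\<in>UNIV. g (axis i 1))"
proof -
  have "bij_betw (\<lambda>i::'n. axis i (1::real)) UNIV Basis"
    by (auto simp: bij_betw_def inj_on_def axis_eq_axis Basis_vec_def)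
  from prod.reindex_bij_betw[OF this, of g] show ?thesis by simp
qed

lemma integral_lborel_prod_vec:
  fixes f :: "'n::finite \<Rightarrow> real \<Rightarrow> real"
  assumes f: "\<And>i. integrable lborel (f i)"
  shows "(\<integral>z. (\<Prod>i\<in>UNIV. f i (z $ i)) \<partial>(lborel :: (real ^ 'n) measure)) = (\<Prod>i\<in>UNIV. \<integral>x. f i x \<partial>lborel)"
proof -
  have fm[measurable]: "f i \<in> borel_measurable borel" for i
    using f[of i] by auto
  interpret product_sigma_finite "\<lambda>_. lborel :: real measure" ..
  define j where "j b = (THE i. b = axis i (1::real))" for b :: "real ^ 'n"
  have j: "j (axis i 1) = i" for i by (auto simp: j_def axis_eq_axis)
  have nth: "(\<Sum>b\<in>Basis. x b *\<^sub>R b) $ i = x (axis i 1)" for x :: "real ^ 'n \<Rightarrow> real" and i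
    by (simp add: cart_eq_inner_axis inner_sum_left inner_Basis if_distrib sum.delta cong: if_cong)
  have nth': "f i ((\<Sum>b\<in>Basis. x b *\<^sub>R b) $ i) = f i (x (axis i 1))" for x :: "real ^ 'n \<Rightarrow> real" and i
    using nth by metis
  have "(\<integral>z. (\<Prod>i\<in>UNIV. f i (z $ i)) \<partial>(lborel :: (real ^ 'n) measure))
     = (\<integral>x. (\<Prod>i\<in>UNIV. f i ((\<Sum>b\<in>Basis. x b *\<^sub>R b) $ i)) \<partial>(\<Pi>\<^sub>M b\<in>Basis. lborel))"
    by (subst lborel_eq) (subst integral_distr; measurable)
  also have "\<dots> = (\<integral>x. (\<Prod>b\<in>(Basis :: (real ^ 'n) set). f (j b) (x b)) \<partial>(\<Pi>\<^sub>M b\<in>Basis. lborel))"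
    unfolding nth' by (subst prod_Basis_vec) (simp add: j)
  also have "\<dots> = (\<Prod>b\<in>(Basis :: (real ^ 'n) set). \<integral>x. f (j b) x \<partial>lborel)"
    by (rule product_integral_prod) (auto simp: f)
  finally show ?thesis by (simp add: prod_Basis_vec j)
qed

lemma integral_Icc_lborel:
  fixes f :: "real \<Rightarrow> real"
  assumes f: "continuous_on UNIV f"
  shows "integrable lborel (\<lambda>x. indicat_real {-s..s} x * f x)"
    "integral {-s..s} f = (\<integral>x. indicat_real {-s..s} x * f x \<partial>lborel)"
proof -
  show 1: "integrable lborel (\<lambda>x. indicat_real {-s..s} x * f x)"
    using borel_integrable_compact[of "{-s..s}" f] f continuous_on_subset[OF f] by auto
  show "integral {-s..s} f = (\<integral>x. indicat_real {-s..s} x * f x \<partial>lborel)"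
    using set_borel_integral_eq_integral(2)[of "{-s..s}" f] 1
    by (auto simp: set_integrable_def set_lebesgue_integral_def)
qed

lemma integral_cube_prod:
  fixes f :: "'n::finite \<Rightarrow> real \<Rightarrow> real"
  assumes f: "\<And>i. continuous_on UNIV (f i)"
  shows "integral (cube s) (\<lambda>z :: real ^ 'n. \<Prod>i\<in>UNIV. f i (z $ i)) = (\<Prod>i\<in>UNIV. integral {-s..s} (f i))"
proof -
  note I = integral_Icc_lborel[OF f]
  have c: "continuous_on (cube s) (\<lambda>z :: real ^ 'n. \<Prod>i\<in>UNIV. f i (z $ i))"
    by (intro continuous_intros continuous_on_compose2[OF f]) auto
  have 3: "integrable lborel (\<lambda>z :: real ^ 'n. indicator (cube s) z *\<^sub>R (\<Prod>i\<in>UNIV. f i (z $ i)))"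
    by (rule borel_integrable_compact) (use c in \<open>auto simp: cube_def\<close>)
  have 4: "indicator (cube s) z *\<^sub>R (\<Prod>i\<in>UNIV. f i (z $ i)) = (\<Prod>i\<in>UNIV. indicat_real {-s..s} (z $ i) * f i (z $ i))" for z :: "real ^ 'n"
  proof -
    have "indicat_real (cube s) z = (\<Prod>i\<in>UNIV. indicat_real {-s..s} (z $ i))"
    proof (cases "z \<in> cube s")
      case True then show ?thesis by (auto simp: mem_cube indicator_def abs_le_iff minus_le_iff intro!: prod.neutral)
    next
      case False
      then obtain i where "\<not> \<bar>z $ i\<bar> \<le> s" by (auto simp: mem_cube)
      then have "indicat_real {-s..s} (z $ i) = 0" by (auto simp: indicator_def)
      then show ?thesis using False by (subst prod_zero) auto
    qed
    then show ?thesis by (simp add: prod.distrib)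
  qed
  have "integral (cube s) (\<lambda>z :: real ^ 'n. \<Prod>i\<in>UNIV. f i (z $ i)) = (\<integral>z. indicator (cube s) z *\<^sub>R (\<Prod>i\<in>UNIV. f i (z $ i)) \<partial>lborel)"
    using set_borel_integral_eq_integral(2)[of "cube s" "\<lambda>z :: real ^ 'n. \<Prod>i\<in>UNIV. f i (z $ i)"] 3
    by (auto simp: set_integrable_def set_lebesgue_integral_def)
  also have "\<dots> = (\<Prod>i\<in>UNIV. \<integral>x. indicat_real {-s..s} x * f i x \<partial>lborel)"
    unfolding 4 by (rule integral_lborel_prod_vec[OF I(1)])
  finally show ?thesis by (simp add: I(2))
qed

abbreviation gauss1 :: "real \<Rightarrow> real \<Rightarrow> real" where
  "gauss1 t \<equiv> normal_density 0 (sqrt (2 * t))"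

lemma continuous_gauss1[continuous_intros]:
  "continuous_on S f \<Longrightarrow> continuous_on S (\<lambda>x. gauss1 t (f x))"
  unfolding normal_density_def by (cases "t = 0") (auto intro!: continuous_intros)

lemma gauss1_moment:
  assumes "t > 0"
  shows "has_bochner_integral lborel (\<lambda>x. gauss1 t x * x ^ (2 * k)) (fact (2 * k) / (1 / t ^ k * fact k))"
  using normal_moment_even[of "sqrt (2 * t)" 0 k] assms by (simp add: power_divide)

lemma gauss1_moments:
  assumes "t > 0"
  shows "has_bochner_integral lborel (gauss1 t) 1"
    "has_bochner_integral lborel (\<lambda>x. gauss1 t x * x\<^sup>2) (2 * t)"
    "has_bochner_integral lborel (\<lambda>x. gauss1 t x * x ^ 4) (12 * t\<^sup>2)"
  using gauss1_moment[OF assms, of 0] gauss1_moment[OF assms, of 1] gauss1_moment[OF assms, of 2]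
  by (simp_all add: fact_numeral numeral_eq_Suc)

lemma gauss1_power_nonneg: "even k \<Longrightarrow> 0 \<le> integral {-s..s} (\<lambda>x. gauss1 t x * x ^ k)"
  by (intro Henstock_Kurzweil_Integration.integral_nonneg integrable_continuous_interval continuous_intros) (auto simp: zero_le_even_power)

text \<open>All errors caused by truncating to \<open>{-s..s}\<close> are of order \<open>t\<^sup>2\<close>: outside this interval
\<open>1 \<le> x\<^sup>4 / s\<^sup>4\<close> and \<open>x\<^sup>2 \<le> x\<^sup>4 / s\<^sup>2\<close>, and the fourth moment is \<open>12 * t\<^sup>2\<close>.\<close>

lemma gauss1_truncated:
  assumes t: "t > 0" and s: "s > 0"
  shows "1 - 12 * t\<^sup>2 / s ^ 4 \<le> integral {-s..s} (gauss1 t)"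
    "integral {-s..s} (gauss1 t) \<le> 1"
    "integral {-s..s} (\<lambda>x. gauss1 t x * x) = 0"
    "2 * t - 12 * t\<^sup>2 / s\<^sup>2 \<le> integral {-s..s} (\<lambda>x. gauss1 t x * x\<^sup>2)"
    "integral {-s..s} (\<lambda>x. gauss1 t x * x\<^sup>2) \<le> 2 * t"
    "integral {-s..s} (\<lambda>x. gauss1 t x * x ^ 4) \<le> 12 * t\<^sup>2"
    "0 \<le> integral {-s..s} (gauss1 t)"
    "0 \<le> integral {-s..s} (\<lambda>x. gauss1 t x * x ^ 4)"
proof -
  have c: "continuous_on UNIV (\<lambda>x. gauss1 t x * x ^ k)" for k
    by (intro continuous_intros)
  note m = gauss1_moments[OF t]
  have upper: "integral {-s..s} (\<lambda>x. gauss1 t x * x ^ k) \<le> M"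
    if "has_bochner_integral lborel (\<lambda>x. gauss1 t x * x ^ k) M" "even k" for k M
  proof -
    have "integral {-s..s} (\<lambda>x. gauss1 t x * x ^ k) \<le> (\<integral>x. gauss1 t x * x ^ k \<partial>lborel)"
      unfolding integral_Icc_lborel(2)[OF c]
      using that by (intro integral_mono integral_Icc_lborel(1)[OF c])
        (auto simp: indicator_def has_bochner_integral_iff zero_le_even_power)
    then show ?thesis using that by (simp add: has_bochner_integral_iff)
  qed
  have lower: "M - 12 * t\<^sup>2 / s ^ (4 - k) \<le> integral {-s..s} (\<lambda>x. gauss1 t x * x ^ k)"
    if M: "has_bochner_integral lborel (\<lambda>x. gauss1 t x * x ^ k) M" and k: "even k" "k \<le> 4" for k M
  proof -
    have "gauss1 t x * x ^ k - gauss1 t x * x ^ 4 / s ^ (4 - k) \<le> indicat_real {-s..s} x * (gauss1 t x * x ^ k)" for x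
    proof (cases "x \<in> {-s..s}")
      case True
      have "0 \<le> gauss1 t x * x ^ 4 / s ^ (4 - k)" using s by simp
      then show ?thesis using True by simp
    next
      case False
      then have "s \<le> \<bar>x\<bar>" by auto
      then have "s ^ (4 - k) \<le> \<bar>x\<bar> ^ (4 - k)" using s by (intro power_mono) auto
      then have "\<bar>x\<bar> ^ k * s ^ (4 - k) \<le> \<bar>x\<bar> ^ k * \<bar>x\<bar> ^ (4 - k)" by (intro mult_left_mono) auto
      also have "\<dots> = x ^ 4" using k by (simp flip: power_add)
      finally have "x ^ k * s ^ (4 - k) \<le> x ^ 4" using k by (simp add: power_even_abs)
      then have "x ^ k \<le> x ^ 4 / s ^ (4 - k)" using s by (simp add: field_simps)
      then have "gauss1 t x * x ^ k \<le> gauss1 t x * (x ^ 4 / s ^ (4 - k))"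
        by (intro mult_left_mono) auto
      then show ?thesis using False by simp
    qed
    then have "(\<integral>x. gauss1 t x * x ^ k - gauss1 t x * x ^ 4 / s ^ (4 - k) \<partial>lborel) \<le> integral {-s..s} (\<lambda>x. gauss1 t x * x ^ k)"
      unfolding integral_Icc_lborel(2)[OF c]
      using M m(3) by (intro integral_mono integral_Icc_lborel(1)[OF c]) (auto simp: has_bochner_integral_iff)
    moreover have "(\<integral>x. gauss1 t x * x ^ k - gauss1 t x * x ^ 4 / s ^ (4 - k) \<partial>lborel) = M - 12 * t\<^sup>2 / s ^ (4 - k)"
      using M m(3) by (subst Bochner_Integration.integral_diff) (auto simp: has_bochner_integral_iff)
    ultimately show ?thesis by simp
  qed
  show "1 - 12 * t\<^sup>2 / s ^ 4 \<le> integral {-s..s} (gauss1 t)" using lower[of 0 1] m by simp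
  show "integral {-s..s} (gauss1 t) \<le> 1" using upper[of 0 1] m by simp
  show "2 * t - 12 * t\<^sup>2 / s\<^sup>2 \<le> integral {-s..s} (\<lambda>x. gauss1 t x * x\<^sup>2)" using lower[of 2 "2 * t"] m by simp
  show "integral {-s..s} (\<lambda>x. gauss1 t x * x\<^sup>2) \<le> 2 * t" using upper[of 2 "2 * t"] m by simp
  show "integral {-s..s} (\<lambda>x. gauss1 t x * x ^ 4) \<le> 12 * t\<^sup>2" using upper[of 4] m by simp
  have "integral {-s..s} (\<lambda>x. gauss1 t x * x) = integral {-s..s} (\<lambda>x. gauss1 t (-x) * (-x))"
    using Henstock_Kurzweil_Integration.integral_reflect_real[of s "-s" "\<lambda>x. gauss1 t x * x"] by simp
  also have "\<dots> = - integral {-s..s} (\<lambda>x. gauss1 t x * x)"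
    by (simp add: normal_density_def)
  finally show "integral {-s..s} (\<lambda>x. gauss1 t x * x) = 0" by simp
  show "0 \<le> integral {-s..s} (gauss1 t)"
    using gauss1_power_nonneg[of 0 s t] by simp
  show "0 \<le> integral {-s..s} (\<lambda>x. gauss1 t x * x ^ 4)"
    using gauss1_power_nonneg[of 4 s t] by simp
qed

text \<open>The heat kernel: the variance is \<open>2 * t\<close> in each coordinate, so that the derivative in \<open>t\<close> is the
Laplacian without a factor.\<close>

definition gauss :: "real \<Rightarrow> real ^ 'n \<Rightarrow> real" where
  "gauss t z = (\<Prod>i\<in>UNIV. gauss1 t (z $ i))"

text \<open>The average is truncated to a box, without renormalising. Differentiation under the integral sign
is then an instance of the Leibniz rule on compact boxes, and the missing tail is of order \<open>t\<^sup>2\<close>, which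
is negligible against the first order in \<open>t\<close> that carries the information.\<close>

definition gauss_avg :: "real \<Rightarrow> real \<Rightarrow> (real ^ 'n \<Rightarrow> real) \<Rightarrow> real" where
  "gauss_avg s t f = integral (cube s) (\<lambda>z. gauss t z * f z)"

lemma gauss_nonneg: "0 \<le> gauss t z"
  by (auto simp: gauss_def intro!: prod_nonneg)

lemma continuous_gauss[continuous_intros]:
  "continuous_on S f \<Longrightarrow> continuous_on S (\<lambda>x. gauss t (f x))"
  unfolding gauss_def by (intro continuous_intros)

lemma gauss_avg_integrable:
  "continuous_on UNIV f \<Longrightarrow> (\<lambda>z. gauss t z * f z) integrable_on cube s"
  unfolding cube_def
  by (intro integrable_continuous continuous_intros) (auto intro: continuous_on_subset)

lemma gauss_avg_mono:
  assumes "continuous_on UNIV f" "continuous_on UNIV g" "\<And>z. z \<in> cube s \<Longrightarrow> f z \<le> g z"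
  shows "gauss_avg s t f \<le> gauss_avg s t g"
  unfolding gauss_avg_def using assms
  by (intro integral_le gauss_avg_integrable) (auto intro!: mult_left_mono gauss_nonneg)

lemma gauss_avg_add:
  assumes "continuous_on UNIV f" "continuous_on UNIV g"
  shows "gauss_avg s t (\<lambda>z. f z + g z) = gauss_avg s t f + gauss_avg s t g"
  unfolding gauss_avg_def using assms
  by (subst integral_add[symmetric]) (auto intro!: gauss_avg_integrable simp: distrib_left)

lemma gauss_avg_cmult: "gauss_avg s t (\<lambda>z. c * f z) = c * gauss_avg s t f"
  unfolding gauss_avg_def by (subst integral_mult_right[symmetric]) (simp add: algebra_simps)

lemma gauss_avg_sum:
  assumes "finite I" "\<And>i. i \<in> I \<Longrightarrow> continuous_on UNIV (f i)"
  shows "gauss_avg s t (\<lambda>z. \<Sum>i\<in>I. f i z) = (\<Sum>i\<in>I. gauss_avg s t (f i))"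
  unfolding gauss_avg_def using assms
  by (subst integral_sum[symmetric]) (auto intro!: gauss_avg_integrable simp: sum_distrib_left)

lemma gauss_avg_prod:
  fixes f :: "'n::finite \<Rightarrow> real \<Rightarrow> real"
  assumes "\<And>i. continuous_on UNIV (f i)"
  shows "gauss_avg s t (\<lambda>z :: real ^ 'n. \<Prod>i\<in>UNIV. f i (z $ i)) = (\<Prod>i\<in>UNIV. integral {-s..s} (\<lambda>x. gauss1 t x * f i x))"
  unfolding gauss_avg_def gauss_def prod.distrib[symmetric]
  by (rule integral_cube_prod) (intro continuous_intros assms)

lemma gauss_avg_power:
  fixes i :: "'n::finite"
  shows "gauss_avg s t (\<lambda>z :: real ^ 'n. (z $ i) ^ k) =
    integral {-s..s} (\<lambda>x. gauss1 t x * x ^ k) * integral {-s..s} (gauss1 t) ^ (CARD('n) - 1)"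
proof -
  have c: "continuous_on UNIV (\<lambda>x::real. if j = i then x ^ k else 1)" for j
    by (cases "j = i") (auto intro!: continuous_intros)
  have "(\<lambda>z :: real ^ 'n. (z $ i) ^ k) = (\<lambda>z. \<Prod>j\<in>UNIV. (if j = i then (z $ j) ^ k else 1))"
    by (simp add: prod.delta)
  then have "gauss_avg s t (\<lambda>z :: real ^ 'n. (z $ i) ^ k) = 
    gauss_avg s t (\<lambda>z :: real ^ 'n. \<Prod>j\<in>UNIV. (if j = i then (z $ j) ^ k else 1))"
    by (rule arg_cong)
  also have "\<dots> = (\<Prod>j\<in>UNIV. integral {-s..s} (\<lambda>x. gauss1 t x * (if j = i then x ^ k else 1)))"
    by (rule gauss_avg_prod[OF c])
  also have "\<dots> = integral {-s..s} (\<lambda>x. gauss1 t x * x ^ k) * (\<Prod>j\<in>UNIV - {i}. integral {-s..s} (\<lambda>x. gauss1 t x))"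
    by (subst prod.remove[of _ i]) (auto intro!: prod.cong)
  finally show ?thesis by (simp add: card_Diff_singleton)
qed

lemma gauss_avg_mixed:
  fixes i j :: "'n::finite"
  assumes t: "t > 0" "s > 0" and "i \<noteq> j"
  shows "gauss_avg s t (\<lambda>z :: real ^ 'n. z $ i * z $ j) = 0"
proof -
  have *: "(\<lambda>z :: real ^ 'n. z $ i * z $ j) = (\<lambda>z. \<Prod>k\<in>UNIV. ((if k = i then z $ k else 1) * (if k = j then z $ k else 1)))"
    by (simp add: prod.distrib prod.delta)
  have "continuous_on UNIV (\<lambda>x::real. (if k = i then x else 1) * (if k = j then x else 1))" for k
    by (cases "k = i"; cases "k = j") (auto intro!: continuous_intros)
  then have "gauss_avg s t (\<lambda>z :: real ^ 'n. z $ i * z $ j) = 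
    (\<Prod>k\<in>UNIV. integral {-s..s} (\<lambda>x. gauss1 t x * ((if k = i then x else 1) * (if k = j then x else 1))))"
    unfolding * by (rule gauss_avg_prod)
  also have "\<dots> = 0"
  proof (rule prod_zero[OF finite], rule bexI[of _ i])
    show "integral {-s..s} (\<lambda>x. gauss1 t x * ((if i = i then x else 1) * (if i = j then x else 1))) = 0"
      using gauss1_truncated(3)[OF t] \<open>i \<noteq> j\<close> by simp
  qed simp
  finally show ?thesis .
qed

lemma gauss_avg_1_eq: "gauss_avg s t (\<lambda>_ :: real ^ 'n. 1) = integral {-s..s} (gauss1 t) ^ CARD('n::finite)"
  using gauss_avg_prod[of "\<lambda>(_ :: 'n) _. 1" s t] by simp

lemma power_ge_Bernoulli:
  fixes a c :: real
  assumes "0 \<le> a" "1 - c \<le> a"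
  shows "1 - real n * c \<le> a ^ n"
proof (cases "a \<le> 1")
  case True
  have "1 + real n * (a - 1) \<le> (1 + (a - 1)) ^ n" by (rule Bernoulli_inequality) (use assms in auto)
  moreover have "real n * (1 - a) \<le> real n * c" using assms by (intro mult_left_mono) auto
  ultimately show ?thesis by (simp add: algebra_simps)
next
  case False
  show ?thesis
  proof (cases "c \<ge> 0")
    case True
    have "1 \<le> a ^ n" using False by (intro one_le_power) auto
    moreover have "0 \<le> real n * c" using True by simp
    ultimately show ?thesis by linarith
  next
    case c: False
    have "1 + real n * (-c) \<le> (1 + (-c)) ^ n" by (rule Bernoulli_inequality) (use c in auto)
    also have "\<dots> \<le> a ^ n" using assms c by (intro power_mono) auto
    finally show ?thesis by simp
  qed
qed

lemma gauss_avg_1: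
  assumes "t > 0" "s > 0"
  shows "gauss_avg s t (\<lambda>_ :: real ^ 'n. 1) \<le> 1" "1 - real CARD('n) * (12 * t\<^sup>2 / s ^ 4) \<le> gauss_avg s t (\<lambda>_ :: real ^ 'n::finite. 1)"
proof -
  note g = gauss1_truncated[OF assms]
  show "gauss_avg s t (\<lambda>_ :: real ^ 'n. 1) \<le> 1"
    unfolding gauss_avg_1_eq using g by (intro power_le_one) auto
  show "1 - real CARD('n) * (12 * t\<^sup>2 / s ^ 4) \<le> gauss_avg s t (\<lambda>_ :: real ^ 'n. 1)"
    unfolding gauss_avg_1_eq by (rule power_ge_Bernoulli[OF g(7) g(1)])
qed

text \<open>Affine parts are averaged exactly up to the missing mass, mixed second moments vanish by symmetry,
and each square contributes \<open>2 * t\<close>. The error is uniform in the linear part \<open>l\<close>, which allows its use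
with an uncontrolled subgradient.\<close>

lemma gauss_avg_quadratic:
  fixes B :: "real ^ 'n ^ 'n"
  assumes s: "s > 0"
  shows "\<exists>C\<ge>0. \<forall>t c l. 0 < t \<longrightarrow> t \<le> 1 \<longrightarrow>
    \<bar>gauss_avg s t (\<lambda>z. c + l \<bullet> z + z \<bullet> (B *v z)) - (c + 2 * t * trace B)\<bar> \<le> C * (\<bar>c\<bar> + 1) * t\<^sup>2"
proof -
  define N where "N = real CARD('n)"
  define k where "k = 12 / s\<^sup>2 + 2 * N * (12 / s ^ 4)"
  define C where "C = N * (12 / s ^ 4) + k * (\<Sum>i\<in>UNIV. \<bar>B $ i $ i\<bar>)"
  have N0: "N \<ge> 1" unfolding N_def by (simp add: Suc_leI)
  have k0: "k \<ge> 0" unfolding k_def using N0 s by simp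
  have C0: "C \<ge> 0" unfolding C_def using N0 s k0 by (simp add: sum_nonneg)
  have "\<bar>gauss_avg s t (\<lambda>z. c + l \<bullet> z + z \<bullet> (B *v z)) - (c + 2 * t * trace B)\<bar> \<le> C * (\<bar>c\<bar> + 1) * t\<^sup>2"
    if t: "0 < t" "t \<le> 1" for t c and l :: "real ^ 'n"
  proof -
    note g = gauss1_truncated[OF t(1) s]
    let ?a = "integral {-s..s} (gauss1 t)" and ?b = "integral {-s..s} (\<lambda>x. gauss1 t x * x\<^sup>2)"
    have lin: "gauss_avg s t (\<lambda>z :: real ^ 'n. z $ i) = 0" for i
      using gauss_avg_power[of s t i 1] g(3) by simp
    have sq: "\<bar>gauss_avg s t (\<lambda>z :: real ^ 'n. z $ i * z $ i) - 2 * t\<bar> \<le> k * t\<^sup>2" for i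
    proof -
      let ?p = "?a ^ (CARD('n) - 1)"
      have e: "gauss_avg s t (\<lambda>z :: real ^ 'n. z $ i * z $ i) = ?b * ?p"
        using gauss_avg_power[of s t i 2] by (simp add: power2_eq_square)
      have b0: "0 \<le> ?b"
        using gauss1_power_nonneg[of 2 s t] by simp
      have p1: "?p \<le> 1" using g by (intro power_le_one) auto
      have p0: "0 \<le> ?p" using g by simp
      have "1 - real (CARD('n) - 1) * (12 * t\<^sup>2 / s ^ 4) \<le> ?p" using g by (intro power_ge_Bernoulli) auto
      moreover have "real (CARD('n) - 1) * (12 * t\<^sup>2 / s ^ 4) \<le> N * (12 * t\<^sup>2 / s ^ 4)"
        unfolding N_def using s by (intro mult_right_mono) auto
      ultimately have p2: "1 - ?p \<le> N * (12 * t\<^sup>2 / s ^ 4)" by linarith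
      have "?b * (1 - ?p) \<le> 2 * (N * (12 * t\<^sup>2 / s ^ 4))"
        using p2 p1 g(5) t b0 by (intro mult_mono) auto
      moreover have "?b * ?p \<le> ?b" using b0 p1 by (simp add: mult_left_le)
      moreover have "k * t\<^sup>2 = 12 * t\<^sup>2 / s\<^sup>2 + 2 * (N * (12 * t\<^sup>2 / s ^ 4))"
        unfolding k_def by (simp add: algebra_simps)
      ultimately show ?thesis unfolding e using g(4,5) p0 b0
        by (simp add: algebra_simps abs_le_iff)
    qed
    have e1: "c + l \<bullet> z + z \<bullet> (B *v z) = c * 1 + ((\<Sum>i\<in>UNIV. l $ i * z $ i) + (\<Sum>i\<in>UNIV. \<Sum>j\<in>UNIV. B $ i $ j * (z $ i * z $ j)))" for z
      by (simp add: inner_vec_def matrix_vector_mult_def sum_distrib_left algebra_simps)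
    have "gauss_avg s t (\<lambda>z. c + l \<bullet> z + z \<bullet> (B *v z)) = c * gauss_avg s t (\<lambda>_ :: real ^ 'n. 1) +
      ((\<Sum>i\<in>UNIV. l $ i * gauss_avg s t (\<lambda>z. z $ i)) + (\<Sum>i\<in>UNIV. \<Sum>j\<in>UNIV. B $ i $ j * gauss_avg s t (\<lambda>z. z $ i * z $ j)))"
      unfolding e1 by (simp only: gauss_avg_add gauss_avg_sum gauss_avg_cmult continuous_intros finite)
    also have "(\<Sum>i\<in>UNIV. \<Sum>j\<in>UNIV. B $ i $ j * gauss_avg s t (\<lambda>z. z $ i * z $ j)) = (\<Sum>i\<in>UNIV. B $ i $ i * gauss_avg s t (\<lambda>z. z $ i * z $ i))"
    proof (rule sum.cong[OF refl])
      fix i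
      show "(\<Sum>j\<in>UNIV. B $ i $ j * gauss_avg s t (\<lambda>z. z $ i * z $ j)) = B $ i $ i * gauss_avg s t (\<lambda>z. z $ i * z $ i)"
        by (subst sum.remove[of _ i]) (auto intro!: sum.neutral simp: gauss_avg_mixed[OF t(1) s])
    qed
    finally have e2: "gauss_avg s t (\<lambda>z. c + l \<bullet> z + z \<bullet> (B *v z)) - (c + 2 * t * trace B) = 
        c * (gauss_avg s t (\<lambda>_ :: real ^ 'n. 1) - 1) + (\<Sum>i\<in>UNIV. B $ i $ i * (gauss_avg s t (\<lambda>z. z $ i * z $ i) - 2 * t))"
      by (simp add: lin trace_def sum_distrib_left algebra_simps sum_subtractf)
    have "\<bar>gauss_avg s t (\<lambda>_ :: real ^ 'n. 1) - 1\<bar> \<le> N * (12 / s ^ 4) * t\<^sup>2"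
      using gauss_avg_1[OF t(1) s, where 'n='n] unfolding N_def by (simp add: abs_le_iff)
    then have "\<bar>c * (gauss_avg s t (\<lambda>_ :: real ^ 'n. 1) - 1)\<bar> \<le> \<bar>c\<bar> * (N * (12 / s ^ 4) * t\<^sup>2)"
      unfolding abs_mult by (intro mult_left_mono) auto
    moreover have "\<bar>\<Sum>i\<in>UNIV. B $ i $ i * (gauss_avg s t (\<lambda>z. z $ i * z $ i) - 2 * t)\<bar> \<le> (\<Sum>i\<in>UNIV. \<bar>B $ i $ i\<bar> * (k * t\<^sup>2))"
      by (intro order.trans[OF sum_abs] sum_mono) (auto simp: abs_mult intro!: mult_left_mono sq)
    ultimately have "\<bar>gauss_avg s t (\<lambda>z. c + l \<bullet> z + z \<bullet> (B *v z)) - (c + 2 * t * trace B)\<bar>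
       \<le> \<bar>c\<bar> * (N * (12 / s ^ 4) * t\<^sup>2) + k * t\<^sup>2 * (\<Sum>i\<in>UNIV. \<bar>B $ i $ i\<bar>)"
      unfolding e2 by (simp add: sum_distrib_left mult.commute)
    also have "\<dots> \<le> C * (\<bar>c\<bar> + 1) * t\<^sup>2"
    proof -
      define w where "w = N * (12 / s ^ 4)"
      define S where "S = (\<Sum>i\<in>UNIV. \<bar>B $ i $ i\<bar>)"
      have "w \<ge> 0" "S \<ge> 0" unfolding w_def S_def using N0 s by (auto intro: sum_nonneg)
      then have "0 \<le> w * t\<^sup>2" "0 \<le> \<bar>c\<bar> * (k * t\<^sup>2 * S)" using k0 by auto
      moreover have "C = w + k * S" unfolding C_def w_def S_def by simp
      then have "C * (\<bar>c\<bar> + 1) * t\<^sup>2 = \<bar>c\<bar> * (w * t\<^sup>2) + k * t\<^sup>2 * S + w * t\<^sup>2 + \<bar>c\<bar> * (k * t\<^sup>2 * S)"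
        by (simp add: algebra_simps)
      ultimately show ?thesis unfolding w_def[symmetric] S_def[symmetric] by linarith
    qed
    finally show ?thesis .
  qed
  then show ?thesis using C0 by blast
qed

text \<open>Fourth powers serve to dominate, away from the origin, functions on which only a bound is known;
they cost only \<open>t\<^sup>2\<close>.\<close>

lemma gauss_avg_quartic:
  assumes t: "t > 0" and s: "s > 0"
  shows "gauss_avg s t (\<lambda>z :: real ^ 'n. norm z ^ 4) \<le> 12 * (real CARD('n))\<^sup>2 * t\<^sup>2"
proof -
  have le: "norm z ^ 4 \<le> real CARD('n) * (\<Sum>i\<in>UNIV. (z $ i) ^ 4)" for z :: "real ^ 'n"
  proof -
    have "norm z ^ 4 = (\<Sum>i\<in>UNIV. (z $ i)\<^sup>2)\<^sup>2"
      by (simp add: norm_vec_def L2_set_def power4_eq_xxxx power2_eq_square sum_nonneg flip: real_sqrt_mult)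
    also have "\<dots> \<le> (\<Sum>i\<in>UNIV. ((z $ i)\<^sup>2)\<^sup>2) * real CARD('n)"
      using sum_squared_le_sum_of_squares[of "\<lambda>i. (z $ i)\<^sup>2" UNIV] by simp
    finally show ?thesis by (simp add: mult.commute flip: power_mult)
  qed
  have "gauss_avg s t (\<lambda>z :: real ^ 'n. norm z ^ 4) \<le> gauss_avg s t (\<lambda>z :: real ^ 'n. real CARD('n) * (\<Sum>i\<in>UNIV. (z $ i) ^ 4))"
    by (intro gauss_avg_mono continuous_intros le)
  also have "\<dots> = real CARD('n) * (\<Sum>i\<in>UNIV. gauss_avg s t (\<lambda>z :: real ^ 'n. (z $ i) ^ 4))"
    by (simp only: gauss_avg_sum gauss_avg_cmult continuous_intros finite)
  also have "\<dots> \<le> real CARD('n) * (\<Sum>i\<in>(UNIV :: 'n set). 12 * t\<^sup>2)"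
  proof (intro mult_left_mono sum_mono)
    fix i :: 'n
    note g = gauss1_truncated[OF t s]
    have "integral {-s..s} (\<lambda>x. gauss1 t x * x ^ 4) * integral {-s..s} (gauss1 t) ^ (CARD('n) - 1) \<le> 12 * t\<^sup>2 * 1"
      using g by (intro mult_mono power_le_one) auto
    then show "gauss_avg s t (\<lambda>z :: real ^ 'n. (z $ i) ^ 4) \<le> 12 * t\<^sup>2" unfolding gauss_avg_power by simp
  qed auto
  finally show ?thesis by (simp add: power2_eq_square mult_ac)
qed

section \<open>The heat extension of a function\<close>

lemma gauss_eq:
  fixes z :: "real ^ 'n"
  assumes "t > 0"
  shows "gauss t z = (1 / sqrt (4 * pi * t)) ^ CARD('n) * exp (- (z \<bullet> z) / (4 * t))"
proof -
  have "gauss t z = (\<Prod>i\<in>UNIV. 1 / sqrt (4 * pi * t) * exp (- (z $ i * z $ i) / (4 * t)))"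
    unfolding gauss_def normal_density_def using assms by (simp add: power2_eq_square mult_ac)
  also have "\<dots> = (1 / sqrt (4 * pi * t)) ^ CARD('n) * exp (\<Sum>i\<in>UNIV. - (z $ i * z $ i) / (4 * t))"
    by (simp add: prod.distrib prod_dividef exp_sum power_one_over)
  also have "(\<Sum>i\<in>UNIV. - (z $ i * z $ i) / (4 * t)) = - (z \<bullet> z) / (4 * t)"
    by (simp add: inner_vec_def sum_negf sum_divide_distrib)
  finally show ?thesis .
qed

lemma gauss_minus: "gauss t (- z) = gauss t z"
  by (simp add: gauss_def normal_density_def)

lemma continuous_on_gauss_pair:
  "continuous_on ({0<..} \<times> UNIV) (\<lambda>(t, z :: real ^ 'n). gauss t z)"
proof -
  have "continuous_on ({0<..} \<times> UNIV) (\<lambda>(t, z :: real ^ 'n). (1 / sqrt (4 * pi * t)) ^ CARD('n) * exp (- (z \<bullet> z) / (4 * t)))"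
    unfolding case_prod_unfold by (intro continuous_intros) auto
  then show ?thesis
    by (rule continuous_on_cong[THEN iffD1, rotated -1]) (auto simp: gauss_eq)
qed

lemma GDERIV_gauss:
  assumes "t > 0"
  shows "GDERIV (gauss t) z :> (- (gauss t z / (2 * t))) *\<^sub>R z"
  unfolding gderiv_def gauss_eq[OF assms, abs_def]
  using assms by (auto intro!: derivative_eq_intros simp: inner_commute field_simps)

lemma DERIV_gauss:
  fixes z :: "real ^ 'n"
  assumes t: "t > 0"
  shows "((\<lambda>t. gauss t z) has_real_derivative ((z \<bullet> z) / (4 * t\<^sup>2) - real CARD('n) / (2 * t)) * gauss t z) (at t)"
proof -
  let ?N = "CARD('n)"
  have "((\<lambda>t. 1 / sqrt (4 * pi * t)) has_real_derivative - (1 / (2 * t)) * (1 / sqrt (4 * pi * t))) (at t)"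
    using t by (auto intro!: derivative_eq_intros simp: field_simps real_sqrt_mult)
  from DERIV_power[OF this, of ?N]
  have 1: "((\<lambda>t. (1 / sqrt (4 * pi * t)) ^ ?N) has_real_derivative
     - (real ?N / (2 * t)) * (1 / sqrt (4 * pi * t)) ^ ?N) (at t)"
  proof (rule DERIV_cong)
    have "(1 / sqrt (4 * pi * t)) ^ ?N = (1 / sqrt (4 * pi * t)) * (1 / sqrt (4 * pi * t)) ^ (?N - 1)"
      by (metis power_eq_if zero_less_card_finite less_irrefl)
    then show "real ?N * (- (1 / (2 * t)) * (1 / sqrt (4 * pi * t)) * (1 / sqrt (4 * pi * t)) ^ (?N - Suc 0))
      = - (real ?N / (2 * t)) * (1 / sqrt (4 * pi * t)) ^ ?N"
      by simp
  qed
  have 2: "((\<lambda>t. exp (- (z \<bullet> z) / (4 * t))) has_real_derivative (z \<bullet> z) / (4 * t\<^sup>2) * exp (- (z \<bullet> z) / (4 * t))) (at t)"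
    using t by (auto intro!: derivative_eq_intros simp: field_simps power2_eq_square)
  have "((\<lambda>t. (1 / sqrt (4 * pi * t)) ^ ?N * exp (- (z \<bullet> z) / (4 * t))) has_real_derivative
     ((z \<bullet> z) / (4 * t\<^sup>2) - real ?N / (2 * t)) * gauss t z) (at t)"
    by (rule DERIV_cong[OF DERIV_mult[OF 1 2]]) (simp add: gauss_eq[OF t] algebra_simps)
  moreover have "eventually (\<lambda>t. gauss t z = (1 / sqrt (4 * pi * t)) ^ ?N * exp (- (z \<bullet> z) / (4 * t))) (nhds t)"
    using eventually_nhds_in_open[of "{0<..}" t] t by (auto elim!: eventually_mono simp: gauss_eq)
  ultimately show ?thesis by (subst DERIV_cong_ev[OF refl _ refl]) auto
qed

lemma GDERIV_integral:
  fixes a :: "real ^ 'n \<Rightarrow> real ^ 'm \<Rightarrow> real"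
  assumes der: "\<And>x y. GDERIV (\<lambda>x. a x y) x :> ga x y"
    and ga: "continuous_on UNIV (\<lambda>(x, y). ga x y)"
    and a: "\<And>x. continuous_on (cbox l u) (a x)"
  shows "GDERIV (\<lambda>x. integral (cbox l u) (a x)) x :> integral (cbox l u) (ga x)"
proof -
  have i: "(ga x) integrable_on cbox l u"
    by (rule integrable_continuous) (rule continuous_on_compose2[OF ga, of _ "\<lambda>y. (x, y)", simplified], auto intro!: continuous_intros)
  have "((\<lambda>x. integral (cbox l u) (a x)) has_derivative
      blinfun_apply (integral (cbox l u) (\<lambda>y. blinfun_inner_left (ga x y)))) (at x within UNIV)"
  proof (rule leibniz_rule)
    show "((\<lambda>x. a x t) has_derivative blinfun_apply (blinfun_inner_left (ga x t))) (at x within UNIV)" for x t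
      using der[of t x] by (simp add: gderiv_def)
    show "continuous_on (UNIV \<times> cbox l u) (\<lambda>(x, t). blinfun_inner_left (ga x t))"
      using continuous_on_subset[OF ga, of "UNIV \<times> cbox l u"]
      by (auto simp: case_prod_unfold intro!: continuous_intros bounded_linear.continuous_on[OF bounded_linear_blinfun_inner_left])
  qed (auto intro!: integrable_continuous a)
  moreover have "integral (cbox l u) (\<lambda>y. blinfun_inner_left (ga x y)) = blinfun_inner_left (integral (cbox l u) (ga x))"
    using integral_linear[OF i bounded_linear_blinfun_inner_left] by (simp add: o_def)
  ultimately show ?thesis by (simp add: gderiv_def)
qed

lemma continuous_on_compose_UNIV:
  "continuous_on UNIV u \<Longrightarrow> continuous_on S f \<Longrightarrow> continuous_on S (\<lambda>x. u (f x))"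
  using continuous_on_compose2 by blast

definition heat :: "real \<Rightarrow> (real ^ 'n \<Rightarrow> real) \<Rightarrow> real \<Rightarrow> real ^ 'n \<Rightarrow> real" where
  "heat s u t x = integral (cube s) (\<lambda>y. gauss t (x - y) * u y)"

definition heat_D :: "real \<Rightarrow> (real ^ 'n \<Rightarrow> real) \<Rightarrow> real \<Rightarrow> real ^ 'n \<Rightarrow> real ^ 'n" where
  "heat_D s u t x = (\<chi> i. integral (cube s) (\<lambda>y. - (gauss t (x - y) * (x - y) $ i / (2 * t)) * u y))"

definition heat_D2 :: "real \<Rightarrow> (real ^ 'n \<Rightarrow> real) \<Rightarrow> real \<Rightarrow> real ^ 'n \<Rightarrow> real ^ 'n ^ 'n" where
  "heat_D2 s u t x = (\<chi> i j. integral (cube s) (\<lambda>y. (gauss t (x - y) * (x - y) $ i * (x - y) $ j / (4 * t\<^sup>2)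
      - (if i = j then gauss t (x - y) / (2 * t) else 0)) * u y))"

lemma has_derivative_vecI:
  fixes f :: "'a::real_normed_vector \<Rightarrow> real ^ 'n"
  assumes "\<And>i. ((\<lambda>x. f x $ i) has_derivative (\<lambda>h. f' h $ i)) (at x)"
  shows "(f has_derivative f') (at x)"
  using assms by (subst has_derivative_componentwise_within)
    (auto simp: Basis_vec_def simp flip: cart_eq_inner_axis)

lemma C2_with_heat:
  fixes u :: "real ^ 'n \<Rightarrow> real"
  assumes t: "t > 0" and u: "continuous_on UNIV u"
  shows "C2_with (heat s u t) (heat_D s u t) (heat_D2 s u t)"
proof -
  note cu = continuous_on_compose_UNIV[OF u]
  have ci: "continuous_on S (\<lambda>x. if P then f x else 0)" if "continuous_on S f" for S P and f :: "'z::topological_space \<Rightarrow> real"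
    using that by (cases P) auto
  let ?g1 = "\<lambda>x y. (- (gauss t (x - y) / (2 * t)) * u y) *\<^sub>R (x - y)"
  let ?g2 = "\<lambda>i x y. (gauss t (x - y) * (x - y) $ i / (4 * t\<^sup>2) * u y) *\<^sub>R (x - y) - (gauss t (x - y) / (2 * t) * u y) *\<^sub>R axis i 1"
  have g: "GDERIV (\<lambda>x. gauss t (x - y)) x :> (- (gauss t (x - y) / (2 * t))) *\<^sub>R (x - y)" for x y :: "real ^ 'n"
  proof -
    have "((\<lambda>x. x - y) has_derivative (\<lambda>h. h)) (at x)"
      by (auto intro!: derivative_eq_intros)
    from has_derivative_compose[OF this GDERIV_gauss[OF t, unfolded gderiv_def]]
    show ?thesis unfolding gderiv_def .
  qed
  have n: "GDERIV (\<lambda>x. (x - y) $ i) x :> axis i (1::real)" for x y :: "real ^ 'n" and i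
  proof -
    have "((\<lambda>x. x - y) has_derivative (\<lambda>h. h)) (at x)"
      by (auto intro!: derivative_eq_intros)
    from bounded_linear.has_derivative[OF bounded_linear_vec_nth this, of i]
    show ?thesis by (simp add: gderiv_def inner_axis)
  qed
  have 1: "GDERIV (heat s u t) x :> heat_D s u t x" for x
  proof -
    have "GDERIV (heat s u t) x :> integral (cube s) (?g1 x)"
      unfolding heat_def[abs_def] cube_def
    proof (rule GDERIV_integral)
      show "GDERIV (\<lambda>x. gauss t (x - y) * u y) x :> ?g1 x y" for x y
        using GDERIV_mult[OF g[of y x] GDERIV_const[of "u y" x]] by (simp add: mult.commute)
      show "continuous_on UNIV (\<lambda>(x, y). ?g1 x y)"
        unfolding case_prod_unfold using t by (intro continuous_intros cu) auto
      show "continuous_on (cbox l r) (\<lambda>y. gauss t (x - y) * u y)" for x l r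
        by (intro continuous_intros cu)
    qed
    moreover have "integral (cube s) (?g1 x) = heat_D s u t x"
    proof (rule vec_eq_iff[THEN iffD2], rule allI)
      fix i
      have "(?g1 x) integrable_on cube s"
        unfolding cube_def using t by (intro integrable_continuous continuous_intros cu) auto
      from integral_component_eq_cart[OF this, of i]
      show "integral (cube s) (?g1 x) $ i = heat_D s u t x $ i"
        unfolding heat_D_def by (simp add: mult_ac)
    qed
    ultimately show ?thesis by simp
  qed
  have 2: "GDERIV (\<lambda>x. heat_D s u t x $ i) x :> heat_D2 s u t x $ i" for x i
  proof -
    have "GDERIV (\<lambda>x. heat_D s u t x $ i) x :> integral (cube s) (?g2 i x)"
      unfolding heat_D_def[abs_def] cube_def vec_lambda_beta
    proof (rule GDERIV_integral)
      show "GDERIV (\<lambda>x. - (gauss t (x - y) * (x - y) $ i / (2 * t)) * u y) x :> ?g2 i x y" for x y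
      proof -
        have "GDERIV (\<lambda>x. (gauss t (x - y) * (x - y) $ i) * (- (u y / (2 * t)))) x :> ?g2 i x y"
          by (rule GDERIV_subst[OF GDERIV_mult[OF GDERIV_mult[OF g n] GDERIV_const]])
            (use t in \<open>simp add: vec_eq_iff field_simps power2_eq_square\<close>)
        then show ?thesis by (simp add: mult_ac)
      qed
      show "continuous_on UNIV (\<lambda>(x, y). ?g2 i x y)"
        unfolding case_prod_unfold using t by (intro continuous_intros cu) auto
      show "continuous_on (cbox l r) (\<lambda>y. - (gauss t (x - y) * (x - y) $ i / (2 * t)) * u y)" for x l r
        using t by (intro continuous_intros cu) auto
    qed
    moreover have "integral (cube s) (?g2 i x) = heat_D2 s u t x $ i"
    proof (rule vec_eq_iff[THEN iffD2], rule allI)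
      fix j
      have "(?g2 i x) integrable_on cube s"
        unfolding cube_def using t by (intro integrable_continuous continuous_intros cu) auto
      from integral_component_eq_cart[OF this, of j]
      have "integral (cube s) (?g2 i x) $ j = integral (cube s) (\<lambda>y. ?g2 i x y $ j)" by simp
      also have "\<dots> = heat_D2 s u t x $ i $ j"
      proof -
        have "((G * w $ i / (4 * t\<^sup>2) * c) *\<^sub>R w - (G / (2 * t) * c) *\<^sub>R axis i 1) $ j
          = (G * w $ i * w $ j / (4 * t\<^sup>2) - (if i = j then G / (2 * t) else 0)) * c" for G c and w :: "real ^ 'n"
          by (simp add: axis_def algebra_simps)
        then show ?thesis unfolding heat_D2_def vec_lambda_beta by (intro integral_cong) blast
      qed
      finally show "integral (cube s) (?g2 i x) $ j = heat_D2 s u t x $ i $ j" .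
    qed
    ultimately show ?thesis by simp
  qed
  have 3: "(heat_D s u t has_derivative (\<lambda>h. heat_D2 s u t x *v h)) (at x)" for x
    using 2 by (intro has_derivative_vecI) (simp add: gderiv_def matrix_vector_mul_component inner_commute)
  have 4: "continuous_on UNIV (heat_D2 s u t)"
    unfolding heat_D2_def[abs_def] cube_def
    using t by (intro continuous_on_vec_lambda integral_continuous_on_param)
      (auto simp: case_prod_unfold intro!: continuous_intros cu ci)
  show ?thesis unfolding C2_with_def using 1 3 4 by auto
qed

lemma DERIV_heat:
  fixes u :: "real ^ 'n \<Rightarrow> real"
  assumes t: "t > 0" and u: "continuous_on UNIV u"
  shows "((\<lambda>t. heat s u t x) has_real_derivative trace (heat_D2 s u t x)) (at t)"
proof -
  note cu = continuous_on_compose_UNIV[OF u]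
  let ?k = "\<lambda>t y. ((x - y) \<bullet> (x - y)) / (4 * t\<^sup>2) - real CARD('n) / (2 * t)"
  let ?s = "\<lambda>i y. (gauss t (x - y) * (x - y) $ i * (x - y) $ i / (4 * t\<^sup>2) - gauss t (x - y) / (2 * t)) * u y"
  have cg: "continuous_on ({0<..} \<times> cube s) (\<lambda>p. gauss (fst p) (x - snd p))"
    by (rule continuous_on_compose2[OF continuous_on_gauss_pair, of _ "\<lambda>p. (fst p, x - snd p)", simplified])
      (auto intro!: continuous_intros)
  have "((\<lambda>t. heat s u t x) has_real_derivative integral (cube s) (\<lambda>y. ?k t y * gauss t (x - y) * u y)) (at t within {0<..})"
    unfolding heat_def cube_def
  proof (rule leibniz_rule_field_derivative)
    show "((\<lambda>t. gauss t (x - y) * u y) has_real_derivative ?k t y * gauss t (x - y) * u y) (at t within {0<..})"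
      if "t \<in> {0<..}" for t y
      using DERIV_cmult_right[OF has_field_derivative_at_within[OF DERIV_gauss[of t "x - y"], of "{0<..}"], of "u y"] that by simp
    show "(\<lambda>y. gauss t (x - y) * u y) integrable_on cbox l r" for t l r
      by (intro integrable_continuous continuous_intros cu)
    show "continuous_on ({0<..} \<times> cbox (\<chi> i. - s) (\<chi> i. s)) (\<lambda>(t, y). ?k t y * gauss t (x - y) * u y)"
      using cg unfolding case_prod_unfold cube_def by (intro continuous_intros cu) auto
  qed (use t in auto)
  then have "((\<lambda>t. heat s u t x) has_real_derivative integral (cube s) (\<lambda>y. ?k t y * gauss t (x - y) * u y)) (at t)"
    using t by (subst (asm) at_within_open) auto
  moreover have "integral (cube s) (\<lambda>y. ?k t y * gauss t (x - y) * u y) = trace (heat_D2 s u t x)"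
  proof -
    have "trace (heat_D2 s u t x) = (\<Sum>i\<in>UNIV. integral (cube s) (\<lambda>y. ?s i y))"
      by (simp add: trace_def heat_D2_def)
    also have "\<dots> = integral (cube s) (\<lambda>y. \<Sum>i\<in>UNIV. ?s i y)"
    proof (rule integral_sum[symmetric])
      show "(\<lambda>y. ?s i y)
        integrable_on cube s" for i
        unfolding cube_def using t by (intro integrable_continuous continuous_intros cu) auto
    qed simp
    also have "(\<lambda>y. \<Sum>i\<in>UNIV. ?s i y) = (\<lambda>y. ?k t y * gauss t (x - y) * u y)"
    proof
      fix y
      have "(\<Sum>i\<in>UNIV. ?s i y)
        = (gauss t (x - y) / (4 * t\<^sup>2) * (\<Sum>i\<in>UNIV. (x - y) $ i * (x - y) $ i) - real CARD('n) * (gauss t (x - y) / (2 * t))) * u y"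
      proof -
        have "(\<Sum>i\<in>UNIV. G * w $ i * w $ i / a - b) = G / a * (\<Sum>i\<in>UNIV. w $ i * w $ i) - real CARD('n) * b"
          for G a b and w :: "real ^ 'n"
          by (simp add: sum_subtractf sum_distrib_left sum_divide_distrib mult.assoc)
        then show ?thesis by (simp only: sum_distrib_right[symmetric])
      qed
      then show "(\<Sum>i\<in>UNIV. ?s i y) = ?k t y * gauss t (x - y) * u y"
        by (simp add: inner_vec_def left_diff_distrib right_diff_distrib mult_ac del: vector_minus_component)
    qed
    finally show ?thesis by simp
  qed
  ultimately show ?thesis by simp
qed

lemma continuous_on_heat:
  fixes u :: "real ^ 'n \<Rightarrow> real"
  assumes u: "continuous_on UNIV u"
  shows "continuous_on ({0<..} \<times> UNIV) (\<lambda>(t, x). heat s u t x)"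
proof -
  note cu = continuous_on_compose_UNIV[OF u]
  have cg: "continuous_on (({0<..} \<times> UNIV) \<times> cube s) (\<lambda>p. gauss (fst (fst p)) (snd (fst p) - snd p))"
    by (rule continuous_on_compose2[OF continuous_on_gauss_pair, of _ "\<lambda>p. (fst (fst p), snd (fst p) - snd p)", simplified])
      (auto intro!: continuous_intros)
  show ?thesis unfolding case_prod_unfold heat_def cube_def
    by (rule integral_continuous_on_param)
      (use cg in \<open>auto simp: case_prod_unfold cube_def intro!: continuous_intros cu\<close>)
qed

lemma heat_0: "heat s u t 0 = gauss_avg s t u"
  by (simp add: heat_def gauss_avg_def gauss_minus)

section \<open>Submean inequality for semiconvex viscosity subsolutions\<close>

text \<open>Semiconvexity in the form in which it is used: at every point a paraboloid of opening \<open>c\<close> touches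
from below.\<close>

definition semiconvex :: "real \<Rightarrow> (real ^ 'n \<Rightarrow> real) \<Rightarrow> bool" where
  "semiconvex c u \<longleftrightarrow> (\<forall>x. \<exists>q. \<forall>z. u x + q \<bullet> z - c * (norm z)\<^sup>2 \<le> u (x + z))"

definition laplacian_ge :: "real \<Rightarrow> real \<Rightarrow> (real ^ 'n \<Rightarrow> real) \<Rightarrow> bool" where
  "laplacian_ge f \<rho> u \<longleftrightarrow> (\<forall>\<theta> D D2 x. C2_with \<theta> D D2 \<longrightarrow> norm x < \<rho> \<longrightarrow>
     (\<forall>\<^sub>F y in nhds x. u y - \<theta> y \<le> u x - \<theta> x) \<longrightarrow> f \<le> trace (D2 x))"

lemma C2_with_add:
  assumes "C2_with f Df D2f" "C2_with g Dg D2g"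
  shows "C2_with (\<lambda>x. f x + g x) (\<lambda>x. Df x + Dg x) (\<lambda>x. D2f x + D2g x)"
proof -
  have "(*v) (D2f x + D2g x) = (\<lambda>h. D2f x *v h + D2g x *v h)" for x
    by (rule ext) (rule matrix_vector_mult_add_rdistrib)
  then show ?thesis using assms unfolding C2_with_def
    by (auto intro!: GDERIV_add continuous_intros has_derivative_add)
qed

lemma C2_with_square: "C2_with (\<lambda>x. b * (x \<bullet> x)) (\<lambda>x. (2 * b) *\<^sub>R x) (\<lambda>_. (2 * b) *\<^sub>R mat 1)"
  unfolding C2_with_def gderiv_def
  by (auto intro!: derivative_eq_intros simp: inner_commute scaleR_matrix_vector_assoc[symmetric] matrix_vector_mul_lid)

lemma C2_with_scale:
  assumes "C2_with f D D2"
  shows "C2_with (\<lambda>x. k * f x) (\<lambda>x. k *\<^sub>R D x) (\<lambda>x. k *\<^sub>R D2 x)"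
  using assms unfolding C2_with_def gderiv_def
  by (auto intro!: derivative_eq_intros continuous_intros simp: scaleR_matrix_vector_assoc[symmetric])

lemma trace_scaleR: "trace (c *\<^sub>R (A :: real ^ 'n ^ 'n)) = c * trace A"
  by (simp add: trace_def sum_distrib_left)

text \<open>Averaging the paraboloid that touches \<open>u\<close> at \<open>x\<close> from below loses at most a multiple of \<open>t\<close>: the
first order part has mean zero. The constant is uniform in \<open>x\<close>, which gives the boundary
inequality of the comparison in \<open>gaussian_submean_nonneg\<close>. Since \<open>u \<ge> 0\<close>, the integral over the
large box is at least the one over the unit box centred at \<open>x\<close>.\<close>

lemma heat_lower_bound:
  fixes u :: "real ^ 'n \<Rightarrow> real"
  assumes u: "continuous_on UNIV u" and nn: "\<And>x. 0 \<le> u x" and B: "\<And>x. u x \<le> B"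
    and c: "0 \<le> c" and sc: "semiconvex c u"
  shows "\<exists>C\<ge>0. \<forall>t x. 0 < t \<longrightarrow> t \<le> 1 \<longrightarrow> norm x \<le> 1 \<longrightarrow> u x - C * t \<le> heat 2 u t x"
proof -
  note cu = continuous_on_compose_UNIV[OF u]
  let ?B = "(- c) *\<^sub>R mat 1 :: real ^ 'n ^ 'n"
  obtain C0 where C0: "C0 \<ge> 0" "\<And>t d l. 0 < t \<Longrightarrow> t \<le> 1 \<Longrightarrow>
    \<bar>gauss_avg 1 t (\<lambda>z. d + l \<bullet> z + z \<bullet> (?B *v z)) - (d + 2 * t * trace ?B)\<bar> \<le> C0 * (\<bar>d\<bar> + 1) * t\<^sup>2"
    using gauss_avg_quadratic[of 1 ?B] by auto
  have B0: "0 \<le> B" using nn[of 0] B[of 0] by linarith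
  define C where "C = C0 * (B + 1) + 2 * c * real CARD('n)"
  have "C \<ge> 0" unfolding C_def using C0 B0 c by simp
  moreover have "u x - C * t \<le> heat 2 u t x" if t: "0 < t" "t \<le> 1" and x: "norm x \<le> 1" for t x
  proof -
    obtain q where q: "\<And>z. u x + q \<bullet> z - c * (norm z)\<^sup>2 \<le> u (x + z)"
      using sc unfolding semiconvex_def by blast
    have tr: "trace ?B = - c * real CARD('n)" by (simp add: trace_def mat_def sum_negf)
    have tt: "t\<^sup>2 \<le> t" using t by (simp add: power2_eq_square mult_left_le)
    have "C0 * (\<bar>u x\<bar> + 1) * t\<^sup>2 \<le> C0 * (B + 1) * t"
      using C0 nn[of x] B[of x] t tt by (intro mult_mono) auto
    then have "u x - C * t \<le> (u x + 2 * t * trace ?B) - C0 * (\<bar>u x\<bar> + 1) * t\<^sup>2"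
      unfolding tr C_def by (simp add: algebra_simps)
    also have "\<dots> \<le> gauss_avg 1 t (\<lambda>z. u x + q \<bullet> z + z \<bullet> (?B *v z))"
      using C0(2)[OF t, of "u x" q] by linarith
    also have "\<dots> \<le> gauss_avg 1 t (\<lambda>z. u (x + z))"
    proof (rule gauss_avg_mono)
      fix z
      have "?B *v z = (- c) *\<^sub>R z"
        by (simp only: scaleR_matrix_vector_assoc[symmetric] matrix_vector_mul_lid)
      then have "z \<bullet> (?B *v z) = - c * (norm z)\<^sup>2"
        by (simp add: power2_norm_eq_inner)
      then show "u x + q \<bullet> z + z \<bullet> (?B *v z) \<le> u (x + z)" using q[of z] by simp
    qed (intro continuous_intros cu matrix_vector_mult_linear_continuous_on)+
    also have "\<dots> = integral (cbox ((\<chi> i. - 1) + x) ((\<chi> i. 1) + x)) (\<lambda>y. gauss t (x - y) * u y)"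
    proof -
      have "(\<lambda>z. gauss t z * u (x + z)) = (\<lambda>y. gauss t (x - y) * u y) \<circ> (+) x"
        by (rule ext) (simp add: gauss_minus)
      then show ?thesis unfolding gauss_avg_def cube_def integral_shift_cbox_plus[symmetric] by simp
    qed
    also have "\<dots> \<le> heat 2 u t x"
      unfolding heat_def cube_def
    proof (rule integral_subset_le)
      show "cbox ((\<chi> i. - 1) + x) ((\<chi> i. 1) + x) \<subseteq> cbox (\<chi> i. - 2) (\<chi> i. 2)"
      proof
        fix y assume y: "y \<in> cbox ((\<chi> i. - 1) + x) ((\<chi> i. 1) + x)"
        have "\<bar>x $ i\<bar> \<le> 1" for i using component_le_norm_cart[of x i] x by linarith
        then show "y \<in> cbox (\<chi> i. - 2) (\<chi> i. 2)"
          using y unfolding mem_box_cart by (auto simp: abs_le_iff) (smt (verit))+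
      qed
      show "(\<lambda>y. gauss t (x - y) * u y) integrable_on cbox l r" for l r
        by (intro integrable_continuous continuous_intros cu)
      then show "(\<lambda>y. gauss t (x - y) * u y) integrable_on cbox l r" for l r .
      show "\<forall>y\<in>cbox (\<chi> i. - 2) (\<chi> i. 2). 0 \<le> gauss t (x - y) * u y"
        by (auto intro!: mult_nonneg_nonneg gauss_nonneg nn)
    qed
    finally show ?thesis .
  qed
  ultimately show ?thesis by blast
qed

text \<open>Comparison of \<open>u + (f - \<eta>) * t\<close> with the heat extension on a parabolic cylinder. A small
multiple of \<open>\<bar>x\<bar>\<^sup>2\<close> pushes a positive maximum of the difference off the lateral boundary, and
\<open>heat_lower_bound\<close> keeps it away from \<open>t = 0\<close>. At such a maximum the heat extension is
an admissible test function: its Laplacian is almost at least \<open>f\<close>, while its time derivative is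
at most \<open>f - \<eta>\<close>, contrary to the heat equation.\<close>

lemma gaussian_submean_nonneg:
  fixes u :: "real ^ 'n \<Rightarrow> real"
  assumes u: "continuous_on UNIV u" and nn: "\<And>x. 0 \<le> u x" and B: "\<And>x. u x \<le> B"
    and c: "0 \<le> c" and sc: "semiconvex c u"
    and \<rho>: "0 < \<rho>" and lap: "laplacian_ge f \<rho> u" and \<eta>: "0 < \<eta>"
  shows "\<exists>t0>0. \<forall>t. 0 < t \<longrightarrow> t \<le> t0 \<longrightarrow> u 0 + (f - \<eta>) * t \<le> gauss_avg 2 t u"
proof -
  obtain C where C: "C \<ge> 0" "\<And>t x. 0 < t \<Longrightarrow> t \<le> 1 \<Longrightarrow> norm x \<le> 1 \<Longrightarrow> u x - C * t \<le> heat 2 u t x"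
    using heat_lower_bound[OF u nn B c sc] by blast
  \<comment> \<open>the Laplacian of \<open>\<beta> * \<bar>x\<bar>\<^sup>2\<close> is \<open>\<eta> / 2\<close>\<close>
  define \<beta> where "\<beta> = \<eta> / (4 * real CARD('n))"
  define M where "M = \<bar>f - \<eta>\<bar> + C + 1"
  define r where "r = min (\<rho> / 2) 1"
  \<comment> \<open>up to the time \<open>t0\<close> the difference is at most \<open>0\<close> on the lateral boundary \<open>norm x = r\<close>\<close>
  define t0 where "t0 = min 1 (\<beta> * r\<^sup>2 / M)"
  have pos: "\<beta> > 0" "M > 0" "r > 0" "r \<le> 1" "r < \<rho>"
    unfolding \<beta>_def M_def r_def using \<eta> C \<rho> by auto
  have t0: "t0 > 0" "t0 \<le> 1" "M * t0 \<le> \<beta> * r\<^sup>2"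
  proof -
    show "t0 > 0" "t0 \<le> 1" unfolding t0_def using pos by auto
    have "t0 \<le> \<beta> * r\<^sup>2 / M" unfolding t0_def by simp
    then show "M * t0 \<le> \<beta> * r\<^sup>2" using pos by (simp add: field_simps)
  qed
  let ?g = "\<lambda>t x. u x + (f - \<eta>) * t - heat 2 u t x - \<beta> * (x \<bullet> x)"
  have g_le: "?g t x \<le> M * t - \<beta> * (norm x)\<^sup>2" if "0 < t" "t \<le> t0" "norm x \<le> r" for t x
  proof -
    have "u x - C * t \<le> heat 2 u t x" using C(2)[of t x] that t0 pos by auto
    moreover have "(f - \<eta>) * t \<le> \<bar>f - \<eta>\<bar> * t" using that by (intro mult_right_mono) auto
    ultimately show ?thesis unfolding M_def using that
      by (simp add: power2_norm_eq_inner algebra_simps)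
  qed
  have "u 0 + (f - \<eta>) * t \<le> gauss_avg 2 t u" if t: "0 < t" "t \<le> t0" for t
  proof (rule ccontr)
    assume neg: "\<not> ?thesis"
    define a where "a = ?g t 0"
    have a: "a > 0" using neg unfolding a_def heat_0[symmetric] by simp
    \<comment> \<open>before the time \<open>\<tau>\<close> the lower bound for the heat extension keeps \<open>?g\<close> below the value \<open>a\<close>\<close>
    define \<tau> where "\<tau> = min t (a / (2 * M))"
    have \<tau>: "0 < \<tau>" "\<tau> \<le> t" "M * \<tau> < a"
    proof -
      show "0 < \<tau>" "\<tau> \<le> t" unfolding \<tau>_def using t a pos by auto
      have "M * \<tau> \<le> M * (a / (2 * M))" unfolding \<tau>_def using pos by (intro mult_left_mono) auto
      also have "\<dots> < a" using pos a by simp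
      finally show "M * \<tau> < a" .
    qed
    let ?K = "{\<tau>..t0} \<times> cball (0 :: real ^ 'n) r"
    have "continuous_on ?K (\<lambda>p. heat 2 u (fst p) (snd p))"
    proof -
      have "?K \<subseteq> {0<..} \<times> UNIV" using \<tau> by auto
      from continuous_on_subset[OF continuous_on_heat[OF u, of 2] this] show ?thesis
        by (simp add: case_prod_unfold)
    qed
    then have "continuous_on ?K (\<lambda>p. ?g (fst p) (snd p))"
      by (intro continuous_intros continuous_on_compose2[OF u]) auto
    moreover have "compact ?K" by (intro compact_Times) auto
    moreover have "(t, 0) \<in> ?K" using t \<tau> pos by auto
    ultimately obtain p where p: "p \<in> ?K" "\<And>y. y \<in> ?K \<Longrightarrow> ?g (fst y) (snd y) \<le> ?g (fst p) (snd p)"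
      using continuous_attains_sup[of ?K "\<lambda>p. ?g (fst p) (snd p)"] by blast
    define t1 x1 where "t1 = fst p" and "x1 = snd p"
    have tx: "\<tau> \<le> t1" "t1 \<le> t0" "norm x1 \<le> r" using p(1) unfolding t1_def x1_def by (auto simp: mem_Times_iff)
    have mx: "?g s y \<le> ?g t1 x1" if "\<tau> \<le> s" "s \<le> t0" "norm y \<le> r" for s y
      using p(2)[of "(s, y)"] that unfolding t1_def x1_def by auto
    have t1: "0 < t1" using tx \<tau> by linarith
    have ga: "a \<le> ?g t1 x1" using mx[of t 0] \<tau> t pos unfolding a_def by auto
    have gM: "?g t1 x1 \<le> M * t1 - \<beta> * (norm x1)\<^sup>2" by (rule g_le) (use t1 tx in auto)
    have "\<tau> < t1"
    proof -
      have "0 \<le> \<beta> * (norm x1)\<^sup>2" using pos by simp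
      then have "M * \<tau> < M * t1" using \<tau>(3) ga gM by linarith
      then show ?thesis using pos by simp
    qed
    have x1: "norm x1 < r"
    proof -
      have "M * t1 \<le> M * t0" using tx pos by simp
      then have "\<beta> * (norm x1)\<^sup>2 < \<beta> * r\<^sup>2" using t0 ga gM a by linarith
      then have "(norm x1)\<^sup>2 < r\<^sup>2" using pos by simp
      then show ?thesis using pos by (simp add: power_less_imp_less_base)
    qed
    let ?\<theta> = "\<lambda>x. heat 2 u t1 x + \<beta> * (x \<bullet> x)"
    have ev: "\<forall>\<^sub>F y in nhds x1. u y - ?\<theta> y \<le> u x1 - ?\<theta> x1"
    proof -
      have "\<forall>\<^sub>F y in nhds x1. y \<in> ball 0 r" using x1 by (intro eventually_nhds_in_open) auto
      then show ?thesis
      proof eventually_elim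
        case (elim y)
        then show ?case using mx[of t1 y] tx by simp
      qed
    qed
    have "f \<le> trace (heat_D2 2 u t1 x1 + (2 * \<beta>) *\<^sub>R mat 1)"
      using lap C2_with_add[OF C2_with_heat[OF t1 u, of 2] C2_with_square[of \<beta>]] ev x1 pos
      unfolding laplacian_ge_def by (meson less_trans)
    then have f1: "f \<le> trace (heat_D2 2 u t1 x1) + \<eta> / 2"
      by (simp add: trace_add trace_scaleR trace_I \<beta>_def)
    have "trace (heat_D2 2 u t1 x1) \<le> f - \<eta>"
    proof (rule ccontr)
      assume neg: "\<not> ?thesis"
      have "((\<lambda>s. (f - \<eta>) * s - heat 2 u s x1) has_real_derivative (f - \<eta>) - trace (heat_D2 2 u t1 x1)) (at t1)"
        by (auto intro!: derivative_eq_intros DERIV_heat[OF t1 u])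
      from DERIV_neg_dec_left[OF this] neg
      obtain d where d: "d > 0" "\<And>h. 0 < h \<Longrightarrow> h < d \<Longrightarrow> (f - \<eta>) * t1 - heat 2 u t1 x1 < (f - \<eta>) * (t1 - h) - heat 2 u (t1 - h) x1"
        by auto
      define h where "h = min (d / 2) (t1 - \<tau>)"
      have h: "0 < h" "h < d" "h \<le> t1 - \<tau>" unfolding h_def using d \<open>\<tau> < t1\<close> by auto
      show False using d(2)[OF h(1,2)] mx[of "t1 - h" x1] h tx by auto
    qed
    with f1 \<eta> show False by linarith
  qed
  with t0 show ?thesis by blast
qed

text \<open>Adding a constant reduces to nonnegative functions, since the total mass of the average is at most
\<open>1\<close>.\<close>

lemma gaussian_submean:
  fixes u :: "real ^ 'n \<Rightarrow> real"
  assumes u: "continuous_on UNIV u" and B: "\<And>x. \<bar>u x\<bar> \<le> B"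
    and c: "0 \<le> c" and sc: "semiconvex c u"
    and \<rho>: "0 < \<rho>" and lap: "laplacian_ge f \<rho> u" and \<eta>: "0 < \<eta>"
  shows "\<exists>t0>0. \<forall>t. 0 < t \<longrightarrow> t \<le> t0 \<longrightarrow> u 0 + (f - \<eta>) * t \<le> gauss_avg 2 t u"
proof -
  let ?v = "\<lambda>x. u x + B"
  have B0: "0 \<le> B" using B[of 0] by linarith
  have "\<exists>t0>0. \<forall>t. 0 < t \<longrightarrow> t \<le> t0 \<longrightarrow> ?v 0 + (f - \<eta>) * t \<le> gauss_avg 2 t ?v"
  proof (rule gaussian_submean_nonneg[OF _ _ _ c _ \<rho> _ \<eta>])
    show "continuous_on UNIV ?v" by (intro continuous_intros u)
    show "0 \<le> ?v x" "?v x \<le> 2 * B" for x using B[of x] by (auto simp: abs_le_iff)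
    show "semiconvex c ?v" using sc unfolding semiconvex_def by (simp add: algebra_simps)
    show "laplacian_ge f \<rho> ?v" using lap unfolding laplacian_ge_def by (simp add: algebra_simps)
  qed
  then obtain t0 where t0: "t0 > 0" "\<And>t. 0 < t \<Longrightarrow> t \<le> t0 \<Longrightarrow> ?v 0 + (f - \<eta>) * t \<le> gauss_avg 2 t ?v" by blast
  have "u 0 + (f - \<eta>) * t \<le> gauss_avg 2 t u" if t: "0 < t" "t \<le> t0" for t
  proof -
    have "gauss_avg 2 t ?v = gauss_avg 2 t u + B * gauss_avg 2 t (\<lambda>_ :: real ^ 'n. 1)"
      using gauss_avg_add[OF u continuous_on_const, of 2 t B] gauss_avg_cmult[of 2 t B "\<lambda>_ :: real ^ 'n. 1"] by simp
    moreover have "B * gauss_avg 2 t (\<lambda>_ :: real ^ 'n. 1) \<le> B"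
      using gauss_avg_1(1)[of t 2, where 'n='n] t B0 by (simp add: mult_left_le)
    ultimately show ?thesis using t0(2)[OF t] by linarith
  qed
  with t0(1) show ?thesis by blast
qed

section \<open>Sup-convolutions\<close>

definition sup_conv :: "real \<Rightarrow> (real ^ 'n \<Rightarrow> real) \<Rightarrow> real ^ 'n \<Rightarrow> real" where
  "sup_conv \<delta> \<phi> x = (SUP z. \<phi> z - (norm (x - z))\<^sup>2 / (2 * \<delta>))"

locale bounded_sup_conv =
  fixes \<phi> :: "real ^ 'n \<Rightarrow> real" and B \<delta> :: real
  assumes cont: "continuous_on UNIV \<phi>" and bound: "\<And>x. \<bar>\<phi> x\<bar> \<le> B" and \<delta>: "0 < \<delta>"
begin

abbreviation "u \<equiv> sup_conv \<delta> \<phi>"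

lemma B_nonneg: "0 \<le> B"
  using bound[of 0] by linarith

lemma sup_conv_attained:
  shows "\<phi> z - (norm (x - z))\<^sup>2 / (2 * \<delta>) \<le> u x"
    and "\<exists>z. u x = \<phi> z - (norm (x - z))\<^sup>2 / (2 * \<delta>)"
proof -
  let ?g = "\<lambda>z. \<phi> z - (norm (x - z))\<^sup>2 / (2 * \<delta>)"
  define R where "R = sqrt (4 * \<delta> * B)"
  have R: "R \<ge> 0" "R\<^sup>2 = 4 * \<delta> * B" unfolding R_def using \<delta> B_nonneg by auto
  have "continuous_on (cball x R) ?g"
    using \<delta> by (intro continuous_intros continuous_on_subset[OF cont]) auto
  moreover have "cball x R \<noteq> {}" using R by auto
  ultimately obtain z0 where z0: "z0 \<in> cball x R" "\<And>z. z \<in> cball x R \<Longrightarrow> ?g z \<le> ?g z0"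
    using continuous_attains_sup[of "cball x R" ?g] by auto
  have le: "?g z \<le> ?g z0" for z
  proof (cases "z \<in> cball x R")
    case False
    then have "R < norm (x - z)" by (simp add: dist_norm)
    then have "R\<^sup>2 \<le> (norm (x - z))\<^sup>2" using R by (intro power_mono) auto
    then have "2 * B \<le> (norm (x - z))\<^sup>2 / (2 * \<delta>)" using R \<delta> by (simp add: field_simps)
    then have "?g z \<le> - B" using bound[of z] by (simp add: abs_le_iff)
    also have "\<dots> \<le> ?g x" using bound[of x] by (simp add: abs_le_iff)
    also have "\<dots> \<le> ?g z0" using z0(2)[of x] R by simp
    finally show ?thesis .
  qed (use z0 in auto)
  have "u x = ?g z0" unfolding sup_conv_def by (rule cSup_eq_maximum) (use le in auto)
  then show "\<phi> z - (norm (x - z))\<^sup>2 / (2 * \<delta>) \<le> u x" "\<exists>z. u x = ?g z" using le by auto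
qed

lemma sup_conv_ge: "\<phi> x \<le> u x"
  using sup_conv_attained(1)[of x x] by simp

lemma sup_conv_bound: "\<bar>u x\<bar> \<le> B"
proof -
  obtain z where "u x = \<phi> z - (norm (x - z))\<^sup>2 / (2 * \<delta>)" using sup_conv_attained(2) by blast
  then have "u x \<le> \<phi> z" using \<delta> by simp
  then show ?thesis using bound[of z] bound[of x] sup_conv_ge[of x] by (simp add: abs_le_iff)
qed

lemma maximizer_dist:
  assumes "u x = \<phi> z - (norm (x - z))\<^sup>2 / (2 * \<delta>)"
  shows "norm (x - z) \<le> 2 * sqrt (\<delta> * B)"
proof -
  have "(norm (x - z))\<^sup>2 / (2 * \<delta>) \<le> 2 * B"
    using assms sup_conv_ge[of x] bound[of x] bound[of z] by (simp add: abs_le_iff)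
  then have "(norm (x - z))\<^sup>2 \<le> (2 * sqrt (\<delta> * B))\<^sup>2"
    using \<delta> B_nonneg by (simp add: field_simps power_mult_distrib)
  then show ?thesis by (rule power2_le_imp_le) (use \<delta> B_nonneg in auto)
qed

lemma sup_conv_lower:
  assumes "u x = \<phi> z - (norm (x - z))\<^sup>2 / (2 * \<delta>)"
  shows "u x + ((z - x) /\<^sub>R \<delta>) \<bullet> h - 1 / (2 * \<delta>) * (norm h)\<^sup>2 \<le> u (x + h)"
proof -
  have "(norm (x + h - z))\<^sup>2 = (norm (x - z))\<^sup>2 - 2 * ((z - x) \<bullet> h) + (norm h)\<^sup>2"
    by (simp add: power2_norm_eq_inner inner_simps inner_commute)
  then have "(norm (x + h - z))\<^sup>2 / (2 * \<delta>) = ((norm (x - z))\<^sup>2 - 2 * ((z - x) \<bullet> h) + (norm h)\<^sup>2) / (2 * \<delta>)"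
    by simp
  also have "\<dots> = (norm (x - z))\<^sup>2 / (2 * \<delta>) - ((z - x) /\<^sub>R \<delta>) \<bullet> h + 1 / (2 * \<delta>) * (norm h)\<^sup>2"
  proof -
    have e: "((z - x) /\<^sub>R \<delta>) \<bullet> h = ((z - x) \<bullet> h) / \<delta>"
      unfolding inner_scaleR_left by (simp only: divide_inverse mult.commute)
    show ?thesis unfolding e using \<delta> by (simp add: field_simps)
  qed
  finally have "u x + ((z - x) /\<^sub>R \<delta>) \<bullet> h - 1 / (2 * \<delta>) * (norm h)\<^sup>2 = \<phi> z - (norm (x + h - z))\<^sup>2 / (2 * \<delta>)"
    unfolding assms by simp
  also have "\<dots> \<le> u (x + h)" by (rule sup_conv_attained)
  finally show ?thesis .
qed

lemma semiconvex_sup_conv: "semiconvex (1 / (2 * \<delta>)) u"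
  unfolding semiconvex_def using sup_conv_attained(2) sup_conv_lower by blast

lemma continuous_sup_conv: "continuous_on UNIV u"
proof -
  define R where "R = 2 * sqrt (\<delta> * B)"
  have le: "u x - u y \<le> R / \<delta> * norm (y - x) + (norm (y - x))\<^sup>2 / (2 * \<delta>)" for x y
  proof -
    obtain z where z: "u x = \<phi> z - (norm (x - z))\<^sup>2 / (2 * \<delta>)" using sup_conv_attained(2) by blast
    have "- (((z - x) /\<^sub>R \<delta>) \<bullet> (y - x)) \<le> norm ((z - x) /\<^sub>R \<delta>) * norm (y - x)"
      using Cauchy_Schwarz_ineq2[of "(z - x) /\<^sub>R \<delta>" "y - x"] by linarith
    also have "norm ((z - x) /\<^sub>R \<delta>) = norm (x - z) / \<delta>"
    proof -
      have "\<bar>inverse \<delta>\<bar> = inverse \<delta>" using \<delta> by simp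
      then show ?thesis unfolding norm_scaleR norm_minus_commute[of z x] divide_inverse
        by (simp only: mult.commute)
    qed
    also have "norm (x - z) / \<delta> * norm (y - x) \<le> R / \<delta> * norm (y - x)"
      using maximizer_dist[OF z] \<delta> unfolding R_def
      by (intro mult_right_mono divide_right_mono) auto
    finally show ?thesis using sup_conv_lower[OF z, of "y - x"] by simp
  qed
  have "isCont u x" for x
  proof -
    let ?e = "\<lambda>y. R / \<delta> * norm (y - x) + (norm (y - x))\<^sup>2 / (2 * \<delta>)"
    have "((\<lambda>y. ?e y) \<longlongrightarrow> ?e x) (at x)"
      using \<delta> by (intro tendsto_intros) auto
    then have e: "(?e \<longlongrightarrow> 0) (at x)" by simp
    have "((\<lambda>y. u y - u x) \<longlongrightarrow> 0) (at x)"
    proof (rule Lim_null_comparison[OF _ e], rule always_eventually, rule allI)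
      fix y show "norm (u y - u x) \<le> ?e y"
        using le[of x y] le[of y x] by (simp add: norm_minus_commute abs_le_iff)
    qed
    then show ?thesis unfolding isCont_def by (simp add: LIM_zero_iff)
  qed
  then show ?thesis by (simp add: continuous_at_imp_continuous_on)
qed

lemma sup_conv_periodic:
  assumes per: "\<And>x. \<phi> (x + k) = \<phi> x"
  shows "u (x + k) = u x"
proof (rule antisym)
  obtain z where "u x = \<phi> z - (norm (x - z))\<^sup>2 / (2 * \<delta>)" using sup_conv_attained(2) by blast
  then show "u x \<le> u (x + k)" using sup_conv_attained(1)[of "z + k" "x + k"] per[of z] by simp
  obtain z where "u (x + k) = \<phi> z - (norm (x + k - z))\<^sup>2 / (2 * \<delta>)" using sup_conv_attained(2) by blast
  then show "u (x + k) \<le> u x" using sup_conv_attained(1)[of "z - k" x] per[of "z - k"]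
    by (simp add: algebra_simps)
qed

text \<open>If \<open>u\<close> is touched from above at \<open>x0\<close> with slope \<open>p\<close>, then the slopes of the paraboloids touching it
from below at points within distance \<open>t\<close> differ from \<open>p\<close> by \<open>O(t)\<close>. Compare the two bounds at
distance \<open>t\<close> from the point \<open>x0 + h1\<close> in the direction in which the slopes differ.\<close>

lemma maximizer_slope:
  assumes C: "0 \<le> C" and touch: "\<And>h. norm h < s \<Longrightarrow> u (x0 + h) \<le> u x0 + p \<bullet> h + C * (norm h)\<^sup>2"
    and t: "0 < t" "2 * t < s" and h1: "norm h1 \<le> t"
    and z0: "u x0 = \<phi> z0 - (norm (x0 - z0))\<^sup>2 / (2 * \<delta>)" "(z0 - x0) /\<^sub>R \<delta> = p"
    and z1: "u (x0 + h1) = \<phi> z1 - (norm (x0 + h1 - z1))\<^sup>2 / (2 * \<delta>)"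
  shows "norm ((z1 - (x0 + h1)) /\<^sub>R \<delta> - p) \<le> (4 * C + 1 / \<delta>) * t"
proof -
  let ?v = "(z1 - (x0 + h1)) /\<^sub>R \<delta> - p"
  define w where "w = (t / norm ?v) *\<^sub>R ?v"
  show ?thesis
  proof (cases "?v = 0")
    case True then show ?thesis using C \<delta> t by (simp add: field_simps)
  next
    case False
    then have w: "norm w = t" "?v \<bullet> w = t * norm ?v"
      unfolding w_def using t by (auto simp: power2_norm_eq_inner[symmetric] power2_eq_square)
    have hw: "norm (h1 + w) \<le> 2 * t" using norm_triangle_ineq[of h1 w] w h1 by linarith
    have 1: "u (x0 + (h1 + w)) \<le> u x0 + p \<bullet> (h1 + w) + C * (norm (h1 + w))\<^sup>2"
      by (rule touch) (use hw t in linarith)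
    have 2: "u (x0 + h1) + ((z1 - (x0 + h1)) /\<^sub>R \<delta>) \<bullet> w - 1 / (2 * \<delta>) * (norm w)\<^sup>2 \<le> u (x0 + h1 + w)"
      by (rule sup_conv_lower[OF z1])
    have 3: "u x0 + p \<bullet> h1 - 1 / (2 * \<delta>) * (norm h1)\<^sup>2 \<le> u (x0 + h1)"
      using sup_conv_lower[OF z0(1), of h1] z0(2) by simp
    have 4: "C * (norm (h1 + w))\<^sup>2 \<le> C * (2 * t)\<^sup>2"
      using hw C by (intro mult_left_mono power_mono) auto
    have 5: "1 / (2 * \<delta>) * (norm h1)\<^sup>2 \<le> 1 / (2 * \<delta>) * t\<^sup>2"
      using h1 \<delta> by (intro mult_left_mono power_mono) auto
    have "?v \<bullet> w \<le> C * (2 * t)\<^sup>2 + 1 / (2 * \<delta>) * t\<^sup>2 + 1 / (2 * \<delta>) * t\<^sup>2"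
      using 1 2 3 4 5 w(1) by (simp add: inner_simps add.assoc)
    then have "t * norm ?v \<le> t * ((4 * C + 1 / \<delta>) * t)"
      using w(2) \<delta> by (simp add: field_simps power2_eq_square)
    then show ?thesis using t by simp
  qed
qed

text \<open>A function squeezed between two paraboloids at \<open>x0\<close> is differentiable there; since
\<open>(z0 - x0) / \<delta>\<close> is a slope from below and \<open>p\<close> a slope from above, they agree.\<close>

lemma maximizer_at_touch:
  assumes s: "0 < s" and touch: "\<And>h. norm h < s \<Longrightarrow> u (x0 + h) \<le> u x0 + p \<bullet> h + C * (norm h)\<^sup>2"
    and z0: "u x0 = \<phi> z0 - (norm (x0 - z0))\<^sup>2 / (2 * \<delta>)"
  shows "z0 = x0 + \<delta> *\<^sub>R p"
proof -
  let ?v = "(z0 - x0) /\<^sub>R \<delta> - p"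
  have *: "?v \<bullet> h \<le> (\<bar>C\<bar> + 1 / (2 * \<delta>)) * (norm h)\<^sup>2" if "norm h < s" for h
  proof -
    have "C * (norm h)\<^sup>2 \<le> \<bar>C\<bar> * (norm h)\<^sup>2" by (intro mult_right_mono) auto
    then show ?thesis using sup_conv_lower[OF z0, of h] touch[OF that]
      by (simp add: inner_simps algebra_simps)
  qed
  have "?v = 0"
  proof (rule ccontr)
    assume v: "?v \<noteq> 0"
    define K where "K = \<bar>C\<bar> + 1 / (2 * \<delta>)"
    have K: "K > 0" unfolding K_def using \<delta> by (simp add: add_nonneg_pos)
    define c where "c = min (1 / (2 * K)) (s / (2 * norm ?v))"
    have c: "0 < c" "c * K < 1" "c * norm ?v < s"
    proof -
      show "0 < c" unfolding c_def using K s v by simp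
      have "c * K \<le> 1 / (2 * K) * K" unfolding c_def using K by (intro mult_right_mono) auto
      then show "c * K < 1" using K by simp
      have "c * norm ?v \<le> s / (2 * norm ?v) * norm ?v" unfolding c_def by (intro mult_right_mono) auto
      then show "c * norm ?v < s" using v s by simp
    qed
    have "?v \<bullet> (c *\<^sub>R ?v) \<le> K * (norm (c *\<^sub>R ?v))\<^sup>2"
      unfolding K_def by (rule *) (use c in simp)
    then have "c * (norm ?v)\<^sup>2 \<le> c * (c * K * (norm ?v)\<^sup>2)"
      by (simp add: power2_norm_eq_inner[symmetric] power_mult_distrib power2_eq_square mult_ac)
    then have "(norm ?v)\<^sup>2 \<le> c * K * (norm ?v)\<^sup>2" using c by simp
    moreover have "c * K * (norm ?v)\<^sup>2 < 1 * (norm ?v)\<^sup>2"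
      using c v by (intro mult_strict_right_mono) auto
    ultimately show False by simp
  qed
  then have "\<delta> *\<^sub>R ((z0 - x0) /\<^sub>R \<delta>) = \<delta> *\<^sub>R p" by simp
  then show ?thesis using \<delta> by (simp add: algebra_simps)
qed

end

section \<open>From a viscosity inequality to a bound on the Laplacian\<close>

text \<open>A common form for the two inequalities contained in the equation: a solution \<open>\<phi>\<close> satisfies it, and
so does a negative multiple of \<open>\<phi>\<close>, with another \<open>b\<close>, because of the supersolution property.\<close>

definition visc_sub ::
  "(real ^ 'n \<Rightarrow> real ^ 'n ^ 'n) \<Rightarrow> (real ^ 'n \<Rightarrow> real \<Rightarrow> real ^ 'n \<Rightarrow> real) \<Rightarrow> (real ^ 'n \<Rightarrow> real) \<Rightarrow> bool" where
  "visc_sub A b \<phi> \<longleftrightarrow> (\<forall>\<theta> D D2 x. C2_with \<theta> D D2 \<longrightarrow>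
     (\<forall>\<^sub>F y in nhds x. \<phi> y - \<theta> y \<le> \<phi> x - \<theta> x) \<longrightarrow>
     b x (\<phi> x) (D x) \<le> trace (A x ** D2 x))"

lemma power2_norm_vec: "(norm (x :: 'a::real_normed_vector ^ 'n))\<^sup>2 = (\<Sum>i\<in>UNIV. (norm (x $ i))\<^sup>2)"
  by (simp add: norm_vec_def L2_set_def sum_nonneg)

lemma norm_matrix_vec_le: "norm ((M :: real ^ 'n ^ 'n) *v v) \<le> norm M * norm v"
proof -
  have "(norm (M *v v))\<^sup>2 = (\<Sum>i\<in>UNIV. (M $ i \<bullet> v)\<^sup>2)"
    by (simp add: power2_norm_vec[of "M *v v"] matrix_vector_mul_component)
  also have "\<dots> \<le> (\<Sum>i\<in>UNIV. (norm (M $ i))\<^sup>2 * (norm v)\<^sup>2)"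
  proof (rule sum_mono)
    fix i show "(M $ i \<bullet> v)\<^sup>2 \<le> (norm (M $ i))\<^sup>2 * (norm v)\<^sup>2"
      using Cauchy_Schwarz_ineq[of "M $ i" v] by (simp add: power2_norm_eq_inner)
  qed
  also have "\<dots> = (norm M * norm v)\<^sup>2"
    by (simp add: power_mult_distrib power2_norm_vec[of M] sum_distrib_right)
  finally show ?thesis by (rule power2_le_imp_le) simp
qed

lemma C2_with_affine:
  fixes T :: "real ^ 'n ^ 'n"
  assumes "C2_with \<theta> D D2"
  shows "C2_with (\<lambda>x. \<theta> (T *v x + d)) (\<lambda>x. transpose T *v D (T *v x + d))
    (\<lambda>x. transpose T ** D2 (T *v x + d) ** T)"
proof -
  have \<theta>: "(\<theta> has_derivative (\<lambda>h. h \<bullet> D y)) (at y)" and D: "(D has_derivative (\<lambda>h. D2 y *v h)) (at y)"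
    and D2: "continuous_on UNIV D2" for y
    using assms by (auto simp: C2_with_def gderiv_def)
  have aff: "((\<lambda>x. T *v x + d) has_derivative (\<lambda>h. T *v h)) (at x)" for x
    using has_derivative_add[OF bounded_linear_imp_has_derivative[OF matrix_vector_mul_bounded_linear] has_derivative_const, of T d]
    by simp
  have 1: "GDERIV (\<lambda>x. \<theta> (T *v x + d)) x :> transpose T *v D (T *v x + d)" for x
  proof -
    have "(T *v h) \<bullet> v = h \<bullet> (transpose T *v v)" for h v
      by (metis dot_lmul_matrix inner_commute transpose_matrix_vector)
    then show ?thesis using has_derivative_compose[OF aff \<theta>] unfolding gderiv_def by simp
  qed
  have 2: "((\<lambda>x. transpose T *v D (T *v x + d)) has_derivative (\<lambda>h. (transpose T ** D2 (T *v x + d) ** T) *v h)) (at x)" for x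
    using bounded_linear.has_derivative[OF matrix_vector_mul_bounded_linear has_derivative_compose[OF aff D]]
    by (simp add: matrix_vector_mul_assoc matrix_mul_assoc del: transpose_matrix_vector)
  have c: "continuous_on UNIV (\<lambda>x. D2 (T *v x + d))"
    by (intro continuous_on_compose2[OF D2] continuous_intros matrix_vector_mult_linear_continuous_on) auto
  have "continuous_on UNIV (\<lambda>x. transpose T ** D2 (T *v x + d) ** T)"
    unfolding matrix_matrix_mult_def
    by (intro continuous_on_vec_lambda continuous_intros c)
  with 1 2 show ?thesis unfolding C2_with_def by blast
qed

text \<open>First and second order conditions at the minimum of \<open>\<theta>\<close> minus a paraboloid, obtained along
lines.\<close>

lemma C2_touched_below:
  assumes C2: "C2_with \<theta> D D2"
    and touch: "\<forall>\<^sub>F h in nhds 0. \<theta> x + q \<bullet> h - c * (norm h)\<^sup>2 \<le> \<theta> (x + h)"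
  shows "D x = q" "- 2 * c * (norm \<xi>)\<^sup>2 \<le> \<xi> \<bullet> (D2 x *v \<xi>)"
proof -
  have der: "\<exists>k'. (\<forall>s. ((\<lambda>s. \<theta> (x + s *\<^sub>R \<xi>) - s * (q \<bullet> \<xi>) + c * (s * norm \<xi>)\<^sup>2) has_real_derivative k' s) (at s)) \<and>
     k' 0 = \<xi> \<bullet> (D x - q) \<and> (k' has_real_derivative \<xi> \<bullet> (D2 x *v \<xi>) + 2 * c * (norm \<xi>)\<^sup>2) (at 0)" for \<xi>
  proof (intro exI conjI allI)
    let ?k' = "\<lambda>s. \<xi> \<bullet> D (x + s *\<^sub>R \<xi>) - q \<bullet> \<xi> + 2 * c * s * (norm \<xi>)\<^sup>2"
    have l: "((\<lambda>s. x + s *\<^sub>R \<xi>) has_derivative (\<lambda>h. h *\<^sub>R \<xi>)) (at s)" for s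
      by (auto intro!: derivative_eq_intros)
    have "(\<theta> has_derivative (\<lambda>h. h \<bullet> D (x + s *\<^sub>R \<xi>))) (at (x + s *\<^sub>R \<xi>))" for s
      using C2 by (auto simp: C2_with_def gderiv_def)
    from has_derivative_compose[OF l this]
    have d1: "((\<lambda>s. \<theta> (x + s *\<^sub>R \<xi>)) has_real_derivative \<xi> \<bullet> D (x + s *\<^sub>R \<xi>)) (at s)" for s
      by (simp add: has_field_derivative_def mult_commute_abs)
    show "((\<lambda>s. \<theta> (x + s *\<^sub>R \<xi>) - s * (q \<bullet> \<xi>) + c * (s * norm \<xi>)\<^sup>2) has_real_derivative ?k' s) (at s)" for s
      by (auto intro!: derivative_eq_intros d1 simp: power2_eq_square)
    show "?k' 0 = \<xi> \<bullet> (D x - q)" by (simp add: inner_simps inner_commute)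
    have "(D has_derivative (\<lambda>h. D2 x *v h)) (at (x + 0 *\<^sub>R \<xi>))"
      using C2 by (auto simp: C2_with_def)
    from has_derivative_inner_right[OF has_derivative_compose[OF l this], of \<xi>]
    have d2: "((\<lambda>s. \<xi> \<bullet> D (x + s *\<^sub>R \<xi>)) has_real_derivative \<xi> \<bullet> (D2 x *v \<xi>)) (at 0)"
      by (simp add: has_field_derivative_def matrix_vector_mult_scaleR mult_commute_abs)
    show "(?k' has_real_derivative \<xi> \<bullet> (D2 x *v \<xi>) + 2 * c * (norm \<xi>)\<^sup>2) (at 0)"
      by (auto intro!: derivative_eq_intros d2)
  qed
  have min: "\<exists>d>0. \<forall>s. \<bar>s\<bar> < d \<longrightarrow> \<theta> x \<le> \<theta> (x + s *\<^sub>R \<xi>) - s * (q \<bullet> \<xi>) + c * (s * norm \<xi>)\<^sup>2" for \<xi>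
  proof -
    obtain e where e: "e > 0" "\<And>h. norm h < e \<Longrightarrow> \<theta> x + q \<bullet> h - c * (norm h)\<^sup>2 \<le> \<theta> (x + h)"
      using touch unfolding eventually_nhds_metric by auto
    have "\<theta> x \<le> \<theta> (x + s *\<^sub>R \<xi>) - s * (q \<bullet> \<xi>) + c * (s * norm \<xi>)\<^sup>2" if "\<bar>s\<bar> < e / (norm \<xi> + 1)" for s
    proof -
      have "norm (s *\<^sub>R \<xi>) \<le> \<bar>s\<bar> * (norm \<xi> + 1)" by (simp add: mult_left_mono)
      also have "\<dots> < e" using that by (simp add: pos_less_divide_eq add_nonneg_pos)
      finally show ?thesis using e(2)[of "s *\<^sub>R \<xi>"] by (simp add: power_mult_distrib)
    qed
    then show ?thesis using e(1) by (intro exI[of _ "e / (norm \<xi> + 1)"]) (auto simp: add_nonneg_pos)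
  qed
  have D0: "\<xi> \<bullet> (D x - q) = 0" for \<xi>
  proof -
    obtain k' where k': "\<And>s. ((\<lambda>s. \<theta> (x + s *\<^sub>R \<xi>) - s * (q \<bullet> \<xi>) + c * (s * norm \<xi>)\<^sup>2) has_real_derivative k' s) (at s)"
      "k' 0 = \<xi> \<bullet> (D x - q)" using der[of \<xi>] by blast
    obtain d where d: "d > 0" "\<And>s. \<bar>s\<bar> < d \<Longrightarrow> \<theta> x \<le> \<theta> (x + s *\<^sub>R \<xi>) - s * (q \<bullet> \<xi>) + c * (s * norm \<xi>)\<^sup>2"
      using min[of \<xi>] by blast
    have "k' 0 = 0" by (rule DERIV_local_min[OF k'(1) d(1)]) (use d(2) in auto)
    then show ?thesis using k'(2) by simp
  qed
  from D0[of "D x - q"] show "D x = q" by simp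
  show "- 2 * c * (norm \<xi>)\<^sup>2 \<le> \<xi> \<bullet> (D2 x *v \<xi>)"
  proof (rule ccontr)
    assume neg: "\<not> ?thesis"
    let ?k = "\<lambda>s. \<theta> (x + s *\<^sub>R \<xi>) - s * (q \<bullet> \<xi>) + c * (s * norm \<xi>)\<^sup>2"
    obtain k' where k': "\<And>s. (?k has_real_derivative k' s) (at s)"
      "k' 0 = 0" "(k' has_real_derivative \<xi> \<bullet> (D2 x *v \<xi>) + 2 * c * (norm \<xi>)\<^sup>2) (at 0)"
      using der[of \<xi>] D0[of \<xi>] by auto
    obtain d where d: "d > 0" "\<And>s. \<bar>s\<bar> < d \<Longrightarrow> \<theta> x \<le> ?k s" using min[of \<xi>] by blast
    obtain d' where d': "d' > 0" "\<And>h. 0 < h \<Longrightarrow> h < d' \<Longrightarrow> k' (0 + h) < k' 0"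
      using DERIV_neg_dec_right[OF k'(3)] neg by auto
    define h where "h = min d d' / 2"
    have h: "0 < h" "h < d" "h < d'" unfolding h_def using d d' by auto
    obtain z where z: "0 < z" "z < h" "?k h - ?k 0 = (h - 0) * k' z"
      using MVT2[of 0 h ?k k'] h k'(1) by blast
    have "k' z < 0" using d'(2)[of z] z h k'(2) by simp
    then have "(h - 0) * k' z < 0" using h by (simp add: mult_pos_neg)
    then have "?k h < \<theta> x" using z(3) by simp
    moreover have "\<theta> x \<le> ?k h" using d(2)[of h] h by simp
    ultimately show False by linarith
  qed
qed

text \<open>The matrix need not be symmetric, hence the symmetrised entry in the second estimate.\<close>

lemma matrix_form_entries:
  fixes P :: "real ^ 'n ^ 'n"
  assumes "\<And>\<xi>. 0 \<le> \<xi> \<bullet> (P *v \<xi>)"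
  shows "0 \<le> P $ i $ i" "\<bar>P $ i $ j + P $ j $ i\<bar> \<le> P $ i $ i + P $ j $ j"
proof -
  have e: "axis i 1 \<bullet> (P *v axis j 1) = P $ i $ j" for i j
    by (simp add: inner_axis' matrix_vector_mul_component inner_axis)
  show "0 \<le> P $ i $ i" using assms[of "axis i 1"] e by simp
  show "\<bar>P $ i $ j + P $ j $ i\<bar> \<le> P $ i $ i + P $ j $ j"
    using assms[of "axis i 1 + axis j 1"] assms[of "axis i 1 - axis j 1"]
    by (simp add: matrix_vector_right_distrib matrix_vector_mult_diff_distrib inner_simps e abs_le_iff)
qed

text \<open>If \<open>G\<close> is close to the identity, the traces of \<open>G X\<close> and \<open>X\<close> are close only when \<open>X\<close> is bounded.
Here \<open>X\<close> is bounded from below, and if its trace is bounded from above it is bounded; a large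
trace is harmless. Quantitatively, the entries of \<open>P = X + c I \<ge> 0\<close> are controlled by its trace.\<close>

lemma trace_perturb:
  fixes G X :: "real ^ 'n ^ 'n"
  assumes X: "\<And>\<xi>. - c * (norm \<xi>)\<^sup>2 \<le> \<xi> \<bullet> (X *v \<xi>)" and c: "0 \<le> c"
    and sym: "transpose G = G" and G: "\<And>i j. \<bar>G $ i $ j - mat 1 $ i $ j\<bar> \<le> \<kappa>"
    and \<gamma>: "f + \<gamma> \<le> trace (G ** X)"
    and small: "\<kappa> * real CARD('n) * (\<bar>f\<bar> + c + c * real CARD('n)) \<le> \<gamma>"
  shows "f \<le> trace X"
proof -
  let ?N = "real CARD('n)"
  define P where "P = X + c *\<^sub>R mat 1"
  define E where "E = G - mat 1"
  have \<kappa>: "0 \<le> \<kappa>" using G[of undefined undefined] by linarith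
  have P: "0 \<le> \<xi> \<bullet> (P *v \<xi>)" for \<xi>
    using X[of \<xi>] unfolding P_def
    by (simp add: matrix_vector_mult_add_rdistrib scaleR_matrix_vector_assoc[symmetric] inner_simps power2_norm_eq_inner)
  have Es: "E $ i $ j = E $ j $ i" for i j
  proof -
    have "G $ i $ j = G $ j $ i" using arg_cong[OF sym, of "\<lambda>M. M $ j $ i"] by (simp add: transpose_def)
    then show ?thesis unfolding E_def by (simp add: mat_def)
  qed
  have trP: "trace P = trace X + c * ?N" unfolding P_def by (simp add: trace_add trace_scaleR trace_I)
  have trP0: "0 \<le> trace P" unfolding trace_def using matrix_form_entries(1)[OF P] by (simp add: sum_nonneg)
  have "trace (E ** P) = (\<Sum>i\<in>UNIV. \<Sum>j\<in>UNIV. E $ i $ j * P $ j $ i)"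
    by (simp add: trace_def matrix_matrix_mult_def)
  moreover have "trace (E ** P) = (\<Sum>i\<in>UNIV. \<Sum>j\<in>UNIV. E $ i $ j * P $ i $ j)"
    by (simp add: trace_def matrix_matrix_mult_def) (subst sum.swap, simp add: Es)
  ultimately have "2 * trace (E ** P) = (\<Sum>i\<in>UNIV. \<Sum>j\<in>UNIV. E $ i $ j * (P $ i $ j + P $ j $ i))"
    by (simp add: distrib_left sum.distrib)
  also have "\<dots> \<le> (\<Sum>i\<in>UNIV. \<Sum>j\<in>UNIV. \<kappa> * (P $ i $ i + P $ j $ j))"
  proof (intro sum_mono)
    fix i j
    have "\<bar>E $ i $ j * (P $ i $ j + P $ j $ i)\<bar> \<le> \<kappa> * (P $ i $ i + P $ j $ j)"
      unfolding abs_mult using G[of i j] matrix_form_entries(2)[OF P, of i j]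
      by (intro mult_mono) (auto simp: E_def \<kappa>)
    then show "E $ i $ j * (P $ i $ j + P $ j $ i) \<le> \<kappa> * (P $ i $ i + P $ j $ j)" by linarith
  qed
  also have "\<dots> = 2 * (\<kappa> * ?N * trace P)"
    by (simp add: trace_def sum.distrib distrib_left sum_distrib_left mult_ac)
  finally have EP: "trace (E ** P) \<le> \<kappa> * ?N * trace P" by simp
  have "G ** (c *\<^sub>R mat 1) = c *\<^sub>R G"
    by (metis matrix_mul_rid matrix_scalar_ac scalar_matrix_assoc)
  then have "trace (G ** X) = trace (G ** P) - c * trace G"
    unfolding P_def by (simp add: matrix_add_ldistrib trace_add trace_scaleR)
  also have "trace (G ** P) = trace P + trace (E ** P)"
  proof -
    have "(mat 1 + E) ** P = mat 1 ** P + E ** P"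
      by (simp add: vec_eq_iff matrix_matrix_mult_def distrib_right sum.distrib)
    then show ?thesis by (simp add: trace_add E_def)
  qed
  finally have 1: "f + \<gamma> \<le> (1 + \<kappa> * ?N) * trace P - c * trace G"
    using EP \<gamma> by (simp add: distrib_right)
  have "?N - \<kappa> * ?N \<le> trace G"
  proof -
    have "(\<Sum>i\<in>(UNIV :: 'n set). 1 - \<kappa>) \<le> trace G"
      unfolding trace_def using G by (intro sum_mono) (auto simp: mat_def abs_le_iff algebra_simps dest: spec, smt (verit) mat_def)
    then show ?thesis by (simp add: algebra_simps)
  qed
  then have "c * (?N - \<kappa> * ?N) \<le> c * trace G" using c by (intro mult_left_mono)
  with 1 have 2: "f + \<gamma> + c * ?N - c * \<kappa> * ?N \<le> (1 + \<kappa> * ?N) * trace P"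
    by (simp add: algebra_simps)
  have "\<kappa> * ?N * f \<le> \<kappa> * ?N * \<bar>f\<bar>" using \<kappa> by (intro mult_left_mono) auto
  with small have "(1 + \<kappa> * ?N) * (f + c * ?N) \<le> f + \<gamma> + c * ?N - c * \<kappa> * ?N"
    by (simp add: algebra_simps)
  with 2 have "(1 + \<kappa> * ?N) * (f + c * ?N) \<le> (1 + \<kappa> * ?N) * trace P" by linarith
  moreover have "0 < 1 + \<kappa> * ?N" using \<kappa> by (simp add: add_pos_nonneg)
  ultimately have "f + c * ?N \<le> trace P" by simp
  then show ?thesis using trP by simp
qed

text \<open>A test function touching \<open>u\<close> from above near \<open>x0\<close>, translated to the corresponding maximizer \<open>z1\<close>,
touches \<open>\<phi>\<close>, so the viscosity inequality holds at \<open>z1\<close>. By \<open>maximizer_slope\<close> the gradient there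
is close to \<open>p\<close> and \<open>z1\<close> is close to \<open>x0 + \<delta> p\<close>, so the lower order term is close to its value at
that point. In the coordinates given by \<open>S\<close> the diffusion matrix is the identity at \<open>x0 + \<delta> p\<close>
and close to it at \<open>z1\<close>; by semiconvexity, \<open>trace_perturb\<close> applies.\<close>

lemma (in bounded_sup_conv) laplacian_ge_sup_conv:
  fixes S T :: "real ^ 'n ^ 'n"
  assumes A: "continuous_on UNIV A" "\<And>x. transpose (A x) = A x"
    and b: "continuous_on UNIV (\<lambda>(x, r, p). b x r p)"
    and sub: "visc_sub A b \<phi>"
    and C: "0 \<le> C" and s: "0 < s"
    and touch: "\<And>h. norm h < s \<Longrightarrow> u (x0 + h) \<le> u x0 + p \<bullet> h + C * (norm h)\<^sup>2"
    and xa: "xa = x0 + \<delta> *\<^sub>R p"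
    and S: "S ** transpose S = A xa" and T: "T ** S = mat 1"
    and f: "f < b xa (\<phi> xa) p"
  shows "\<exists>\<rho>>0. laplacian_ge f \<rho> (\<lambda>z. u (x0 + S *v z))"
proof -
  have T': "S ** T = mat 1" using T by (simp add: matrix_left_right_inverse)
  have STv: "S *v (T *v y) = y" for y by (simp add: matrix_vector_mul_assoc T')
  obtain z0 where z0: "u x0 = \<phi> z0 - (norm (x0 - z0))\<^sup>2 / (2 * \<delta>)" using sup_conv_attained(2) by blast
  have "z0 = xa" using maximizer_at_touch[OF s touch z0] unfolding xa by simp
  then have z0p: "(z0 - x0) /\<^sub>R \<delta> = p" using \<delta> unfolding xa by simp
  obtain K where K: "0 < K" "\<And>y. norm (S *v y) \<le> norm y * K"
    using bounded_linear.pos_bounded[OF matrix_vector_mul_bounded_linear[of S]] by blast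
  obtain K' where K': "0 < K'" "\<And>y. norm (T *v y) \<le> norm y * K'"
    using bounded_linear.pos_bounded[OF matrix_vector_mul_bounded_linear[of T]] by blast
  define c where "c = K\<^sup>2 / (2 * \<delta>)"
  define N where "N = real CARD('n)"
  define \<gamma> where "\<gamma> = (b xa (\<phi> xa) p - f) / 2"
  define \<kappa> where "\<kappa> = \<gamma> / (N * (\<bar>f\<bar> + 2 * c + 2 * c * N) + 1)"
  have c: "0 \<le> c" unfolding c_def using \<delta> by simp
  have N: "0 \<le> N" unfolding N_def by simp
  have \<gamma>: "0 < \<gamma>" "f + \<gamma> < b xa (\<phi> xa) p" unfolding \<gamma>_def using f by (auto simp: field_simps)
  have den: "0 \<le> N * (\<bar>f\<bar> + 2 * c + 2 * c * N)" using c N by simp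
  have \<kappa>: "0 < \<kappa>" unfolding \<kappa>_def using \<gamma> den by (intro divide_pos_pos) auto
  have small: "\<kappa> * N * (\<bar>f\<bar> + 2 * c + 2 * c * N) \<le> \<gamma>"
  proof -
    have "\<kappa> * (N * (\<bar>f\<bar> + 2 * c + 2 * c * N)) \<le> \<kappa> * (N * (\<bar>f\<bar> + 2 * c + 2 * c * N) + 1)"
      using \<kappa> by (intro mult_left_mono) auto
    also have "\<dots> = \<gamma>" unfolding \<kappa>_def using den by simp
    finally show ?thesis by (simp add: mult.assoc)
  qed
  \<comment> \<open>the diffusion matrix in the coordinates given by \<open>S\<close>\<close>
  define G where "G z = T ** A z ** transpose T" for z
  have Gs: "transpose (G z) = G z" for z
    unfolding G_def by (simp add: matrix_transpose_mul A(2) matrix_mul_assoc)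
  have Gxa: "G xa = mat 1"
  proof -
    have "G xa = (T ** S) ** transpose (T ** S)"
      unfolding G_def S[symmetric] by (simp add: matrix_transpose_mul matrix_mul_assoc)
    then show ?thesis by (simp add: T transpose_mat)
  qed
  have "continuous_on UNIV G"
    unfolding G_def matrix_matrix_mult_def by (intro continuous_on_vec_lambda continuous_intros A(1))
  then obtain e1 where e1: "e1 > 0" "\<And>z. norm (z - xa) < e1 \<Longrightarrow> norm (G z - mat 1) < \<kappa>"
    using \<kappa> Gxa unfolding continuous_on_iff dist_norm by (metis UNIV_I)
  have "continuous_on UNIV (\<lambda>y. b (fst y) (\<phi> (fst y)) (snd y))"
    by (rule continuous_on_compose2[OF b, of _ "\<lambda>y. (fst y, \<phi> (fst y), snd y)", simplified])
      (intro continuous_intros continuous_on_compose2[OF cont]; simp)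
  then have "open {y. f + \<gamma> < b (fst y) (\<phi> (fst y)) (snd y)}"
    by (intro open_Collect_less continuous_intros)
  then obtain e2 where e2: "e2 > 0" "\<And>y. dist y (xa, p) < e2 \<Longrightarrow> f + \<gamma> < b (fst y) (\<phi> (fst y)) (snd y)"
  proof -
    assume *: "\<And>e. e > 0 \<Longrightarrow> (\<And>y. dist y (xa, p) < e \<Longrightarrow> f + \<gamma> < b (fst y) (\<phi> (fst y)) (snd y)) \<Longrightarrow> thesis"
    have "(xa, p) \<in> {y. f + \<gamma> < b (fst y) (\<phi> (fst y)) (snd y)}" using \<gamma>(2) by simp
    from bspec[OF iffD1[OF open_dist \<open>open _\<close>] this] show thesis using * by auto
  qed
  define K2 where "K2 = 4 * C + 1 / \<delta>"
  have K2: "0 \<le> K2" "0 \<le> \<delta> * K2" unfolding K2_def using C \<delta> by auto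
  define t where "t = min (s / 4) (min e1 e2 / (2 * (1 + \<delta> * K2 + K2)))"
  have t: "0 < t" "2 * t < s" "t + \<delta> * (K2 * t) + K2 * t < min e1 e2"
  proof -
    have "t \<le> s / 4" unfolding t_def by (rule min.cobounded1)
    then show "2 * t < s" using s by simp
    show "0 < t" unfolding t_def using s e1 e2 K2 by auto
    have "t \<le> min e1 e2 / (2 * (1 + \<delta> * K2 + K2))" unfolding t_def by simp
    then have "t * (2 * (1 + \<delta> * K2 + K2)) \<le> min e1 e2" using K2 by (subst (asm) pos_le_divide_eq) auto
    moreover have "0 < t * (1 + \<delta> * K2 + K2)" using \<open>0 < t\<close> K2 by (intro mult_pos_pos) auto
    ultimately show "t + \<delta> * (K2 * t) + K2 * t < min e1 e2" by (simp add: algebra_simps)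
  qed
  have "laplacian_ge f (t / K) (\<lambda>z. u (x0 + S *v z))"
    unfolding laplacian_ge_def
  proof (intro allI impI)
    fix \<theta> :: "real ^ 'n \<Rightarrow> real" and D D2 and \<zeta> :: "real ^ 'n"
    assume C2: "C2_with \<theta> D D2" and \<zeta>: "norm \<zeta> < t / K"
      and mx: "\<forall>\<^sub>F y in nhds \<zeta>. u (x0 + S *v y) - \<theta> y \<le> u (x0 + S *v \<zeta>) - \<theta> \<zeta>"
    define h1 where "h1 = S *v \<zeta>"
    have h1: "norm h1 \<le> t" using K(2)[of \<zeta>] \<zeta> K(1) unfolding h1_def by (simp add: field_simps)
    obtain z1 where z1: "u (x0 + h1) = \<phi> z1 - (norm (x0 + h1 - z1))\<^sup>2 / (2 * \<delta>)" using sup_conv_attained(2) by blast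
    define q1 where "q1 = (z1 - (x0 + h1)) /\<^sub>R \<delta>"
    have q1: "norm (q1 - p) \<le> K2 * t"
      unfolding q1_def K2_def by (rule maximizer_slope[OF C touch t(1,2) h1 z0 z0p z1])
    have z1eq: "z1 = x0 + h1 + \<delta> *\<^sub>R q1" unfolding q1_def using \<delta> by simp
    have "norm (z1 - xa) = norm (h1 + \<delta> *\<^sub>R (q1 - p))"
      unfolding z1eq xa by (simp add: algebra_simps)
    also have "\<dots> \<le> norm h1 + \<delta> * norm (q1 - p)"
      using norm_triangle_ineq[of h1 "\<delta> *\<^sub>R (q1 - p)"] \<delta> by simp
    also have "\<dots> \<le> t + \<delta> * (K2 * t)" using h1 q1 \<delta> by (intro add_mono mult_left_mono) auto
    finally have z1xa: "norm (z1 - xa) \<le> t + \<delta> * (K2 * t)" .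
    obtain d where d: "d > 0" "\<And>y. dist y \<zeta> < d \<Longrightarrow> u (x0 + S *v y) - \<theta> y \<le> u (x0 + S *v \<zeta>) - \<theta> \<zeta>"
      using mx unfolding eventually_nhds_metric by auto
    have below: "\<forall>\<^sub>F h in nhds 0. \<theta> \<zeta> + (transpose S *v q1) \<bullet> h - c * (norm h)\<^sup>2 \<le> \<theta> (\<zeta> + h)"
      unfolding eventually_nhds_metric
    proof (intro exI conjI allI impI)
      fix h :: "real ^ 'n" assume "dist h 0 < d"
      then have 1: "u (x0 + S *v (\<zeta> + h)) - \<theta> (\<zeta> + h) \<le> u (x0 + S *v \<zeta>) - \<theta> \<zeta>"
        by (intro d(2)) (simp add: dist_norm)
      have 2: "u (x0 + h1) + q1 \<bullet> (S *v h) - 1 / (2 * \<delta>) * (norm (S *v h))\<^sup>2 \<le> u (x0 + h1 + S *v h)"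
        unfolding q1_def by (rule sup_conv_lower[OF z1])
      have "(norm (S *v h))\<^sup>2 \<le> (norm h * K)\<^sup>2" by (rule power_mono[OF K(2)]) simp
      then have 3: "1 / (2 * \<delta>) * (norm (S *v h))\<^sup>2 \<le> c * (norm h)\<^sup>2"
        unfolding c_def using \<delta> by (simp add: field_simps power_mult_distrib)
      have 4: "(transpose S *v q1) \<bullet> h = q1 \<bullet> (S *v h)"
        by (simp add: dot_lmul_matrix)
      show "\<theta> \<zeta> + (transpose S *v q1) \<bullet> h - c * (norm h)\<^sup>2 \<le> \<theta> (\<zeta> + h)"
        using 1 2 3 unfolding 4 h1_def by (simp add: matrix_vector_right_distrib add.assoc)
    qed (rule d(1))
    note lo = C2_touched_below[OF C2 below]
    have D\<zeta>: "transpose T *v D \<zeta> = q1"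
    proof -
      have "transpose T *v (transpose S *v q1) = transpose (S ** T) *v q1"
        by (simp add: matrix_transpose_mul matrix_vector_mul_assoc del: transpose_matrix_vector)
      then show ?thesis unfolding lo(1) by (simp add: T' transpose_mat)
    qed
    \<comment> \<open>with this shift, \<open>y \<mapsto> \<theta> (T *v y + w)\<close> is the test function translated from \<open>x0 + h1\<close> to \<open>z1\<close>\<close>
    define w where "w = \<zeta> - T *v z1"
    have w: "T *v z1 + w = \<zeta>" unfolding w_def by simp
    have ev: "\<forall>\<^sub>F y in nhds z1. \<phi> y - \<theta> (T *v y + w) \<le> \<phi> z1 - \<theta> (T *v z1 + w)"
      unfolding eventually_nhds_metric
    proof (intro exI conjI allI impI)
      fix y assume y: "dist y z1 < d / K'"
      have "T *v y + w - \<zeta> = T *v (y - z1)" unfolding w_def by (simp add: matrix_vector_mult_diff_distrib)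
      then have "dist (T *v y + w) \<zeta> \<le> norm (y - z1) * K'" using K'(2)[of "y - z1"] by (simp add: dist_norm)
      also have "\<dots> < d" using y K'(1) by (simp add: dist_norm field_simps)
      finally have "u (x0 + S *v (T *v y + w)) - \<theta> (T *v y + w) \<le> u (x0 + h1) - \<theta> \<zeta>"
        unfolding h1_def by (rule d(2))
      moreover have "x0 + S *v (T *v y + w) = y + (x0 + h1 - z1)"
        unfolding w_def h1_def
        by (simp add: matrix_vector_right_distrib matrix_vector_mult_diff_distrib STv)
      ultimately have "u (y + (x0 + h1 - z1)) - \<theta> (T *v y + w) \<le> u (x0 + h1) - \<theta> \<zeta>"
        by (simp only:)
      moreover have "\<phi> y - (norm (x0 + h1 - z1))\<^sup>2 / (2 * \<delta>) \<le> u (y + (x0 + h1 - z1))"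
        using sup_conv_attained(1)[of y "y + (x0 + h1 - z1)"] by simp
      ultimately show "\<phi> y - \<theta> (T *v y + w) \<le> \<phi> z1 - \<theta> (T *v z1 + w)" using z1 w by simp
    qed (use d K' in simp)
    have "b z1 (\<phi> z1) (transpose T *v D (T *v z1 + w)) \<le> trace (A z1 ** (transpose T ** D2 (T *v z1 + w) ** T))"
      using sub C2_with_affine[OF C2, of T w] ev unfolding visc_sub_def by blast
    then have "b z1 (\<phi> z1) q1 \<le> trace (A z1 ** (transpose T ** D2 \<zeta> ** T))" unfolding w D\<zeta> .
    also have "\<dots> = trace (G z1 ** D2 \<zeta>)"
      using trace_mul_sym[of "A z1 ** transpose T ** D2 \<zeta>" T]
      unfolding G_def by (simp add: matrix_mul_assoc)
    finally have 1: "b z1 (\<phi> z1) q1 \<le> trace (G z1 ** D2 \<zeta>)" .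
    have "dist (z1, q1) (xa, p) \<le> dist z1 xa + dist q1 p"
      unfolding dist_Pair_Pair by (rule sqrt_sum_squares_le_sum) auto
    also have "\<dots> < e2" using z1xa q1 t(3) by (simp add: dist_norm)
    finally have "f + \<gamma> < b z1 (\<phi> z1) q1" using e2(2)[of "(z1, q1)"] by simp
    with 1 have 2: "f + \<gamma> \<le> trace (G z1 ** D2 \<zeta>)" by linarith
    show "f \<le> trace (D2 \<zeta>)"
    proof (rule trace_perturb[OF _ _ Gs _ 2])
      show "- (2 * c) * (norm \<xi>)\<^sup>2 \<le> \<xi> \<bullet> (D2 \<zeta> *v \<xi>)" for \<xi> using lo(2)[of \<xi>] by simp
      show "0 \<le> 2 * c" using c by simp
      have "0 \<le> K2 * t" using K2 t by simp
      then have n: "norm (G z1 - mat 1) < \<kappa>" by (intro e1(2)) (use z1xa t(3) in linarith)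
      show "\<bar>G z1 $ i $ j - mat 1 $ i $ j\<bar> \<le> \<kappa>" for i j
        using component_le_norm_cart[of "(G z1 - mat 1) $ i" j] Finite_Cartesian_Product.norm_nth_le[of "G z1 - mat 1" i] n by simp
      show "\<kappa> * real CARD('n) * (\<bar>f\<bar> + 2 * c + 2 * c * real CARD('n)) \<le> \<gamma>" using small unfolding N_def .
    qed
  qed
  moreover have "0 < t / K" using t K by simp
  ultimately show ?thesis by blast
qed

section \<open>Doubling the variables\<close>

text \<open>Adding the submean inequalities of \<open>U\<close> and \<open>W\<close>, the average of \<open>U + W\<close> exceeds its value at \<open>0\<close> by
about \<open>(f + g) * t\<close>. The quadratic bound near \<open>0\<close>, and a multiple of \<open>\<bar>z\<bar>\<^sup>4\<close> away from it, bound the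
same average from above by the value at \<open>0\<close> plus \<open>2 * t * trace M + O(t\<^sup>2)\<close>.\<close>

lemma laplacian_sum_le_quadratic:
  fixes U W :: "real ^ 'n \<Rightarrow> real"
  assumes U: "continuous_on UNIV U" "\<And>x. \<bar>U x\<bar> \<le> B" "semiconvex c U" "laplacian_ge f \<rho> U"
    and W: "continuous_on UNIV W" "\<And>x. \<bar>W x\<bar> \<le> B" "semiconvex c W" "laplacian_ge g \<rho> W"
    and c: "0 \<le> c" and \<rho>: "0 < \<rho>" and s: "0 < s"
    and touch: "\<And>z. norm z < s \<Longrightarrow> U z + W z \<le> U 0 + W 0 + l \<bullet> z + z \<bullet> (M *v z)"
  shows "f + g \<le> 2 * trace M"
proof (rule ccontr)
  assume neg: "\<not> ?thesis"
  define \<eta> where "\<eta> = (f + g - 2 * trace M) / 4"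
  have \<eta>: "0 < \<eta>" unfolding \<eta>_def using neg by simp
  obtain t1 where t1: "t1 > 0" "\<And>t. 0 < t \<Longrightarrow> t \<le> t1 \<Longrightarrow> U 0 + (f - \<eta>) * t \<le> gauss_avg 2 t U"
    using gaussian_submean[OF U(1,2) c U(3) \<rho> U(4) \<eta>] by blast
  obtain t2 where t2: "t2 > 0" "\<And>t. 0 < t \<Longrightarrow> t \<le> t2 \<Longrightarrow> W 0 + (g - \<eta>) * t \<le> gauss_avg 2 t W"
    using gaussian_submean[OF W(1,2) c W(3) \<rho> W(4) \<eta>] by blast
  define d where "d = U 0 + W 0"
  let ?q = "\<lambda>z. d + l \<bullet> z + z \<bullet> (M *v z)"
  have cq: "continuous_on UNIV ?q"
    by (intro continuous_intros matrix_vector_mult_linear_continuous_on)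
  have "bounded (?q ` (cube 2 :: (real ^ 'n) set))"
    by (intro compact_imp_bounded compact_continuous_image continuous_on_subset[OF cq]) (auto simp: cube_def)
  then obtain E where E: "\<And>z. z \<in> cube 2 \<Longrightarrow> \<bar>?q z\<bar> \<le> E" unfolding bounded_iff by auto
  define K where "K = (2 * B + E) / s ^ 4"
  have B0: "0 \<le> B" using U(2)[of 0] by linarith
  have "(0 :: real ^ 'n) \<in> cube 2" by (simp add: mem_cube)
  then have E0: "0 \<le> E" using E[of 0] by linarith
  have K: "0 \<le> K" unfolding K_def using B0 E0 s by simp
  have le: "U z + W z \<le> ?q z + K * norm z ^ 4" if z: "z \<in> cube 2" for z
  proof (cases "norm z < s")
    case True
    have "0 \<le> K * norm z ^ 4" using K by simp
    then show ?thesis using touch[OF True] unfolding d_def by linarith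
  next
    case False
    have "U z + W z \<le> 2 * B" using U(2)[of z] W(2)[of z] by (simp add: abs_le_iff)
    also have "\<dots> = K * s ^ 4 - E" unfolding K_def using s by simp
    also have "\<dots> \<le> K * norm z ^ 4 + ?q z"
      using E[OF z] False s K by (intro add_mono[of "K * s ^ 4" _ "- E", simplified] mult_left_mono power_mono) (auto simp: abs_le_iff)
    finally show ?thesis by simp
  qed
  obtain C where C: "C \<ge> 0" "\<And>t d l. 0 < t \<Longrightarrow> t \<le> 1 \<Longrightarrow>
      \<bar>gauss_avg 2 t (\<lambda>z. d + l \<bullet> z + z \<bullet> (M *v z)) - (d + 2 * t * trace M)\<bar> \<le> C * (\<bar>d\<bar> + 1) * t\<^sup>2"
    using gauss_avg_quadratic[of 2 M] by auto
  define C' where "C' = C * (\<bar>d\<bar> + 1) + K * (12 * (real CARD('n))\<^sup>2)"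
  have C': "0 \<le> C'" unfolding C'_def using C(1) K by simp
  define t where "t = min (min 1 (\<eta> / (C' + 1))) (min t1 t2)"
  have t: "0 < t" "t \<le> 1" "t \<le> t1" "t \<le> t2" "t \<le> \<eta> / (C' + 1)"
    unfolding t_def using t1(1) t2(1) \<eta> C' by auto
  have "d + (f + g - 2 * \<eta>) * t \<le> gauss_avg 2 t U + gauss_avg 2 t W"
    using t1(2)[of t] t2(2)[of t] t unfolding d_def by (simp add: algebra_simps)
  also have "\<dots> = gauss_avg 2 t (\<lambda>z. U z + W z)"
    by (rule gauss_avg_add[symmetric, OF U(1) W(1)])
  also have "\<dots> \<le> gauss_avg 2 t (\<lambda>z. ?q z + K * norm z ^ 4)"
    by (intro gauss_avg_mono continuous_intros U(1) W(1) cq le)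
  also have "\<dots> = gauss_avg 2 t ?q + K * gauss_avg 2 t (\<lambda>z :: real ^ 'n. norm z ^ 4)"
    by (subst gauss_avg_add[OF cq]) (auto simp: gauss_avg_cmult intro!: continuous_intros)
  also have "K * gauss_avg 2 t (\<lambda>z :: real ^ 'n. norm z ^ 4) \<le> K * (12 * (real CARD('n))\<^sup>2 * t\<^sup>2)"
    using t K by (intro mult_left_mono gauss_avg_quartic) auto
  also have "gauss_avg 2 t ?q \<le> d + 2 * t * trace M + C * (\<bar>d\<bar> + 1) * t\<^sup>2"
    using C(2)[OF t(1,2), of d l] by linarith
  finally have "(f + g - 2 * \<eta> - 2 * trace M) * t \<le> C' * t\<^sup>2"
    unfolding C'_def by (simp add: algebra_simps)
  moreover have "f + g - 2 * \<eta> - 2 * trace M = 2 * \<eta>" unfolding \<eta>_def by (simp add: field_simps)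
  ultimately have "2 * \<eta> * t \<le> C' * t * t" by (simp add: power2_eq_square mult.assoc)
  then have "2 * \<eta> \<le> C' * t" using t by simp
  also have "\<dots> \<le> (C' + 1) * t" using t by simp
  also have "\<dots> \<le> \<eta>" using t(5) C' by (simp add: field_simps)
  finally show False using \<eta> by simp
qed

lemma semiconvex_compose:
  fixes S :: "real ^ 'n ^ 'n"
  assumes sc: "semiconvex c u" and c: "0 \<le> c" and K: "\<And>y. norm (S *v y) \<le> K * norm y"
  shows "semiconvex (c * K\<^sup>2) (\<lambda>z. u (x0 + S *v z))"
  unfolding semiconvex_def
proof
  fix x
  obtain q where q: "\<And>z. u (x0 + S *v x) + q \<bullet> z - c * (norm z)\<^sup>2 \<le> u (x0 + S *v x + z)"
    using sc unfolding semiconvex_def by blast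
  show "\<exists>q. \<forall>z. u (x0 + S *v x) + q \<bullet> z - c * K\<^sup>2 * (norm z)\<^sup>2 \<le> u (x0 + S *v (x + z))"
  proof (intro exI allI)
    fix z
    have "c * (norm (S *v z))\<^sup>2 \<le> c * (K * norm z)\<^sup>2" by (intro mult_left_mono power_mono K c) simp
    moreover have "(transpose S *v q) \<bullet> z = q \<bullet> (S *v z)" by (simp add: dot_lmul_matrix)
    ultimately show "u (x0 + S *v x) + (transpose S *v q) \<bullet> z - c * K\<^sup>2 * (norm z)\<^sup>2 \<le> u (x0 + S *v (x + z))"
      using q[of "S *v z"] by (simp add: matrix_vector_right_distrib add.assoc power_mult_distrib)
  qed
qed

lemma trace_transpose_mul: "trace (transpose Q ** Q) = (norm (Q :: real ^ 'n ^ 'n))\<^sup>2"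
proof -
  have "trace (transpose Q ** Q) = (\<Sum>i\<in>UNIV. \<Sum>k\<in>UNIV. Q $ k $ i * Q $ k $ i)"
    by (simp add: trace_def matrix_matrix_mult_def transpose_def)
  also have "\<dots> = (\<Sum>k\<in>UNIV. \<Sum>i\<in>UNIV. Q $ k $ i * Q $ k $ i)" by (rule sum.swap)
  also have "\<dots> = (norm Q)\<^sup>2" by (simp add: power2_norm_eq_inner inner_vec_def)
  finally show ?thesis .
qed

text \<open>As a function of the squared distance, the penalty is composed with a polynomial, so
its expansion follows from a one-dimensional one: the increment of \<open>\<bar>z\<bar>\<^sup>2\<close> is \<open>2 z0 \<bullet> h + \<bar>h\<bar>\<^sup>2\<close>.\<close>

lemma squared_norm_expansion:
  fixes z0 :: "real ^ 'n" and w :: "real \<Rightarrow> real"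
  assumes taylor: "\<And>\<kappa>. 0 < \<kappa> \<Longrightarrow> \<exists>s>0. \<forall>a. \<bar>a\<bar> < s \<longrightarrow>
      w ((norm z0)\<^sup>2 + a) \<le> w ((norm z0)\<^sup>2) + w1 * a + (w2 + \<kappa>) / 2 * a\<^sup>2"
    and \<kappa>: "0 < \<kappa>"
  shows "\<exists>s>0. \<forall>h. norm h < s \<longrightarrow> w ((norm (z0 + h))\<^sup>2) \<le> w ((norm z0)\<^sup>2) + ((2 * w1) *\<^sub>R z0) \<bullet> h
    + w1 * (norm h)\<^sup>2 + 2 * w2 * (z0 \<bullet> h)\<^sup>2 + \<kappa> * (norm h)\<^sup>2"
proof -
  define R where "R = 2 * norm z0 + 1"
  have R: "R \<ge> 1" unfolding R_def by simp
  define \<kappa>' where "\<kappa>' = \<kappa> / R\<^sup>2"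
  have \<kappa>': "0 < \<kappa>'" unfolding \<kappa>'_def using \<kappa> R by simp
  obtain s where s: "s > 0" "\<And>a. \<bar>a\<bar> < s \<Longrightarrow>
      w ((norm z0)\<^sup>2 + a) \<le> w ((norm z0)\<^sup>2) + w1 * a + (w2 + \<kappa>') / 2 * a\<^sup>2"
    using taylor[OF \<kappa>'] by blast
  define s' where "s' = min 1 (min (s / R) (\<kappa> / (2 * (\<bar>w2\<bar> + 1) * R)))"
  have s': "s' > 0" unfolding s'_def using s \<kappa> R by (auto intro!: divide_pos_pos mult_pos_pos add_nonneg_pos)
  have "w ((norm (z0 + h))\<^sup>2) \<le> w ((norm z0)\<^sup>2) + ((2 * w1) *\<^sub>R z0) \<bullet> h
    + w1 * (norm h)\<^sup>2 + 2 * w2 * (z0 \<bullet> h)\<^sup>2 + \<kappa> * (norm h)\<^sup>2" if h: "norm h < s'" for h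
  proof -
    define n where "n = norm h"
    have n: "0 \<le> n" "n \<le> 1" "n < s / R" "n \<le> \<kappa> / (2 * (\<bar>w2\<bar> + 1) * R)"
      using h unfolding n_def s'_def by auto
    define e where "e = z0 \<bullet> h"
    have e: "\<bar>e\<bar> \<le> norm z0 * n" unfolding e_def n_def by (rule Cauchy_Schwarz_ineq2)
    define a where "a = 2 * e + n\<^sup>2"
    have nn: "n\<^sup>2 \<le> n" using n by (simp add: power2_eq_square mult_left_le)
    have n2: "0 \<le> n\<^sup>2" by simp
    have "\<bar>a\<bar> \<le> 2 * (norm z0 * n) + n" unfolding a_def using e nn n2 by linarith
    then have aR: "\<bar>a\<bar> \<le> R * n" unfolding R_def by (simp add: algebra_simps)
    also have "\<dots> < s" using n(3) R by (simp add: field_simps)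
    finally have "\<bar>a\<bar> < s" .
    have eq: "(norm (z0 + h))\<^sup>2 = (norm z0)\<^sup>2 + a"
      unfolding a_def e_def n_def by (simp add: power2_norm_eq_inner inner_simps inner_commute)
    have 1: "\<kappa>' / 2 * a\<^sup>2 \<le> \<kappa> / 2 * n\<^sup>2"
    proof -
      have "a\<^sup>2 \<le> (R * n)\<^sup>2" using aR by (metis abs_ge_zero power2_abs power_mono)
      then have "\<kappa>' / 2 * a\<^sup>2 \<le> \<kappa>' / 2 * (R * n)\<^sup>2" using \<kappa>' by (intro mult_left_mono) auto
      also have "\<dots> = \<kappa> / 2 * n\<^sup>2" unfolding \<kappa>'_def using R by (simp add: power_mult_distrib)
      finally show ?thesis .
    qed
    have 2: "w2 / 2 * a\<^sup>2 \<le> 2 * w2 * e\<^sup>2 + \<kappa> / 2 * n\<^sup>2"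
    proof -
      have "w2 / 2 * a\<^sup>2 - 2 * w2 * e\<^sup>2 = w2 * (2 * e + n\<^sup>2 / 2) * n\<^sup>2"
        unfolding a_def by (simp add: power2_eq_square algebra_simps)
      also have "\<dots> \<le> \<kappa> / 2 * n\<^sup>2"
      proof (rule mult_right_mono)
        have "w2 * (2 * e + n\<^sup>2 / 2) \<le> \<bar>w2\<bar> * \<bar>2 * e + n\<^sup>2 / 2\<bar>" by (metis abs_ge_self abs_mult)
        also have "\<dots> \<le> (\<bar>w2\<bar> + 1) * (R * n)"
        proof (rule mult_mono)
          have "\<bar>2 * e + n\<^sup>2 / 2\<bar> \<le> 2 * (norm z0 * n) + n" using e nn n2 by linarith
          then show "\<bar>2 * e + n\<^sup>2 / 2\<bar> \<le> R * n" unfolding R_def by (simp add: algebra_simps)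
        qed auto
        also have "\<dots> \<le> \<kappa> / 2"
        proof -
          have "0 < 2 * (\<bar>w2\<bar> + 1) * R" using R by simp
          from n(4)[unfolded pos_le_divide_eq[OF this]] show ?thesis by (simp add: mult_ac)
        qed
        finally show "w2 * (2 * e + n\<^sup>2 / 2) \<le> \<kappa> / 2" .
      qed simp
      finally show ?thesis by simp
    qed
    have "(w2 + \<kappa>') / 2 * a\<^sup>2 = w2 / 2 * a\<^sup>2 + \<kappa>' / 2 * a\<^sup>2" by (simp add: field_simps)
    then have "w ((norm z0)\<^sup>2 + a) \<le> w ((norm z0)\<^sup>2) + w1 * a + (2 * w2 * e\<^sup>2 + \<kappa> / 2 * n\<^sup>2) + \<kappa> / 2 * n\<^sup>2"
      using s(2)[OF \<open>\<bar>a\<bar> < s\<close>] 1 2 by linarith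
    then show ?thesis unfolding eq
      by (simp add: a_def[symmetric] e_def[symmetric] n_def[symmetric])
        (simp add: a_def algebra_simps)
  qed
  with s' show ?thesis by blast
qed

text \<open>Freezing one of the two variables at its maximum point touches the function of the other one from
above.\<close>

lemma doubling_touch:
  fixes u1 u2 :: "real ^ 'n \<Rightarrow> real"
  assumes max: "\<And>x y. u1 x + u2 y - w ((norm (x - y))\<^sup>2) \<le> u1 x0 + u2 y0 - w ((norm (x0 - y0))\<^sup>2)"
    and taylor: "\<And>\<kappa>. 0 < \<kappa> \<Longrightarrow> \<exists>s>0. \<forall>a. \<bar>a\<bar> < s \<longrightarrow>
      w ((norm (x0 - y0))\<^sup>2 + a) \<le> w ((norm (x0 - y0))\<^sup>2) + w1 * a + (w2 + \<kappa>) / 2 * a\<^sup>2"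
    and p: "p = (2 * w1) *\<^sub>R (x0 - y0)"
  shows "\<exists>C\<ge>0. \<exists>s>0. (\<forall>h. norm h < s \<longrightarrow> u1 (x0 + h) \<le> u1 x0 + p \<bullet> h + C * (norm h)\<^sup>2) \<and>
    (\<forall>h. norm h < s \<longrightarrow> u2 (y0 + h) \<le> u2 y0 + (- p) \<bullet> h + C * (norm h)\<^sup>2)" (is ?touch)
    and "0 < \<kappa> \<Longrightarrow> \<exists>s>0. \<forall>h. norm h < s \<longrightarrow> w ((norm (x0 - y0 + h))\<^sup>2) - w ((norm (x0 - y0))\<^sup>2) \<le> p \<bullet> h
      + w1 * (norm h)\<^sup>2 + 2 * w2 * ((x0 - y0) \<bullet> h)\<^sup>2 + \<kappa> * (norm h)\<^sup>2" (is "_ \<Longrightarrow> ?expansion")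
proof -
  define z0 where "z0 = x0 - y0"
  have touch: "\<exists>s>0. \<forall>h. norm h < s \<longrightarrow> w ((norm (z0 + h))\<^sup>2) - w ((norm z0)\<^sup>2) \<le> p \<bullet> h
    + w1 * (norm h)\<^sup>2 + 2 * w2 * (z0 \<bullet> h)\<^sup>2 + \<kappa> * (norm h)\<^sup>2" if "0 < \<kappa>" for \<kappa>
    using squared_norm_expansion[of w z0 w1 w2 \<kappa>, OF taylor[folded z0_def] that]
    unfolding p z0_def[symmetric] by (simp add: algebra_simps)
  define C where "C = \<bar>w1\<bar> + 2 * \<bar>w2\<bar> * (norm z0)\<^sup>2 + 1"
  have C: "0 \<le> C" unfolding C_def by simp
  obtain s where s: "s > 0" "\<And>h. norm h < s \<Longrightarrow> w ((norm (z0 + h))\<^sup>2) - w ((norm z0)\<^sup>2) \<le> p \<bullet> h + C * (norm h)\<^sup>2"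
  proof -
    obtain s where s: "s > 0" "\<And>h. norm h < s \<Longrightarrow> w ((norm (z0 + h))\<^sup>2) - w ((norm z0)\<^sup>2) \<le> p \<bullet> h
      + w1 * (norm h)\<^sup>2 + 2 * w2 * (z0 \<bullet> h)\<^sup>2 + 1 * (norm h)\<^sup>2"
      using touch[of 1] by (metis zero_less_one)
    have "w1 * (norm h)\<^sup>2 + 2 * w2 * (z0 \<bullet> h)\<^sup>2 + 1 * (norm h)\<^sup>2 \<le> C * (norm h)\<^sup>2" for h
    proof -
      have "(z0 \<bullet> h)\<^sup>2 \<le> (norm z0 * norm h)\<^sup>2"
        using Cauchy_Schwarz_ineq2[of z0 h] by (metis abs_ge_zero power2_abs power_mono)
      then have "\<bar>w2\<bar> * (z0 \<bullet> h)\<^sup>2 \<le> \<bar>w2\<bar> * (norm z0 * norm h)\<^sup>2" by (intro mult_left_mono) auto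
      moreover have "w2 * (z0 \<bullet> h)\<^sup>2 \<le> \<bar>w2\<bar> * (z0 \<bullet> h)\<^sup>2" "w1 * (norm h)\<^sup>2 \<le> \<bar>w1\<bar> * (norm h)\<^sup>2"
        by (intro mult_right_mono; simp)+
      ultimately show ?thesis unfolding C_def by (simp add: distrib_right power_mult_distrib)
    qed
    then show thesis using s by (intro that[of s]) (auto intro: order.trans add_left_mono simp: add.assoc, smt (verit))
  qed
  have t1: "u1 (x0 + h) \<le> u1 x0 + p \<bullet> h + C * (norm h)\<^sup>2" if "norm h < s" for h
    using max[of "x0 + h" y0] s(2)[OF that] unfolding z0_def by (simp add: algebra_simps)
  have t2: "u2 (y0 + h) \<le> u2 y0 + (- p) \<bullet> h + C * (norm h)\<^sup>2" if "norm h < s" for h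
    using max[of x0 "y0 + h"] s(2)[of "- h"] that unfolding z0_def by (simp add: algebra_simps)
  show ?touch using C s(1) t1 t2 by blast
  show "0 < \<kappa> \<Longrightarrow> ?expansion"
    using touch[of \<kappa>] unfolding z0_def .
qed

text \<open>The substitute for the theorem on sums. The variables \<open>x\<close> and \<open>y\<close> are moved along \<open>S1 z\<close> and \<open>S2 z\<close>
with the same \<open>z\<close>, so that \<open>x - y\<close> moves along \<open>(S1 - S2) z\<close>, and maximality bounds the sum of the
two sup-convolutions by the expansion of \<open>w\<close> in this direction. The right-hand side is the
trace of \<open>(S1 - S2)\<^sup>T Z (S1 - S2)\<close>, where \<open>Z\<close> is the Hessian of \<open>w (\<bar>z\<bar>\<^sup>2)\<close> at \<open>x0 - y0\<close>.\<close>

lemma doubling_inequality: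
  fixes \<phi>1 \<phi>2 :: "real ^ 'n \<Rightarrow> real" and S1 S2 :: "real ^ 'n ^ 'n"
  assumes b1: "bounded_sup_conv \<phi>1 B \<delta>" and b2: "bounded_sup_conv \<phi>2 B \<delta>"
    and A: "continuous_on UNIV A" "\<And>x. transpose (A x) = A x"
    and F1: "continuous_on UNIV (\<lambda>(x, r, p). F1 x r p)" "visc_sub A F1 \<phi>1"
    and F2: "continuous_on UNIV (\<lambda>(x, r, p). F2 x r p)" "visc_sub A F2 \<phi>2"
    and max: "\<And>x y. sup_conv \<delta> \<phi>1 x + sup_conv \<delta> \<phi>2 y - w ((norm (x - y))\<^sup>2)
        \<le> sup_conv \<delta> \<phi>1 x0 + sup_conv \<delta> \<phi>2 y0 - w ((norm (x0 - y0))\<^sup>2)"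
    and taylor: "\<And>\<kappa>. 0 < \<kappa> \<Longrightarrow> \<exists>s>0. \<forall>a. \<bar>a\<bar> < s \<longrightarrow>
      w ((norm (x0 - y0))\<^sup>2 + a) \<le> w ((norm (x0 - y0))\<^sup>2) + w1 * a + (w2 + \<kappa>) / 2 * a\<^sup>2"
    and p: "p = (2 * w1) *\<^sub>R (x0 - y0)"
    and xa: "xa = x0 + \<delta> *\<^sub>R p" and ya: "ya = y0 - \<delta> *\<^sub>R p"
    and S1: "S1 ** transpose S1 = A xa" "T1 ** S1 = mat 1"
    and S2: "S2 ** transpose S2 = A ya" "T2 ** S2 = mat 1"
  shows "F1 xa (\<phi>1 xa) p + F2 ya (\<phi>2 ya) (- p)
    \<le> 2 * w1 * (norm (S1 - S2))\<^sup>2 + 4 * w2 * (norm (transpose (S1 - S2) *v (x0 - y0)))\<^sup>2"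
proof -
  interpret one: bounded_sup_conv \<phi>1 B \<delta> by fact
  interpret two: bounded_sup_conv \<phi>2 B \<delta> by fact
  let ?u1 = "sup_conv \<delta> \<phi>1" and ?u2 = "sup_conv \<delta> \<phi>2"
  define z0 where "z0 = x0 - y0"
  define Q where "Q = S1 - S2"
  obtain C s where C: "0 \<le> C" and s: "0 < s"
    and t1: "\<And>h. norm h < s \<Longrightarrow> ?u1 (x0 + h) \<le> ?u1 x0 + p \<bullet> h + C * (norm h)\<^sup>2"
    and t2: "\<And>h. norm h < s \<Longrightarrow> ?u2 (y0 + h) \<le> ?u2 y0 + (- p) \<bullet> h + C * (norm h)\<^sup>2"
    using doubling_touch(1)[of ?u1 ?u2 w x0 y0 w1 w2 p, OF max taylor p] by blast
  note touch = doubling_touch(2)[of ?u1 ?u2 w x0 y0 w1 w2 p, OF max taylor p, folded z0_def]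
  have key: "f + g \<le> 2 * w1 * (norm Q)\<^sup>2 + 4 * w2 * (norm (transpose Q *v z0))\<^sup>2"
    if f: "f < F1 xa (\<phi>1 xa) p"
      and g: "g < F2 ya (\<phi>2 ya) (- p)" for f g
  proof -
    let ?U = "\<lambda>z. ?u1 (x0 + S1 *v z)" and ?W = "\<lambda>z. ?u2 (y0 + S2 *v z)"
    obtain \<rho>1 where \<rho>1: "\<rho>1 > 0" "laplacian_ge f \<rho>1 ?U"
      using one.laplacian_ge_sup_conv[OF A F1 C s t1 xa S1 f] by blast
    obtain \<rho>2 where \<rho>2: "\<rho>2 > 0" "laplacian_ge g \<rho>2 ?W"
      using two.laplacian_ge_sup_conv[OF A F2 C s t2 _ S2 g] ya by auto
    define \<rho> where "\<rho> = min \<rho>1 \<rho>2"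
    have \<rho>: "\<rho> > 0" "laplacian_ge f \<rho> ?U" "laplacian_ge g \<rho> ?W"
      using \<rho>1 \<rho>2 unfolding \<rho>_def laplacian_ge_def by auto
    define K where "K = norm S1 + norm S2"
    have K: "norm (S1 *v y) \<le> K * norm y" "norm (S2 *v y) \<le> K * norm y" for y
      using norm_matrix_vec_le[of S1 y] norm_matrix_vec_le[of S2 y]
      unfolding K_def distrib_right by (auto intro: add_increasing add_increasing2)
    define KQ where "KQ = norm Q + 1"
    have KQ: "0 < KQ" "norm (Q *v y) \<le> norm y * KQ" for y
      using norm_matrix_vec_le[of Q y] norm_ge_zero[of Q] norm_ge_zero[of y] unfolding KQ_def
      by (auto simp: algebra_simps add_pos_nonneg intro: add_increasing)
    have c0: "0 \<le> 1 / (2 * \<delta>)" using one.\<delta> by simp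
    define v where "v = transpose Q *v z0"
    have vz: "z0 \<bullet> (Q *v z) = v \<bullet> z" for z unfolding v_def by (simp add: dot_lmul_matrix)
    let ?tr = "w1 * (norm Q)\<^sup>2 + 2 * w2 * (norm v)\<^sup>2"
    have "f + g \<le> 2 * ?tr + \<epsilon>" if \<epsilon>: "0 < \<epsilon>" for \<epsilon>
    proof -
      define \<kappa> where "\<kappa> = \<epsilon> / (2 * KQ\<^sup>2 * real CARD('n))"
      have \<kappa>: "\<kappa> > 0" unfolding \<kappa>_def using \<epsilon> KQ by simp
      obtain s' where s': "s' > 0" "\<And>h. norm h < s' \<Longrightarrow> w ((norm (z0 + h))\<^sup>2) - w ((norm z0)\<^sup>2) \<le> p \<bullet> h
        + w1 * (norm h)\<^sup>2 + 2 * w2 * (z0 \<bullet> h)\<^sup>2 + \<kappa> * (norm h)\<^sup>2"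
        using touch[OF _ \<kappa>] by blast
      define M where "M = w1 *\<^sub>R (transpose Q ** Q) + (2 * w2) *\<^sub>R (\<chi> i j. v $ i * v $ j) + (\<kappa> * KQ\<^sup>2) *\<^sub>R mat 1"
      have trM: "trace M = ?tr + \<kappa> * KQ\<^sup>2 * real CARD('n)"
        unfolding M_def
        by (simp add: trace_add trace_scaleR trace_I trace_transpose_mul)
          (simp add: trace_def power2_norm_eq_inner inner_vec_def)
      have zM: "z \<bullet> (M *v z) = w1 * (norm (Q *v z))\<^sup>2 + 2 * w2 * (v \<bullet> z)\<^sup>2 + \<kappa> * KQ\<^sup>2 * (norm z)\<^sup>2" for z
      proof -
        have 1: "z \<bullet> ((transpose Q ** Q) *v z) = (norm (Q *v z))\<^sup>2"
          by (metis dot_lmul_matrix inner_commute matrix_vector_mul_assoc power2_norm_eq_inner transpose_matrix_vector)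
        have "(\<chi> i j. v $ i * v $ j) *v z = (v \<bullet> z) *\<^sub>R v"
          by (simp add: vec_eq_iff matrix_vector_mult_def inner_vec_def sum_distrib_left mult_ac)
        then have 2: "z \<bullet> ((\<chi> i j. v $ i * v $ j) *v z) = (v \<bullet> z)\<^sup>2"
          by (simp add: power2_eq_square inner_commute)
        show ?thesis unfolding M_def
          by (simp add: matrix_vector_mult_add_rdistrib inner_add_right scaleR_matrix_vector_assoc[symmetric] 1 2 power2_norm_eq_inner)
      qed
      have "f + g \<le> 2 * trace M"
      proof (rule laplacian_sum_le_quadratic[of ?U B "1 / (2 * \<delta>) * K\<^sup>2" f \<rho> ?W g "s' / KQ" "transpose Q *v p" M])
        show "continuous_on UNIV ?U" "continuous_on UNIV ?W"
          by (auto intro!: continuous_on_compose2[OF one.continuous_sup_conv] continuous_on_compose2[OF two.continuous_sup_conv]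
              continuous_intros matrix_vector_mult_linear_continuous_on)
        show "semiconvex (1 / (2 * \<delta>) * K\<^sup>2) ?U" "semiconvex (1 / (2 * \<delta>) * K\<^sup>2) ?W"
          by (rule semiconvex_compose[OF one.semiconvex_sup_conv c0 K(1)] semiconvex_compose[OF two.semiconvex_sup_conv c0 K(2)])+
        show "?U z + ?W z \<le> ?U 0 + ?W 0 + (transpose Q *v p) \<bullet> z + z \<bullet> (M *v z)" if z: "norm z < s' / KQ" for z
        proof -
          have "norm (Q *v z) < s'" using KQ(2)[of z] z KQ(1) by (simp add: field_simps)
          note 1 = s'(2)[OF this]
          have "(norm (Q *v z))\<^sup>2 \<le> (norm z * KQ)\<^sup>2" by (rule power_mono[OF KQ(2)]) simp
          then have 2: "\<kappa> * (norm (Q *v z))\<^sup>2 \<le> \<kappa> * KQ\<^sup>2 * (norm z)\<^sup>2"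
            using \<kappa> by (simp add: power_mult_distrib mult_ac)
          have 3: "(transpose Q *v p) \<bullet> z = p \<bullet> (Q *v z)" by (simp add: dot_lmul_matrix)
          have eqd: "x0 + S1 *v z - (y0 + S2 *v z) = z0 + Q *v z"
            unfolding z0_def Q_def by (simp add: matrix_vector_mult_diff_rdistrib)
          have "?U z + ?W z - w ((norm (z0 + Q *v z))\<^sup>2) \<le> ?u1 x0 + ?u2 y0 - w ((norm z0)\<^sup>2)"
            using max[of "x0 + S1 *v z" "y0 + S2 *v z"] by (simp only: eqd z0_def[symmetric])
          then show ?thesis using 1 2 unfolding 3 zM vz by simp
        qed
        show "0 < s' / KQ" using s' KQ by simp
        show "0 \<le> 1 / (2 * \<delta>) * K\<^sup>2" using c0 by simp
      qed (use \<rho> one.sup_conv_bound two.sup_conv_bound in auto)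
      also have "2 * trace M = 2 * ?tr + \<epsilon>" unfolding trM \<kappa>_def using KQ by (simp add: field_simps)
      finally show ?thesis .
    qed
    then have "f + g \<le> 2 * ?tr" by (rule field_le_epsilon)
    then show ?thesis unfolding v_def by (simp add: algebra_simps)
  qed
  let ?r = "2 * w1 * (norm Q)\<^sup>2 + 4 * w2 * (norm (transpose Q *v z0))\<^sup>2"
  let ?f = "F1 xa (\<phi>1 xa) p" and ?g = "F2 ya (\<phi>2 ya) (- p)"
  have "?f + ?g \<le> ?r + e" if "0 < e" for e
    using key[of "?f - e / 2" "?g - e / 2"] that by simp
  then show ?thesis unfolding Q_def[symmetric] z0_def[symmetric] by (rule field_le_epsilon)
qed

section \<open>Periodic functions\<close>

lemma lattice_uminus: "k \<in> int_lattice \<Longrightarrow> - k \<in> int_lattice"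
  by (auto simp: int_lattice_def)

text \<open>Subtracting the nearest lattice point does not increase any coordinate in absolute value. Therefore the
reduction is compatible with penalties that increase with the distance.\<close>

lemma lattice_reduce:
  fixes z :: "real ^ 'n"
  shows "\<exists>k\<in>int_lattice. norm (z - k) \<le> norm z \<and> norm (z - k) \<le> real CARD('n)"
proof
  let ?k = "\<chi> i. of_int (round (z $ i)) :: real ^ 'n"
  show "?k \<in> int_lattice" by (simp add: int_lattice_def)
  have "\<bar>(z - ?k) $ i\<bar> \<le> \<bar>z $ i\<bar>" for i
    using round_diff_minimal[of "z $ i" 0] by simp
  then have "norm (z - ?k) \<le> norm z" by (intro norm_le_componentwise_cart) simp
  moreover have "norm (z - ?k) \<le> real CARD('n)"
  proof -
    have "\<bar>(z - ?k) $ i\<bar> \<le> 1" for i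
      using of_int_round_abs_le[of "z $ i"] by (simp add: abs_minus_commute)
    then have "(\<Sum>i\<in>UNIV. \<bar>(z - ?k) $ i\<bar>) \<le> (\<Sum>i\<in>(UNIV :: 'n set). 1)" by (intro sum_mono)
    then show ?thesis using norm_le_l1_cart[of "z - ?k"] by simp
  qed
  ultimately show "norm (z - ?k) \<le> norm z \<and> norm (z - ?k) \<le> real CARD('n)" ..
qed

lemma torus_dist_le:
  fixes x y :: "real ^ 'n"
  shows "torus_dist x y \<le> real CARD('n)"
proof -
  obtain k where k: "k \<in> int_lattice" "norm (x - y - k) \<le> real CARD('n)" using lattice_reduce[of "x - y"] by blast
  have "torus_dist x y \<le> dist x (y + k)"
    unfolding torus_dist_def by (rule cINF_lower[OF _ k(1)]) (auto intro!: bdd_belowI2[of _ 0])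
  also have "\<dots> \<le> real CARD('n)" using k(2) by (simp add: dist_norm algebra_simps)
  finally show ?thesis .
qed

lemma torus_periodic_reduce:
  assumes "torus_periodic f" "k \<in> int_lattice"
  shows "f (x - k) = f x"
proof -
  have "f (x + - k) = f x"
    using assms(1) lattice_uminus[OF assms(2)] unfolding torus_periodic_def by blast
  then show ?thesis by simp
qed

lemma torus_C_attains_sup:
  fixes f :: "real ^ 'n \<Rightarrow> real"
  assumes "torus_C f"
  shows "\<exists>x. \<forall>y. f y \<le> f x"
proof -
  have per: "torus_periodic f" and cont: "continuous_on UNIV f" using assms by (auto simp: torus_C_def)
  let ?K = "cball (0 :: real ^ 'n) (real CARD('n))"
  have "\<exists>x\<in>?K. \<forall>y\<in>?K. f y \<le> f x"
    by (rule continuous_attains_sup) (auto intro: continuous_on_subset[OF cont])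
  then obtain x where x: "\<And>y. y \<in> ?K \<Longrightarrow> f y \<le> f x" by blast
  have "f y \<le> f x" for y
  proof -
    obtain k where "k \<in> int_lattice" "norm (y - k) \<le> real CARD('n)" using lattice_reduce[of y] by blast
    then show ?thesis using x[of "y - k"] torus_periodic_reduce[OF per] by simp
  qed
  then show ?thesis by blast
qed

lemma torus_C_uniformly_continuous:
  fixes f :: "real ^ 'n \<Rightarrow> 'b::metric_space"
  assumes f: "torus_C f" and e: "0 < e"
  shows "\<exists>d>0. \<forall>x y. norm (x - y) < d \<longrightarrow> dist (f x) (f y) < e"
proof -
  have per: "torus_periodic f" and cont: "continuous_on UNIV f" using f by (auto simp: torus_C_def)
  let ?N = "real CARD('n)"
  have "uniformly_continuous_on (cball 0 (?N + 1)) f"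
    by (intro compact_uniformly_continuous continuous_on_subset[OF cont]) auto
  then obtain d where d: "d > 0" "\<And>x y. x \<in> cball 0 (?N + 1) \<Longrightarrow> y \<in> cball 0 (?N + 1) \<Longrightarrow> dist y x < d \<Longrightarrow> dist (f y) (f x) < e"
    using e unfolding uniformly_continuous_on_def by blast
  have "dist (f x) (f y) < e" if xy: "norm (x - y) < min d 1" for x y
  proof -
    obtain k where k: "k \<in> int_lattice" "norm (x - k) \<le> ?N" using lattice_reduce[of x] by blast
    have "norm (y - k) \<le> norm (x - k) + norm (x - y)"
      using norm_triangle_ineq4[of "x - k" "x - y"] by simp
    then have "dist (f (x - k)) (f (y - k)) < e"
      using k xy by (intro d(2)) (auto simp: mem_cball_0 dist_norm norm_minus_commute)
    then show ?thesis by (simp add: torus_periodic_reduce[OF per k(1)])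
  qed
  moreover have "0 < min d 1" using d(1) by simp
  ultimately show ?thesis by blast
qed

text \<open>The penalty itself is not periodic, but as it increases with the distance, moving \<open>x - y\<close> to its
reduced representative only increases the doubled function.\<close>

lemma periodic_doubling_attained:
  fixes u1 u2 :: "real ^ 'n \<Rightarrow> real"
  assumes u1: "torus_C u1" and u2: "torus_C u2" and w: "continuous_on {0..} w" "mono_on {0..} w"
  shows "\<exists>x0 y0. norm (x0 - y0) \<le> real CARD('n) \<and>
    (\<forall>x y. u1 x + u2 y - w ((norm (x - y))\<^sup>2) \<le> u1 x0 + u2 y0 - w ((norm (x0 - y0))\<^sup>2))"
proof -
  let ?K = "cball (0 :: real ^ 'n) (real CARD('n))"
  let ?J = "\<lambda>p. u1 (fst p + snd p) + u2 (fst p) - w ((norm (snd p))\<^sup>2)"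
  have c: "continuous_on UNIV u1" "continuous_on UNIV u2" and per: "torus_periodic u1" "torus_periodic u2"
    using u1 u2 by (auto simp: torus_C_def)
  have "continuous_on (?K \<times> ?K) ?J"
    by (intro continuous_intros continuous_on_compose2[OF c(1)] continuous_on_compose2[OF c(2)]
        continuous_on_compose2[OF w(1)]) auto
  moreover have "compact (?K \<times> ?K)" by (intro compact_Times) auto
  moreover have "?K \<times> ?K \<noteq> {}" by simp
  ultimately obtain p where p: "p \<in> ?K \<times> ?K" "\<And>q. q \<in> ?K \<times> ?K \<Longrightarrow> ?J q \<le> ?J p"
    using continuous_attains_sup[of "?K \<times> ?K" ?J] by blast
  show ?thesis
  proof (intro exI conjI allI)
    show "norm ((fst p + snd p) - fst p) \<le> real CARD('n)" using p(1) by (auto simp: mem_Times_iff)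
    fix x y :: "real ^ 'n"
    obtain k where k: "k \<in> int_lattice" "norm (y - k) \<le> real CARD('n)" using lattice_reduce[of y] by blast
    obtain l where l: "l \<in> int_lattice" "norm (x - y - l) \<le> norm (x - y)" "norm (x - y - l) \<le> real CARD('n)"
      using lattice_reduce[of "x - y"] by blast
    have "u1 x = u1 (x - k - l)" 
      using torus_periodic_reduce[OF per(1) k(1), of x] torus_periodic_reduce[OF per(1) l(1), of "x - k"] by simp
    also have "x - k - l = (y - k) + (x - y - l)" by simp
    finally have "u1 x + u2 y - w ((norm (x - y - l))\<^sup>2) = ?J (y - k, x - y - l)"
      using torus_periodic_reduce[OF per(2) k(1)] by simp
    also have "\<dots> \<le> ?J p" using k l by (intro p(2)) auto
    finally have "u1 x + u2 y - w ((norm (x - y - l))\<^sup>2) \<le> ?J p" .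
    moreover have "w ((norm (x - y - l))\<^sup>2) \<le> w ((norm (x - y))\<^sup>2)"
      using w(2) l(2) by (auto intro!: mono_onD[OF w(2)] power_mono)
    ultimately show "u1 x + u2 y - w ((norm (x - y))\<^sup>2) \<le> u1 (fst p + snd p) + u2 (fst p) - w ((norm (fst p + snd p - fst p))\<^sup>2)"
      by simp
  qed
qed

section \<open>Coupling the square roots of the diffusion matrices\<close>

definition outer :: "real ^ 'n \<Rightarrow> real ^ 'n \<Rightarrow> real ^ 'n ^ 'n" where
  "outer a b = (\<chi> i j. a $ i * b $ j)"

lemma outer_mult_vec: "outer a b *v z = (b \<bullet> z) *\<^sub>R a"
  by (simp add: outer_def vec_eq_iff matrix_vector_mult_def inner_vec_def sum_distrib_left mult_ac)

lemma transpose_outer: "transpose (outer a b) = outer b a"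
  by (simp add: outer_def transpose_def vec_eq_iff mult.commute)

lemma norm_outer: "norm (outer a b) = norm a * norm b"
proof -
  have "(norm (outer a b))\<^sup>2 = (norm a * norm b)\<^sup>2"
    unfolding power_mult_distrib
    by (simp add: outer_def power2_norm_vec sum_product power_mult_distrib)
  then show ?thesis by simp
qed

lemma transpose_vec_inner: "norm (transpose (\<sigma> :: real ^ 'n ^ 'n) *v v) ^ 2 = v \<bullet> ((\<sigma> ** transpose \<sigma>) *v v)"
  by (metis dot_lmul_matrix inner_commute matrix_vector_mul_assoc power2_norm_eq_inner transpose_matrix_vector)

lemma norm_transpose: "norm (transpose (M :: real ^ 'n ^ 'n)) = norm M"
proof -
  have "(norm (transpose M))\<^sup>2 = (norm M)\<^sup>2"
    by (simp add: power2_norm_vec transpose_def) (rule sum.swap)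
  then show ?thesis by simp
qed

text \<open>With \<open>v = T n\<close> and \<open>w = T\<^sup>T v\<close> one has \<open>\<bar>v\<bar>\<^sup>2 = w \<bullet> n\<close> and \<open>\<nu> \<bar>w\<bar>\<^sup>2 \<le> \<bar>v\<bar>\<^sup>2\<close>, which bounds \<open>T\<close>.\<close>

lemma elliptic_inverse:
  fixes \<sigma> :: "real ^ 'n ^ 'n"
  assumes \<nu>: "0 < \<nu>" and ell: "\<And>v. \<nu> * (norm v)\<^sup>2 \<le> (norm (transpose \<sigma> *v v))\<^sup>2"
  shows "\<exists>T. T ** \<sigma> = mat 1 \<and> \<sigma> ** T = mat 1 \<and> (\<forall>n. \<nu> * (norm (T *v n))\<^sup>2 \<le> (norm n)\<^sup>2)"
proof -
  have "inj ((*v) (transpose \<sigma>))"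
  proof (rule injI)
    fix x y assume "transpose \<sigma> *v x = transpose \<sigma> *v y"
    then have "transpose \<sigma> *v (x - y) = 0" by (simp only: matrix_vector_mult_diff_distrib) simp
    then have "\<nu> * (norm (x - y))\<^sup>2 \<le> 0" using ell[of "x - y"] by simp
    then show "x = y" using \<nu> by (simp add: mult_le_0_iff)
  qed
  then obtain B where B: "B ** transpose \<sigma> = mat 1" using matrix_left_invertible_injective by blast
  define T where "T = transpose B"
  have \<sigma>T: "\<sigma> ** T = mat 1"
    using arg_cong[OF B, of transpose] unfolding T_def by (simp add: matrix_transpose_mul transpose_mat)
  then have T\<sigma>: "T ** \<sigma> = mat 1" by (simp add: matrix_left_right_inverse)
  have "\<nu> * (norm (T *v n))\<^sup>2 \<le> (norm n)\<^sup>2" for n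
  proof -
    define v where "v = T *v n"
    \<comment> \<open>so that \<open>n = A w\<close> for the matrix \<open>A = \<sigma> \<sigma>\<^sup>T\<close>\<close>
    define w where "w = transpose T *v v"
    have sw: "transpose \<sigma> *v w = v"
    proof -
      have "transpose \<sigma> *v w = transpose (T ** \<sigma>) *v v"
        unfolding w_def by (simp only: matrix_transpose_mul matrix_vector_mul_assoc)
      then show ?thesis by (simp only: T\<sigma> transpose_mat matrix_vector_mul_lid)
    qed
    have "(norm v)\<^sup>2 = v \<bullet> (transpose \<sigma> *v w)" by (simp only: sw power2_norm_eq_inner)
    also have "\<dots> = w \<bullet> (\<sigma> *v v)" by (metis dot_lmul_matrix inner_commute transpose_matrix_vector)
    also have "\<sigma> *v v = n" unfolding v_def by (simp add: matrix_vector_mul_assoc \<sigma>T)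
    also have "w \<bullet> n \<le> norm w * norm n" by (rule norm_cauchy_schwarz)
    finally have 1: "(norm v)\<^sup>2 \<le> norm w * norm n" .
    have 2: "\<nu> * (norm w)\<^sup>2 \<le> (norm v)\<^sup>2" using ell[of w] by (simp only: sw)
    have "(\<nu> * (norm v)\<^sup>2) * (norm v)\<^sup>2 \<le> \<nu> * ((norm w * norm n) * (norm w * norm n))"
      using mult_left_mono[OF mult_mono[OF 1 1], of \<nu>] \<nu> by (simp add: mult.assoc)
    also have "\<dots> = (\<nu> * (norm w)\<^sup>2) * (norm n)\<^sup>2" by (simp add: power2_eq_square mult_ac)
    also have "\<dots> \<le> (norm v)\<^sup>2 * (norm n)\<^sup>2" using 2 by (rule mult_right_mono) simp
    finally have "(\<nu> * (norm v)\<^sup>2) * (norm v)\<^sup>2 \<le> (norm n)\<^sup>2 * (norm v)\<^sup>2" by (simp add: mult.commute)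
    then show ?thesis unfolding v_def[symmetric]
      by (cases "v = 0") (auto simp: mult_le_cancel_right)
  qed
  then show ?thesis using \<sigma>T T\<sigma> by blast
qed

text \<open>Take \<open>S = \<sigma>y R\<close> with the reflection \<open>R\<close> in the unit vector \<open>e\<close> parallel to the preimage of \<open>n\<close> under
\<open>\<sigma>y\<close>. Then \<open>\<sigma>x - S\<close> is, up to the small matrix \<open>\<sigma>x - \<sigma>y\<close>, the rank one matrix
\<open>2 l n e\<^sup>T\<close> with \<open>l \<ge> \<surd>\<nu>\<close>: all of its norm lies in the direction \<open>n\<close>. The numbers work because
\<open>2 * 21\<^sup>2 < 3 * 19\<^sup>2\<close>. For a penalty \<open>r\<^sup>a\<close> the factor \<open>3\<close> would be \<open>4 - 2 * a\<close>, so what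
matters is that the penalty is more concave than the linear one, \<open>a = 1\<close>.\<close>

lemma reflection_coupling:
  fixes \<sigma>x \<sigma>y :: "real ^ 'n ^ 'n"
  assumes \<nu>: "0 < \<nu>" and ell: "\<And>v. \<nu> * (norm v)\<^sup>2 \<le> (norm (transpose \<sigma>y *v v))\<^sup>2"
    and close: "norm (\<sigma>x - \<sigma>y) \<le> sqrt \<nu> / 10" and n: "norm n = 1" and \<kappa>: "0 \<le> \<kappa>"
  shows "\<exists>S T. S ** transpose S = \<sigma>y ** transpose \<sigma>y \<and> T ** S = mat 1 \<and>
    2 * (norm (\<sigma>x - S))\<^sup>2 - (3 + \<kappa>) * (norm (transpose (\<sigma>x - S) *v n))\<^sup>2 \<le> - (1 + \<kappa>) * \<nu>"
proof -
  obtain Ty where Ty: "Ty ** \<sigma>y = mat 1" "\<sigma>y ** Ty = mat 1" "\<And>n. \<nu> * (norm (Ty *v n))\<^sup>2 \<le> (norm n)\<^sup>2"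
    using elliptic_inverse[OF \<nu> ell] by blast
  define v where "v = Ty *v n"
  have yv: "\<sigma>y *v v = n" unfolding v_def by (simp add: matrix_vector_mul_assoc Ty(2))
  have v0: "norm v > 0"
    using yv n by (cases "v = 0") auto
  define l where "l = 1 / norm v"
  have l0: "0 < l" unfolding l_def using v0 by simp
  have l\<nu>: "\<nu> \<le> l\<^sup>2"
    using Ty(3)[of n] n v0 unfolding l_def v_def[symmetric] by (simp add: power_one_over field_simps)
  have sl: "sqrt \<nu> \<le> l" using l\<nu> l0 by (simp add: real_le_lsqrt)
  define e where "e = l *\<^sub>R v"
  have e1: "norm e = 1" "e \<bullet> e = 1" unfolding e_def l_def using v0 by (auto simp: dot_square_norm power2_eq_square)
  have ye: "\<sigma>y *v e = l *\<^sub>R n" unfolding e_def by (simp add: matrix_vector_mult_scaleR yv)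
  define R where "R = mat 1 - 2 *\<^sub>R outer e e"
  have Rt: "transpose R = R"
  proof -
    have "transpose R = mat 1 - 2 *\<^sub>R transpose (outer e e)"
      unfolding R_def by (simp add: transpose_def vec_eq_iff mat_def)
    then show ?thesis by (simp add: transpose_outer R_def)
  qed
  have Rv: "R *v z = z - (2 * (e \<bullet> z)) *\<^sub>R e" for z
    unfolding R_def by (simp add: matrix_vector_mult_diff_rdistrib outer_mult_vec flip: scaleR_matrix_vector_assoc)
  have RR: "R ** R = mat 1"
  proof -
    have "(R ** R) *v z = mat 1 *v z" for z
      by (simp add: Rv e1 inner_simps flip: matrix_vector_mul_assoc)
    then show ?thesis by (metis matrix_eq)
  qed
  define S where "S = \<sigma>y ** R"
  have SS: "S ** transpose S = \<sigma>y ** transpose \<sigma>y"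
  proof -
    have "S ** transpose S = \<sigma>y ** (R ** R) ** transpose \<sigma>y"
      unfolding S_def by (simp only: matrix_transpose_mul Rt matrix_mul_assoc)
    then show ?thesis by (simp add: RR)
  qed
  have TS: "(R ** Ty) ** S = mat 1"
  proof -
    have "(R ** Ty) ** S = R ** (Ty ** \<sigma>y) ** R" unfolding S_def by (simp only: matrix_mul_assoc)
    then show ?thesis by (simp add: Ty RR)
  qed
  define E where "E = \<sigma>x - \<sigma>y"
  have Q: "\<sigma>x - S = E + (2 * l) *\<^sub>R outer n e"
  proof -
    have "(\<sigma>x - S) *v z = (E + (2 * l) *\<^sub>R outer n e) *v z" for z
      unfolding S_def E_def
      by (simp add: matrix_vector_mult_diff_rdistrib matrix_vector_mult_add_rdistrib outer_mult_vec Rv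
          matrix_vector_mult_diff_distrib matrix_vector_mult_scaleR ye
          flip: matrix_vector_mul_assoc scaleR_matrix_vector_assoc)
    then show ?thesis by (metis matrix_eq)
  qed
  have E: "norm E \<le> l / 10" unfolding E_def using close sl by simp
  have no: "norm ((2 * l) *\<^sub>R outer n e) = 2 * l" using l0 n e1 by (simp add: norm_outer)
  have Q1: "norm (\<sigma>x - S) \<le> 21 / 10 * l"
    unfolding Q using norm_triangle_ineq[of E "(2 * l) *\<^sub>R outer n e"] no E by simp
  have "transpose (\<sigma>x - S) *v n = transpose E *v n + (2 * l) *\<^sub>R e"
  proof -
    have "transpose (\<sigma>x - S) = transpose E + (2 * l) *\<^sub>R transpose (outer n e)"
      unfolding Q by (simp add: transpose_def vec_eq_iff)
    then show ?thesis
      using n by (simp add: transpose_outer matrix_vector_mult_add_rdistrib outer_mult_vec dot_square_norm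
          del: transpose_matrix_vector flip: scaleR_matrix_vector_assoc)
  qed
  then have "norm (transpose (\<sigma>x - S) *v n) \<ge> norm ((2 * l) *\<^sub>R e) - norm (transpose E *v n)"
    using norm_diff_ineq[of "(2 * l) *\<^sub>R e" "transpose E *v n"] by (simp add: add.commute)
  moreover have "norm (transpose E *v n) \<le> l / 10"
    using norm_matrix_vec_le[of "transpose E" n] n E by (simp add: norm_transpose del: transpose_matrix_vector)
  ultimately have Q2: "19 / 10 * l \<le> norm (transpose (\<sigma>x - S) *v n)" using l0 e1 by simp
  have "(norm (\<sigma>x - S))\<^sup>2 \<le> (21 / 10 * l)\<^sup>2" using Q1 by (intro power_mono) auto
  moreover have "(3 + \<kappa>) * (19 / 10 * l)\<^sup>2 \<le> (3 + \<kappa>) * (norm (transpose (\<sigma>x - S) *v n))\<^sup>2"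
    using Q2 l0 \<kappa> by (intro mult_left_mono power_mono) auto
  ultimately have "2 * (norm (\<sigma>x - S))\<^sup>2 - (3 + \<kappa>) * (norm (transpose (\<sigma>x - S) *v n))\<^sup>2
    \<le> 2 * (21 / 10 * l)\<^sup>2 - (3 + \<kappa>) * (19 / 10 * l)\<^sup>2" by linarith
  also have "\<dots> = - (201 / 100 + 361 / 100 * \<kappa>) * l\<^sup>2" by (simp add: power2_eq_square field_simps)
  also have "\<dots> \<le> - (1 + \<kappa>) * \<nu>"
  proof -
    have "(1 + \<kappa>) * \<nu> \<le> (201 / 100 + 361 / 100 * \<kappa>) * l\<^sup>2" using l\<nu> \<kappa> \<nu> by (intro mult_mono) auto
    then show ?thesis by (simp only: mult_minus_left neg_le_iff_le)
  qed
  finally show ?thesis using SS TS by blast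
qed

text \<open>When the two points are far apart, \<open>\<sigma>x\<close> and \<open>\<sigma>y\<close> are unrelated. By the parallelogram identity one of
the two square roots \<open>\<sigma>y\<close> and \<open>- \<sigma>y\<close> differs from \<open>\<sigma>x\<close> in the direction \<open>n\<close> by at least
\<open>\<surd>(2\<nu>)\<close>; a large \<open>\<kappa>\<close> then compensates the other directions.\<close>

lemma sign_coupling:
  fixes \<sigma>x \<sigma>y :: "real ^ 'n ^ 'n"
  assumes \<nu>: "0 < \<nu>" and ellx: "\<And>v. \<nu> * (norm v)\<^sup>2 \<le> (norm (transpose \<sigma>x *v v))\<^sup>2"
    and elly: "\<And>v. \<nu> * (norm v)\<^sup>2 \<le> (norm (transpose \<sigma>y *v v))\<^sup>2"
    and bound: "norm \<sigma>x \<le> s" "norm \<sigma>y \<le> s"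
    and n: "norm n = 1" and \<kappa>: "8 * s\<^sup>2 \<le> \<kappa> * \<nu>"
  shows "\<exists>S T. S ** transpose S = \<sigma>y ** transpose \<sigma>y \<and> T ** S = mat 1 \<and>
    2 * (norm (\<sigma>x - S))\<^sup>2 - (3 + \<kappa>) * (norm (transpose (\<sigma>x - S) *v n))\<^sup>2 \<le> - (1 + \<kappa>) * \<nu>"
proof -
  obtain Ty where Ty: "Ty ** \<sigma>y = mat 1" using elliptic_inverse[OF \<nu> elly] by blast
  define a b where "a = transpose \<sigma>x *v n" and "b = transpose \<sigma>y *v n"
  have ab: "\<nu> \<le> (norm a)\<^sup>2" "\<nu> \<le> (norm b)\<^sup>2"
    using ellx[of n] elly[of n] n unfolding a_def b_def by auto
  have s0: "0 \<le> s" using bound(1) norm_ge_zero order.trans by blast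
  have \<kappa>0: "0 \<le> \<kappa>" using \<kappa> \<nu> s0 by (metis mult_nonneg_nonneg order.trans zero_le_mult_iff zero_le_numeral zero_le_power2 not_le)
  have fin: "2 * (norm (\<sigma>x - S))\<^sup>2 - (3 + \<kappa>) * (norm (transpose (\<sigma>x - S) *v n))\<^sup>2 \<le> - (1 + \<kappa>) * \<nu>"
    if "norm S \<le> s" "2 * \<nu> \<le> (norm (transpose (\<sigma>x - S) *v n))\<^sup>2" for S
  proof -
    have "norm (\<sigma>x - S) \<le> 2 * s" using norm_triangle_ineq4[of \<sigma>x S] bound(1) that(1) by linarith
    then have "(norm (\<sigma>x - S))\<^sup>2 \<le> (2 * s)\<^sup>2" by (intro power_mono) auto
    moreover have "(3 + \<kappa>) * (2 * \<nu>) \<le> (3 + \<kappa>) * (norm (transpose (\<sigma>x - S) *v n))\<^sup>2"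
      using that(2) \<kappa>0 by (intro mult_left_mono) auto
    ultimately have "2 * (norm (\<sigma>x - S))\<^sup>2 - (3 + \<kappa>) * (norm (transpose (\<sigma>x - S) *v n))\<^sup>2
      \<le> 2 * (2 * s)\<^sup>2 - (3 + \<kappa>) * (2 * \<nu>)" by linarith
    also have "\<dots> = 8 * s\<^sup>2 - 6 * \<nu> - 2 * (\<kappa> * \<nu>)" by (simp add: power2_eq_square algebra_simps)
    also have "\<dots> \<le> - \<nu> - \<kappa> * \<nu>" using \<kappa> \<nu> by linarith
    finally show ?thesis by (simp add: algebra_simps)
  qed
  have par: "(norm (a - b))\<^sup>2 + (norm (a + b))\<^sup>2 = 2 * (norm a)\<^sup>2 + 2 * (norm b)\<^sup>2"
    by (simp add: power2_norm_eq_inner inner_simps inner_commute)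
  have tr: "transpose (\<sigma>x - S) *v n = a - transpose S *v n" for S
  proof -
    have "transpose (\<sigma>x - S) = transpose \<sigma>x - transpose S" by (simp add: transpose_def vec_eq_iff)
    then show ?thesis unfolding a_def by (simp add: matrix_vector_mult_diff_rdistrib del: transpose_matrix_vector)
  qed
  show ?thesis
  proof (cases "2 * \<nu> \<le> (norm (a - b))\<^sup>2")
    case True
    then show ?thesis using fin[of \<sigma>y] bound(2) Ty tr[of \<sigma>y] unfolding b_def by metis
  next
    case False
    then have "2 * \<nu> \<le> (norm (a + b))\<^sup>2" using par ab by linarith
    moreover have "transpose (- \<sigma>y) *v n = - b"
    proof -
      have "transpose (- \<sigma>y) = - transpose \<sigma>y" by (simp add: transpose_def vec_eq_iff)
      moreover have "(- M) *v n = - (M *v n)" for M :: "real ^ 'n ^ 'n"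
        by (simp add: matrix_vector_mult_def vec_eq_iff sum_negf)
      ultimately show ?thesis unfolding b_def by simp
    qed
    ultimately have 1: "2 * \<nu> \<le> (norm (transpose (\<sigma>x - (- \<sigma>y)) *v n))\<^sup>2" unfolding tr by simp
    have mm: "(- M) ** (- P) = M ** P" for M P :: "real ^ 'n ^ 'n"
      by (simp add: matrix_matrix_mult_def vec_eq_iff)
    have "transpose (- \<sigma>y) = - transpose \<sigma>y" by (simp add: transpose_def vec_eq_iff)
    then have "(- \<sigma>y) ** transpose (- \<sigma>y) = \<sigma>y ** transpose \<sigma>y" "(- Ty) ** (- \<sigma>y) = mat 1"
      using Ty by (simp_all add: mm)
    moreover note fin[OF _ 1]
    ultimately show ?thesis using bound(2) by (metis norm_minus_cancel)
  qed
qed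

section \<open>The concave penalty\<close>

text \<open>The derivative of the difference of the two sides is negative to the right of \<open>0\<close> and positive to the
left.\<close>

lemma second_order_upper_bound:
  fixes w w' :: "real \<Rightarrow> real"
  assumes r: "0 < r" and d1: "\<And>a. \<bar>a\<bar> < r \<Longrightarrow> (w has_real_derivative w' (q + a)) (at (q + a))"
    and d2: "(w' has_real_derivative w2) (at q)" and \<kappa>: "0 < \<kappa>"
  shows "\<exists>s>0. \<forall>a. \<bar>a\<bar> < s \<longrightarrow> w (q + a) \<le> w q + w' q * a + (w2 + \<kappa>) / 2 * a\<^sup>2"
proof -
  let ?g = "\<lambda>a. w (q + a) - w q - w' q * a - (w2 + \<kappa>) / 2 * a\<^sup>2"
  let ?g' = "\<lambda>a. w' (q + a) - w' q - (w2 + \<kappa>) * a"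
  have g: "(?g has_real_derivative ?g' a) (at a)" if "\<bar>a\<bar> < r" for a
  proof -
    have "((\<lambda>a. w (q + a)) has_real_derivative w' (q + a)) (at a)"
      using d1[OF that] by (simp add: DERIV_shift add.commute)
    then show ?thesis by (auto intro!: derivative_eq_intros)
  qed
  have "((\<lambda>a. w' (q + a)) has_real_derivative w2) (at 0)"
    using d2 DERIV_shift[of w' w2 0 q] by (simp add: add.commute)
  then have d: "(?g' has_real_derivative - \<kappa>) (at 0)"
    by (auto intro!: derivative_eq_intros)
  obtain r1 where r1: "r1 > 0" "\<And>h. 0 < h \<Longrightarrow> h < r1 \<Longrightarrow> ?g' (0 + h) < ?g' 0"
    using DERIV_neg_dec_right[OF d] \<kappa> by auto
  obtain r2 where r2: "r2 > 0" "\<And>h. 0 < h \<Longrightarrow> h < r2 \<Longrightarrow> ?g' 0 < ?g' (0 - h)"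
    using DERIV_neg_dec_left[OF d] \<kappa> by auto
  define s where "s = min r (min r1 r2)"
  have s: "0 < s" unfolding s_def using r r1 r2 by auto
  have "?g a \<le> 0" if a: "\<bar>a\<bar> < s" for a
  proof -
    consider "a = 0" | "0 < a" | "a < 0" by linarith
    then show ?thesis
    proof cases
      case 2
      obtain z where z: "0 < z" "z < a" "?g a - ?g 0 = (a - 0) * ?g' z"
        using MVT2[of 0 a ?g ?g'] 2 g a unfolding s_def by fastforce
      have "?g' z \<le> 0" using r1(2)[of z] z a unfolding s_def by simp
      then have "(a - 0) * ?g' z \<le> 0" using 2 by (simp add: mult_nonneg_nonpos)
      then show ?thesis using z(3) by simp
    next
      case 3
      obtain z where z: "a < z" "z < 0" "?g 0 - ?g a = (0 - a) * ?g' z"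
        using MVT2[of a 0 ?g ?g'] 3 g a unfolding s_def by fastforce
      have "0 \<le> ?g' z" using r2(2)[of "- z"] z a unfolding s_def by simp
      then have "0 \<le> (0 - a) * ?g' z" using 3 by (intro mult_nonneg_nonneg) auto
      then show ?thesis using z(3) by simp
    qed simp
  qed
  then show ?thesis using s by (intro exI[of _ s]) (auto simp: algebra_simps)
qed

text \<open>The concave function \<open>\<Lambda> * (1 - exp (- K * \<surd>r))\<close> of the distance \<open>r\<close>, written in terms of
\<open>q = r\<^sup>2\<close>. The factor \<open>\<surd>r\<close> makes it strictly more concave than linear near \<open>r = 0\<close>, where tangential
second derivatives blow up; the exponential makes it concave enough, relative to its slope, to
absorb terms linear in the gradient.\<close>

definition penalty :: "real \<Rightarrow> real \<Rightarrow> real \<Rightarrow> real" where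
  "penalty \<Lambda> K q = \<Lambda> * (1 - exp (- K * sqrt (sqrt q)))"

definition penalty' :: "real \<Rightarrow> real \<Rightarrow> real \<Rightarrow> real" where
  "penalty' \<Lambda> K q = \<Lambda> * K / 4 * exp (- K * sqrt (sqrt q)) / sqrt (sqrt q) ^ 3"

lemma DERIV_sqrt_sqrt:
  assumes "0 < q"
  shows "((\<lambda>q. sqrt (sqrt q)) has_real_derivative 1 / (4 * sqrt (sqrt q) ^ 3)) (at q)"
proof -
  have "((\<lambda>q. sqrt (sqrt q)) has_real_derivative inverse (sqrt (sqrt q)) / 2 * (inverse (sqrt q) / 2)) (at q)"
    using assms by (auto intro!: derivative_eq_intros)
  moreover have "inverse (sqrt (sqrt q)) / 2 * (inverse (sqrt q) / 2) = 1 / (4 * sqrt (sqrt q) ^ 3)"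
  proof -
    have "inverse r / 2 * (inverse (r * r) / 2) = 1 / (4 * r ^ 3)" for r :: real
      by (cases "r = 0") (auto simp: field_simps power3_eq_cube)
    from this[of "sqrt (sqrt q)"] show ?thesis using assms by (simp only: real_sqrt_mult_self abs_of_pos real_sqrt_gt_zero)
  qed
  ultimately show ?thesis by (simp only:)
qed

lemma penalty_derivatives:
  assumes q: "0 < q"
  shows "(penalty \<Lambda> K has_real_derivative penalty' \<Lambda> K q) (at q)"
    "(penalty' \<Lambda> K has_real_derivative - penalty' \<Lambda> K q * (3 + K * sqrt (sqrt q)) / (4 * q)) (at q)"
proof -
  define \<rho> where "\<rho> = sqrt (sqrt q)"
  have \<rho>: "0 < \<rho>" unfolding \<rho>_def using q by simp
  have q4: "q = \<rho> ^ 4"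
  proof -
    have "\<rho>\<^sup>2 = sqrt q" unfolding \<rho>_def using q by simp
    then have "(\<rho>\<^sup>2)\<^sup>2 = q" using q by simp
    then show ?thesis by simp
  qed
  note d = DERIV_sqrt_sqrt[OF q, folded \<rho>_def]
  have "((\<lambda>q. \<Lambda> * (1 - exp (- K * s q))) has_real_derivative \<Lambda> * (exp (- K * s q) * K * s')) (at q)"
    if "(s has_real_derivative s') (at q)" for s s'
    using that by (auto intro!: derivative_eq_intros)
  from this[OF d] show "(penalty \<Lambda> K has_real_derivative penalty' \<Lambda> K q) (at q)"
    unfolding penalty_def[abs_def] penalty'_def \<rho>_def[symmetric] by (simp add: mult_ac)
  have "((\<lambda>q. \<Lambda> * K / 4 * exp (- K * s q) / s q ^ 3) has_real_derivative
      - (\<Lambda> * K / 4 * exp (- K * s q) / s q ^ 3) * (K + 3 / s q) * s') (at q)"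
    if s: "(s has_real_derivative s') (at q)" "0 < s q" for s s'
    using s(2) by (auto intro!: derivative_eq_intros s(1) simp: field_simps eval_nat_numeral)
  from this[OF d] \<rho>
  have "(penalty' \<Lambda> K has_real_derivative - penalty' \<Lambda> K q * (K + 3 / \<rho>) * (1 / (4 * \<rho> ^ 3))) (at q)"
    unfolding penalty'_def[abs_def] \<rho>_def[symmetric] by simp
  moreover have "- P * (K + 3 / \<rho>) * (1 / (4 * \<rho> ^ 3)) = - P * (3 + K * \<rho>) / (4 * \<rho> ^ 4)" for P
    using \<rho> by (simp add: field_simps eval_nat_numeral)
  ultimately show "(penalty' \<Lambda> K has_real_derivative - penalty' \<Lambda> K q * (3 + K * sqrt (sqrt q)) / (4 * q)) (at q)"
    unfolding \<rho>_def[symmetric] q4[symmetric] by simp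
qed

lemma penalty_bounds:
  assumes "0 \<le> \<Lambda>" "0 \<le> K" "0 \<le> q"
  shows "0 \<le> penalty \<Lambda> K q" "penalty \<Lambda> K q \<le> \<Lambda>"
  using assms by (auto simp: penalty_def mult_left_le)

lemma penalty_0: "penalty \<Lambda> K 0 = 0"
  by (simp add: penalty_def)

lemma continuous_penalty: "continuous_on {0..} (penalty \<Lambda> K)"
  unfolding penalty_def[abs_def] by (intro continuous_intros)

lemma mono_penalty:
  assumes "0 \<le> \<Lambda>" "0 \<le> K"
  shows "mono_on {0..} (penalty \<Lambda> K)"
  unfolding penalty_def using assms by (intro mono_onI mult_left_mono) (auto intro: mult_left_mono)

text \<open>Choosing \<open>K\<close> first makes \<open>K * \<surd>r * \<nu>\<close> dominate \<open>C2 * r\<close> for all \<open>r \<le> D\<close>, which takes care of terms linear in the gradient; after that, a large factor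
\<open>\<Lambda>\<close> takes care of the constant term and makes the gradient as large as required.\<close>

lemma penalty_constants:
  assumes \<nu>: "0 < \<nu>" and D: "0 < D" and C: "0 \<le> C1" "0 \<le> C2" and L: "0 \<le> L" and K0: "0 \<le> K0"
  shows "\<exists>\<Lambda>>0. \<exists>K\<ge>K0. 0 < K \<and> (\<forall>r. 0 < r \<longrightarrow> r \<le> D \<longrightarrow> 0 < penalty' \<Lambda> K (r\<^sup>2) \<and>
    L \<le> 2 * penalty' \<Lambda> K (r\<^sup>2) * r \<and>
    C1 + C2 * (2 * penalty' \<Lambda> K (r\<^sup>2) * r) < penalty' \<Lambda> K (r\<^sup>2) * (1 + K * sqrt r) * \<nu>)"
proof -
  define K where "K = K0 + 4 * C2 * sqrt D / \<nu> + 1"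
  have "0 \<le> 4 * C2 * sqrt D / \<nu>" using C D \<nu> by simp
  then have K: "K0 \<le> K" "0 < K" "4 * C2 * sqrt D / \<nu> \<le> K" unfolding K_def using K0 by auto
  define ex where "ex = exp (- (K * sqrt D))"
  have ex: "0 < ex" unfolding ex_def by simp
  define \<Lambda> where "\<Lambda> = 8 * D * (C1 + 1) / (K\<^sup>2 * \<nu> * ex) + 2 * sqrt D * L / (K * ex)"
  have t: "0 < 8 * D * (C1 + 1) / (K\<^sup>2 * \<nu> * ex)" "0 \<le> 2 * sqrt D * L / (K * ex)"
    using C D \<nu> K ex L by auto
  then have \<Lambda>0: "0 < \<Lambda>" unfolding \<Lambda>_def by linarith
  have \<Lambda>: "C1 + 1 \<le> \<Lambda> * K\<^sup>2 * \<nu> * ex / (8 * D)" "L \<le> \<Lambda> * K * ex / (2 * sqrt D)"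
  proof -
    have "8 * D * (C1 + 1) / (K\<^sup>2 * \<nu> * ex) \<le> \<Lambda>" unfolding \<Lambda>_def using t by linarith
    then show "C1 + 1 \<le> \<Lambda> * K\<^sup>2 * \<nu> * ex / (8 * D)" using D \<nu> K ex by (simp add: field_simps)
    have "2 * sqrt D * L / (K * ex) \<le> \<Lambda>" unfolding \<Lambda>_def using t by linarith
    then show "L \<le> \<Lambda> * K * ex / (2 * sqrt D)" using D \<nu> K ex by (simp add: field_simps)
  qed
  have "0 < penalty' \<Lambda> K (r\<^sup>2) \<and> L \<le> 2 * penalty' \<Lambda> K (r\<^sup>2) * r \<and>
    C1 + C2 * (2 * penalty' \<Lambda> K (r\<^sup>2) * r) < penalty' \<Lambda> K (r\<^sup>2) * (1 + K * sqrt r) * \<nu>"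
    if r: "0 < r" "r \<le> D" for r
  proof -
    define \<rho> where "\<rho> = sqrt r"
    have \<rho>: "0 < \<rho>" "r = \<rho> * \<rho>" "\<rho> \<le> sqrt D" "\<rho> * \<rho> \<le> D" unfolding \<rho>_def using r by auto
    define P where "P = penalty' \<Lambda> K (r\<^sup>2)"
    have P: "P = \<Lambda> * K / 4 * exp (- (K * \<rho>)) / \<rho> ^ 3"
      unfolding P_def penalty'_def \<rho>_def using r by simp
    have P0: "0 < P" unfolding P using \<Lambda>0 K \<rho> by simp
    have ex\<rho>: "ex \<le> exp (- (K * \<rho>))" unfolding ex_def using K \<rho> by simp
    have 1: "L \<le> 2 * P * r"
    proof -
      have "L \<le> \<Lambda> * K * ex / (2 * sqrt D)" by (rule \<Lambda>)
      also have "\<dots> \<le> \<Lambda> * K * exp (- (K * \<rho>)) / (2 * \<rho>)"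
        using \<Lambda>0 K ex ex\<rho> \<rho> by (intro frac_le mult_left_mono) auto
      also have "\<dots> = 2 * P * r" unfolding P \<rho>(2) using \<rho>(1) by (simp add: field_simps power3_eq_cube)
      finally show ?thesis .
    qed
    have 2: "C1 < P * (K * \<rho>) * \<nu> / 2"
    proof -
      have "C1 < \<Lambda> * K\<^sup>2 * \<nu> * ex / (8 * D)" using \<Lambda>(1) by linarith
      also have "\<dots> \<le> \<Lambda> * K\<^sup>2 * \<nu> * exp (- (K * \<rho>)) / (8 * (\<rho> * \<rho>))"
        using \<Lambda>0 K \<nu> ex ex\<rho> \<rho> by (intro frac_le mult_left_mono) auto
      also have "\<dots> = P * (K * \<rho>) * \<nu> / 2"
        unfolding P using \<rho>(1) by (simp add: field_simps power3_eq_cube power2_eq_square)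
      finally show ?thesis .
    qed
    have 3: "C2 * (2 * P * r) \<le> P * (K * \<rho>) * \<nu> / 2"
    proof -
      have "4 * C2 * \<rho> \<le> 4 * C2 * sqrt D" using C \<rho> by (intro mult_left_mono) auto
      also have "\<dots> \<le> K * \<nu>" using K(3) \<nu> by (simp add: field_simps)
      finally have "P * \<rho> * (4 * C2 * \<rho>) \<le> P * \<rho> * (K * \<nu>)" using P0 \<rho> by (intro mult_left_mono) auto
      then show ?thesis unfolding \<rho>(2) by (simp add: algebra_simps)
    qed
    have 4: "P * (1 + K * \<rho>) * \<nu> = P * \<nu> + P * (K * \<rho>) * \<nu> / 2 + P * (K * \<rho>) * \<nu> / 2"
      by (simp add: algebra_simps)
    have "0 < P * \<nu>" using P0 \<nu> by simp
    then have "C1 + C2 * (2 * P * r) < P * (1 + K * \<rho>) * \<nu>" unfolding 4 using 2 3 by linarith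
    then show ?thesis using P0 1 unfolding P_def \<rho>_def by blast
  qed
  then show ?thesis using \<Lambda>0 K by blast
qed

section \<open>The oscillation bound\<close>

text \<open>The constants are fixed in the following order: the distance below which \<open>\<sigma>\<close> varies little, then
the penalty, and only then, for a given solution, the parameter \<open>\<delta>\<close> of the sup-convolutions. The bound
therefore does not depend on \<open>\<epsilon>\<close> or on the solution.\<close>

lemma oscillation_bound:
  fixes \<sigma> A :: "real ^ 'n \<Rightarrow> real ^ 'n ^ 'n"
    and H_lo H_up :: "real ^ 'n \<Rightarrow> real ^ 'n \<Rightarrow> real"
  assumes \<sigma>: "torus_C \<sigma>" and A: "\<And>x. A x = \<sigma> x ** transpose (\<sigma> x)"
    and H_lo: "torus_C_Hamiltonian H_lo" and H_up: "torus_C_Hamiltonian H_up"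
    and \<nu>: "0 < \<nu>" and elliptic: "\<And>x. mat_le (\<nu> *\<^sub>R mat 1) (A x)"
    and growth: "\<And>x p. \<bar>H_lo x p\<bar> \<le> C * (1 + norm p)"
    and Cb: "0 < Cb" and L: "1 < L" and \<mu>: "1 < \<mu>"
    and superlinear: "\<And>x y p. norm p \<ge> L \<Longrightarrow> H_up x p - \<mu> * H_up y (p /\<^sub>R \<mu>) \<ge> - Cb * norm p"
  shows "\<exists>K>0. \<forall>\<epsilon>>0. \<forall>\<phi>. torus_viscosity_solution
      (\<lambda>x u p X. \<epsilon> * u - trace (A x ** X) + H_lo x p + H_up x p) \<phi> \<longrightarrow> osc \<phi> \<le> K"
proof -
  have \<sigma>c: "continuous_on UNIV \<sigma>" using \<sigma> by (simp add: torus_C_def)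
  have H_lo_c: "continuous_on UNIV (\<lambda>(x, p). H_lo x p)" and H_up_c: "continuous_on UNIV (\<lambda>(x, p). H_up x p)"
    using H_lo H_up by (auto simp: torus_C_Hamiltonian_def)
  have hc: "continuous_on UNIV (\<lambda>y. H_lo (f y) (g y))" "continuous_on UNIV (\<lambda>y. H_up (f y) (g y))"
    if "continuous_on UNIV f" "continuous_on UNIV g" for f g :: "'z::topological_space \<Rightarrow> real ^ 'n"
    using continuous_on_compose2[OF H_lo_c continuous_on_Pair[OF that]]
      continuous_on_compose2[OF H_up_c continuous_on_Pair[OF that]] by auto
  have ell: "\<nu> * (norm v)\<^sup>2 \<le> (norm (transpose (\<sigma> x) *v v))\<^sup>2" for x v
    using elliptic[of x, unfolded mat_le_def, rule_format, of v] unfolding transpose_vec_inner A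
    by (simp add: power2_norm_eq_inner flip: scaleR_matrix_vector_assoc)
  have As: "transpose (A x) = A x" for x unfolding A by (simp add: matrix_transpose_mul)
  have Ac: "continuous_on UNIV A"
    unfolding A[abs_def] matrix_matrix_mult_def transpose_def
    by (simp, intro continuous_on_vec_lambda continuous_intros \<sigma>c)
  obtain s where s: "\<And>x. norm (\<sigma> x) \<le> s"
  proof -
    have "torus_C (\<lambda>x. norm (\<sigma> x))" using \<sigma> unfolding torus_C_def torus_periodic_def by (auto intro!: continuous_intros)
    then show thesis using torus_C_attains_sup that by blast
  qed
  obtain CH where CH: "\<And>x. \<bar>H_up x 0\<bar> \<le> CH"
  proof -
    have "torus_C (\<lambda>x. \<bar>H_up x 0\<bar>)"
      using H_up hc(2)[of "\<lambda>x. x" "\<lambda>_. 0"] unfolding torus_C_def torus_C_Hamiltonian_def torus_periodic_def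
      by (auto intro!: continuous_intros)
    then show thesis using torus_C_attains_sup that by blast
  qed
  have C0: "0 \<le> C" using growth[of 0 0] by simp
  have CH0: "0 \<le> CH" using CH[of 0] by linarith
  obtain r1 where r1: "r1 > 0" "\<And>x y. norm (x - y) < r1 \<Longrightarrow> norm (\<sigma> x - \<sigma> y) < sqrt \<nu> / 10"
    using torus_C_uniformly_continuous[OF \<sigma>, of "sqrt \<nu> / 10"] \<nu> by (auto simp: dist_norm)
  define r0 where "r0 = r1 / 2"
  have r0: "0 < r0" unfolding r0_def using r1 by simp
  define C1 where "C1 = (\<mu> - 1) * (C + CH) + C * (1 + \<mu>)"
  define C2 where "C2 = 2 * C + Cb"
  define K0 where "K0 = 8 * s\<^sup>2 / (\<nu> * sqrt r0)"
  define D where "D = real CARD('n)"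
  have pos: "0 \<le> C1" "0 \<le> C2" "0 \<le> K0" "0 < D" "0 \<le> L"
    unfolding C1_def C2_def K0_def D_def using C0 CH0 \<mu> Cb \<nu> r0 L by auto
  obtain \<Lambda> K where \<Lambda>: "0 < \<Lambda>" and K: "K0 \<le> K" "0 < K"
    and pen: "\<And>r. 0 < r \<Longrightarrow> r \<le> D \<Longrightarrow> 0 < penalty' \<Lambda> K (r\<^sup>2)"
      "\<And>r. 0 < r \<Longrightarrow> r \<le> D \<Longrightarrow> L \<le> 2 * penalty' \<Lambda> K (r\<^sup>2) * r"
      "\<And>r. 0 < r \<Longrightarrow> r \<le> D \<Longrightarrow> C1 + C2 * (2 * penalty' \<Lambda> K (r\<^sup>2) * r) < penalty' \<Lambda> K (r\<^sup>2) * (1 + K * sqrt r) * \<nu>"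
    using penalty_constants[OF \<nu> pos(4,1,2,5,3)] by blast
  have "osc \<phi> \<le> \<Lambda> + 1" if \<epsilon>: "0 < \<epsilon>" and sol: "torus_viscosity_solution
      (\<lambda>x u p X. \<epsilon> * u - trace (A x ** X) + H_lo x p + H_up x p) \<phi>" for \<epsilon> \<phi>
  proof (rule ccontr)
    assume big: "\<not> osc \<phi> \<le> \<Lambda> + 1"
    have \<phi>: "torus_C \<phi>" and per: "torus_periodic \<phi>" and \<phi>c: "continuous_on UNIV \<phi>"
      using sol by (auto simp: torus_viscosity_solution_def torus_C_def)
    have sub: "\<epsilon> * \<phi> x - trace (A x ** D2 x) + H_lo x (D x) + H_up x (D x) \<le> 0"
      if "C2_with \<theta> D D2" "\<forall>\<^sub>F y in nhds x. \<phi> y - \<theta> y \<le> \<phi> x - \<theta> x" for \<theta> D D2 x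
      using sol that unfolding torus_viscosity_solution_def viscosity_subsolution_def by blast
    have super: "0 \<le> \<epsilon> * \<phi> x - trace (A x ** D2 x) + H_lo x (D x) + H_up x (D x)"
      if "C2_with \<theta> D D2" "\<forall>\<^sub>F y in nhds x. \<phi> y - \<theta> y \<ge> \<phi> x - \<theta> x" for \<theta> D D2 x
      using sol that unfolding torus_viscosity_solution_def viscosity_supersolution_def by blast
    obtain xM where xM: "\<And>y. \<phi> y \<le> \<phi> xM" using torus_C_attains_sup[OF \<phi>] by blast
    obtain xm where xm: "\<And>y. \<phi> xm \<le> \<phi> y"
    proof -
      have "torus_C (\<lambda>x. - \<phi> x)" using \<phi> unfolding torus_C_def torus_periodic_def by (auto intro!: continuous_intros)
      from torus_C_attains_sup[OF this] show thesis using that by auto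
    qed
    define m where "m = \<phi> xm"
    have "osc \<phi> = \<phi> xM - m"
      unfolding osc_def m_def
      by (intro arg_cong2[where f = "(-)"] cSup_eq_maximum cInf_eq_minimum) (use xM xm in auto)
    then have osc: "\<Lambda> + 1 < \<phi> xM - m" using big by simp
    have \<epsilon>m: "\<epsilon> * m \<le> C + CH"
    proof -
      have "C2_with (\<lambda>_. 0) (\<lambda>_. 0) (\<lambda>_. 0 :: real ^ 'n ^ 'n)"
        using C2_with_square[of 0, where 'a='n] by simp
      from sub[OF this, of xM] xM have "\<epsilon> * \<phi> xM + H_lo xM 0 + H_up xM 0 \<le> 0" by (simp add: trace_def)
      moreover have "\<epsilon> * m \<le> \<epsilon> * \<phi> xM" using \<epsilon> xM[of xm] unfolding m_def by simp
      ultimately show ?thesis using growth[of xM 0] CH[of xM] by (simp add: abs_le_iff)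
    qed
    \<comment> \<open>both \<open>\<phi>1\<close> and \<open>\<phi>2\<close> satisfy subsolution inequalities, and their sum is at most \<open>0\<close> at each point\<close>
    define \<phi>1 where "\<phi>1 x = \<phi> x - m" for x
    define \<phi>2 where "\<phi>2 x = - \<mu> * (\<phi> x - m)" for x
    define B where "B = \<mu> * (\<phi> xM - m)"
    have nn: "0 \<le> \<phi>1 x" "\<phi>1 x \<le> \<phi> xM - m" for x unfolding \<phi>1_def m_def using xm[of x] xM[of x] by auto
    have B1: "\<bar>\<phi>1 x\<bar> \<le> B" for x
    proof -
      have "1 * (\<phi> xM - m) \<le> \<mu> * (\<phi> xM - m)" using \<mu> osc \<Lambda> by (intro mult_right_mono) auto
      then show ?thesis using nn[of x] unfolding B_def by simp
    qed
    have B2: "\<bar>\<phi>2 x\<bar> \<le> B" for x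
    proof -
      have "\<mu> * \<phi>1 x \<le> B" unfolding B_def using nn[of x] \<mu> by (intro mult_left_mono) auto
      moreover have "\<bar>\<phi>2 x\<bar> = \<mu> * \<phi>1 x"
        using nn[of x] \<mu> unfolding \<phi>2_def \<phi>1_def by (simp add: abs_mult)
      ultimately show ?thesis by simp
    qed
    have t1: "torus_C \<phi>1" and t2: "torus_C \<phi>2"
      using \<phi> unfolding torus_C_def torus_periodic_def \<phi>1_def \<phi>2_def by (auto intro!: continuous_intros)
    obtain d1 where d1: "d1 > 0" "\<And>x y. norm (x - y) < d1 \<Longrightarrow> \<bar>\<phi>1 x - \<phi>1 y\<bar> < 1 / 2"
      using torus_C_uniformly_continuous[OF t1, of "1 / 2"] by (auto simp: dist_real_def)
    obtain d2 where d2: "d2 > 0" "\<And>x y. norm (x - y) < d2 \<Longrightarrow> \<bar>\<phi>2 x - \<phi>2 y\<bar> < 1 / 2"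
      using torus_C_uniformly_continuous[OF t2, of "1 / 2"] by (auto simp: dist_real_def)
    define \<tau> where "\<tau> = min (r0 / 4) (min d1 d2 / 2)"
    have \<tau>: "0 < \<tau>" "4 * \<tau> \<le> r0" "\<tau> < d1" "\<tau> < d2" unfolding \<tau>_def using r0 d1 d2 by (auto simp: min_def)
    have Bn: "0 < B" using osc \<Lambda> \<mu> unfolding B_def by (intro mult_pos_pos) auto
    \<comment> \<open>maximizers in the sup-convolutions then lie within distance \<open>\<tau>\<close>\<close>
    define \<delta> where "\<delta> = \<tau>\<^sup>2 / (4 * B)"
    have \<delta>: "0 < \<delta>" unfolding \<delta>_def using \<tau> Bn by simp
    have \<delta>B: "2 * sqrt (\<delta> * B) = \<tau>"
    proof -
      have "\<delta> * B = (\<tau> / 2)\<^sup>2" unfolding \<delta>_def using Bn by (simp add: power_divide field_simps)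
      then show ?thesis using \<tau> by simp
    qed
    have b1: "bounded_sup_conv \<phi>1 B \<delta>" and b2: "bounded_sup_conv \<phi>2 B \<delta>"
      using t1 t2 B1 B2 \<delta> by (auto simp: bounded_sup_conv_def torus_C_def)
    interpret one: bounded_sup_conv \<phi>1 B \<delta> by (rule b1)
    interpret two: bounded_sup_conv \<phi>2 B \<delta> by (rule b2)
    let ?u1 = "sup_conv \<delta> \<phi>1" and ?u2 = "sup_conv \<delta> \<phi>2" and ?w = "penalty \<Lambda> K"
    have tu: "torus_C ?u1" "torus_C ?u2"
      using t1 t2 one.continuous_sup_conv two.continuous_sup_conv one.sup_conv_periodic two.sup_conv_periodic
      unfolding torus_C_def torus_periodic_def by auto
    obtain x0 y0 where D0: "norm (x0 - y0) \<le> D"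
      and max: "\<And>x y. ?u1 x + ?u2 y - ?w ((norm (x - y))\<^sup>2) \<le> ?u1 x0 + ?u2 y0 - ?w ((norm (x0 - y0))\<^sup>2)"
      using periodic_doubling_attained[OF tu continuous_penalty mono_penalty, of \<Lambda> K] \<Lambda> K unfolding D_def by auto
    have wb: "0 \<le> ?w q" "?w q \<le> \<Lambda>" if "0 \<le> q" for q using penalty_bounds[of \<Lambda> K q] \<Lambda> K that by auto
    have J: "1 < ?u1 x0 + ?u2 y0 - ?w ((norm (x0 - y0))\<^sup>2)"
    proof -
      have "\<phi>1 xM + \<phi>2 xm - \<Lambda> \<le> ?u1 xM + ?u2 xm - ?w ((norm (xM - xm))\<^sup>2)"
        using one.sup_conv_ge[of xM] two.sup_conv_ge[of xm] wb(2)[of "(norm (xM - xm))\<^sup>2"] by simp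
      moreover have "\<phi>2 xm = 0" unfolding \<phi>2_def m_def by simp
      ultimately show ?thesis using max[of xM xm] osc unfolding \<phi>1_def by linarith
    qed
    \<comment> \<open>the regularisation costs at most \<open>1 / 2\<close> in each function; this is the \<open>1\<close> in the final constant\<close>
    have diag: "?u1 x + ?u2 x \<le> 1" for x
    proof -
      obtain z where z: "?u1 x = \<phi>1 z - (norm (x - z))\<^sup>2 / (2 * \<delta>)" using one.sup_conv_attained(2) by blast
      obtain y where y: "?u2 x = \<phi>2 y - (norm (x - y))\<^sup>2 / (2 * \<delta>)" using two.sup_conv_attained(2) by blast
      have "\<bar>\<phi>1 x - \<phi>1 z\<bar> < 1 / 2" using one.maximizer_dist[OF z] \<delta>B \<tau> by (intro d1(2)) auto
      moreover have "\<bar>\<phi>2 x - \<phi>2 y\<bar> < 1 / 2" using two.maximizer_dist[OF y] \<delta>B \<tau> by (intro d2(2)) auto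
      moreover have "?u1 x \<le> \<phi>1 z" "?u2 x \<le> \<phi>2 y" using z y \<delta> by auto
      moreover have "\<phi>1 x + \<phi>2 x \<le> 0"
      proof -
        have "\<phi>1 x + \<phi>2 x = (1 - \<mu>) * \<phi>1 x" unfolding \<phi>1_def \<phi>2_def by (simp add: algebra_simps)
        also have "\<dots> \<le> 0" using nn[of x] \<mu> by (intro mult_nonpos_nonneg) auto
        finally show ?thesis .
      qed
      ultimately show ?thesis by linarith
    qed
    define r where "r = norm (x0 - y0)"
    have "x0 \<noteq> y0"
    proof
      assume "x0 = y0"
      then show False using J diag[of y0] by (simp add: penalty_0)
    qed
    then have r: "0 < r" "r \<le> D" unfolding r_def using D0 by auto
    \<comment> \<open>the first and second derivative of the penalty at \<open>r\<^sup>2\<close>\<close>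
    define w1 where "w1 = penalty' \<Lambda> K (r\<^sup>2)"
    define w2 where "w2 = - w1 * (3 + K * sqrt r) / (4 * r\<^sup>2)"
    have w1: "0 < w1" unfolding w1_def by (rule pen(1)[OF r])
    have taylor: "\<exists>s>0. \<forall>a. \<bar>a\<bar> < s \<longrightarrow> ?w ((norm (x0 - y0))\<^sup>2 + a) \<le> ?w ((norm (x0 - y0))\<^sup>2) + w1 * a + (w2 + \<kappa>) / 2 * a\<^sup>2"
      if \<kappa>: "0 < \<kappa>" for \<kappa>
      unfolding r_def[symmetric] w1_def
    proof (rule second_order_upper_bound[OF _ _ _ \<kappa>])
      show "0 < r\<^sup>2" using r by simp
      show "(?w has_real_derivative penalty' \<Lambda> K (r\<^sup>2 + a)) (at (r\<^sup>2 + a))" if "\<bar>a\<bar> < r\<^sup>2" for a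
        using that by (intro penalty_derivatives(1)) (auto simp: abs_less_iff)
      have "sqrt (sqrt (r\<^sup>2)) = sqrt r" using r by simp
      then show "(penalty' \<Lambda> K has_real_derivative w2) (at (r\<^sup>2))"
        using penalty_derivatives(2)[of "r\<^sup>2" \<Lambda> K] r unfolding w2_def w1_def by simp
    qed
    define p where "p = (2 * w1) *\<^sub>R (x0 - y0)"
    have np: "norm p = 2 * w1 * r" unfolding p_def r_def using w1 by simp
    have pL: "L \<le> norm p" unfolding np w1_def by (rule pen(2)[OF r])
    define xa where "xa = x0 + \<delta> *\<^sub>R p"
    define ya where "ya = y0 - \<delta> *\<^sub>R p"
    obtain Ct st where st: "0 < st"
      and touch1: "\<And>h. norm h < st \<Longrightarrow> ?u1 (x0 + h) \<le> ?u1 x0 + p \<bullet> h + Ct * (norm h)\<^sup>2"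
      and touch2: "\<And>h. norm h < st \<Longrightarrow> ?u2 (y0 + h) \<le> ?u2 y0 + (- p) \<bullet> h + Ct * (norm h)\<^sup>2"
      using doubling_touch(1)[of ?u1 ?u2 ?w x0 y0 w1 w2 p, OF max taylor p_def] by blast
    have xa: "?u1 x0 = \<phi>1 xa - (norm (x0 - xa))\<^sup>2 / (2 * \<delta>)"
      using one.sup_conv_attained(2)[of x0] one.maximizer_at_touch[OF st touch1] unfolding xa_def by metis
    have ya: "?u2 y0 = \<phi>2 ya - (norm (y0 - ya))\<^sup>2 / (2 * \<delta>)"
      using two.sup_conv_attained(2)[of y0] two.maximizer_at_touch[OF st touch2] unfolding ya_def
      by (metis add_uminus_conv_diff scaleR_minus_right)
    have sum_pos: "0 < \<phi>1 xa + \<phi>2 ya"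
    proof -
      have "?u1 x0 \<le> \<phi>1 xa" "?u2 y0 \<le> \<phi>2 ya" using xa ya \<delta> by auto
      then show ?thesis using J wb(1)[of "(norm (x0 - y0))\<^sup>2"] by simp
    qed
    define n where "n = (1 / r) *\<^sub>R (x0 - y0)"
    have n: "norm n = 1" "x0 - y0 = r *\<^sub>R n" unfolding n_def r_def using \<open>x0 \<noteq> y0\<close> by auto
    have \<kappa>: "0 \<le> K * sqrt r" using K r by simp
    obtain S T where S: "S ** transpose S = \<sigma> ya ** transpose (\<sigma> ya)" "T ** S = mat 1"
      and coupling: "2 * (norm (\<sigma> xa - S))\<^sup>2 - (3 + K * sqrt r) * (norm (transpose (\<sigma> xa - S) *v n))\<^sup>2
        \<le> - (1 + K * sqrt r) * \<nu>"
    proof (cases "r \<le> r0")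
      case True
      have "norm (xa - ya) = norm ((x0 - y0) - (x0 - xa) + (y0 - ya))" by (simp add: algebra_simps)
      also have "\<dots> \<le> norm ((x0 - y0) - (x0 - xa)) + norm (y0 - ya)" by (rule norm_triangle_ineq)
      also have "\<dots> \<le> r + norm (x0 - xa) + norm (y0 - ya)"
        unfolding r_def using norm_triangle_ineq4[of "x0 - y0" "x0 - xa"] by simp
      also have "\<dots> \<le> r0 + \<tau> + \<tau>"
        using True one.maximizer_dist[OF xa] two.maximizer_dist[OF ya] unfolding \<delta>B by linarith
      also have "\<dots> < r1" using \<tau> unfolding r0_def by linarith
      finally have "norm (\<sigma> xa - \<sigma> ya) \<le> sqrt \<nu> / 10" using r1(2) by (simp add: less_imp_le)
      from reflection_coupling[OF \<nu> ell this n(1) \<kappa>] show thesis using that by blast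
    next
      case False
      have "8 * s\<^sup>2 = K0 * \<nu> * sqrt r0" unfolding K0_def using \<nu> r0 by simp
      also have "\<dots> \<le> K * \<nu> * sqrt r" using K \<nu> r0 False pos by (intro mult_mono) auto
      finally have "8 * s\<^sup>2 \<le> K * sqrt r * \<nu>" by (simp add: mult_ac)
      from sign_coupling[OF \<nu> ell ell s s n(1) this, of ya xa] show thesis using that by blast
    qed
    obtain T1 where T1: "T1 ** \<sigma> xa = mat 1" using elliptic_inverse[OF \<nu> ell, of xa] by blast
    \<comment> \<open>the lower order terms in the inequalities satisfied by \<open>\<phi>1\<close> and \<open>\<phi>2\<close>\<close>
    define F1 where "F1 x r p = \<epsilon> * (r + m) + H_lo x p + H_up x p" for x r p
    define F2 where "F2 x r p = \<epsilon> * (r - \<mu> * m) - \<mu> * (H_lo x ((- p) /\<^sub>R \<mu>) + H_up x ((- p) /\<^sub>R \<mu>))" for x r p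
    have F1c: "continuous_on UNIV (\<lambda>(x, r, p). F1 x r p)"
      unfolding F1_def case_prod_unfold by (intro continuous_intros hc)
    have F2c: "continuous_on UNIV (\<lambda>(x, r, p). F2 x r p)"
      unfolding F2_def case_prod_unfold by (intro continuous_intros hc)
    have v1: "visc_sub A F1 \<phi>1"
      unfolding visc_sub_def
    proof (intro allI impI)
      fix \<theta> D D2 x assume C2: "C2_with \<theta> D D2" and ev: "\<forall>\<^sub>F y in nhds x. \<phi>1 y - \<theta> y \<le> \<phi>1 x - \<theta> x"
      have "\<forall>\<^sub>F y in nhds x. \<phi> y - \<theta> y \<le> \<phi> x - \<theta> x" using ev by eventually_elim (simp add: \<phi>1_def)
      from sub[OF C2 this] show "F1 x (\<phi>1 x) (D x) \<le> trace (A x ** D2 x)"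
        unfolding F1_def \<phi>1_def by simp
    qed
    have v2: "visc_sub A F2 \<phi>2"
      unfolding visc_sub_def
    proof (intro allI impI)
      fix \<theta> D D2 x assume C2: "C2_with \<theta> D D2" and ev: "\<forall>\<^sub>F y in nhds x. \<phi>2 y - \<theta> y \<le> \<phi>2 x - \<theta> x"
      let ?k = "- inverse \<mu>"
      have "\<forall>\<^sub>F y in nhds x. \<phi> y - ?k * \<theta> y \<ge> \<phi> x - ?k * \<theta> x"
        using ev
      proof eventually_elim
        case (elim y)
        have cancel: "\<mu> * (inverse \<mu> * a) = a" for a using \<mu> by simp
        have "\<mu> * (\<phi> x - ?k * \<theta> x) \<le> \<mu> * (\<phi> y - ?k * \<theta> y)"
          using elim unfolding \<phi>2_def by (simp add: algebra_simps cancel)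
        then show ?case using \<mu> by simp
      qed
      from super[OF C2_with_scale[OF C2] this]
      have 0: "0 \<le> \<epsilon> * \<phi> x - trace (A x ** (?k *\<^sub>R D2 x)) + H_lo x ((- D x) /\<^sub>R \<mu>) + H_up x ((- D x) /\<^sub>R \<mu>)"
        by simp
      have "trace (A x ** (?k *\<^sub>R D2 x)) = ?k * trace (A x ** D2 x)"
        by (metis matrix_scalar_ac scalar_matrix_assoc trace_scaleR)
      with 0 have "0 \<le> \<epsilon> * \<phi> x + inverse \<mu> * trace (A x ** D2 x) + H_lo x ((- D x) /\<^sub>R \<mu>) + H_up x ((- D x) /\<^sub>R \<mu>)"
        by simp
      then have "0 \<le> \<mu> * (\<epsilon> * \<phi> x + inverse \<mu> * trace (A x ** D2 x) + H_lo x ((- D x) /\<^sub>R \<mu>) + H_up x ((- D x) /\<^sub>R \<mu>))"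
        using \<mu> by (intro mult_nonneg_nonneg) auto
      also have "\<dots> = \<mu> * (\<epsilon> * \<phi> x) + trace (A x ** D2 x) + \<mu> * (H_lo x ((- D x) /\<^sub>R \<mu>) + H_up x ((- D x) /\<^sub>R \<mu>))"
        using \<mu> by (simp add: distrib_left mult.assoc[symmetric])
      finally show "F2 x (\<phi>2 x) (D x) \<le> trace (A x ** D2 x)"
        unfolding F2_def \<phi>2_def by (simp add: algebra_simps)
    qed
    let ?F = "F1 xa (\<phi>1 xa) p + F2 ya (\<phi>2 ya) (- p)"
    have le: "?F
      \<le> 2 * w1 * (norm (\<sigma> xa - S))\<^sup>2 + 4 * w2 * (norm (transpose (\<sigma> xa - S) *v (x0 - y0)))\<^sup>2"
      by (rule doubling_inequality[OF b1 b2 Ac As F1c v1 F2c v2 max taylor p_def xa_def ya_def _ T1 _ S(2)])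
        (simp_all add: A S(1))
    also have "\<dots> = w1 * (2 * (norm (\<sigma> xa - S))\<^sup>2 - (3 + K * sqrt r) * (norm (transpose (\<sigma> xa - S) *v n))\<^sup>2)"
    proof -
      have e1: "norm (transpose (\<sigma> xa - S) *v (x0 - y0)) = r * norm (transpose (\<sigma> xa - S) *v n)"
        unfolding n(2) using r by (simp add: matrix_vector_mult_scaleR del: transpose_matrix_vector)
      have e2: "4 * w2 * (r * X)\<^sup>2 = - w1 * (3 + K * sqrt r) * X\<^sup>2" for X
        unfolding w2_def using r by (simp add: power_mult_distrib)
      have "2 * w1 * a + 4 * w2 * (r * X)\<^sup>2 = w1 * (2 * a - (3 + K * sqrt r) * X\<^sup>2)" for a X
        unfolding e2 by (simp add: algebra_simps)
      then show ?thesis unfolding e1 .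
    qed
    also have "\<dots> \<le> w1 * (- (1 + K * sqrt r) * \<nu>)" using coupling w1 by (intro mult_left_mono) auto
    finally have upper: "?F \<le> - (w1 * (1 + K * sqrt r) * \<nu>)"
      by (simp only: mult_minus_left mult_minus_right mult.assoc)
    have lower: "- (C1 + C2 * norm p) \<le> ?F"
    proof -
      have e: "?F = \<epsilon> * (\<phi>1 xa + \<phi>2 ya) - (\<mu> - 1) * (\<epsilon> * m)
        + (H_lo xa p - \<mu> * H_lo ya (p /\<^sub>R \<mu>)) + (H_up xa p - \<mu> * H_up ya (p /\<^sub>R \<mu>))"
        unfolding F1_def F2_def by (simp add: algebra_simps)
      have 1: "0 \<le> \<epsilon> * (\<phi>1 xa + \<phi>2 ya)" using \<epsilon> sum_pos by simp
      have 2: "(\<mu> - 1) * (\<epsilon> * m) \<le> (\<mu> - 1) * (C + CH)" using \<mu> \<epsilon>m by (intro mult_left_mono) auto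
      have 3: "- (C * (1 + norm p)) \<le> H_lo xa p" using growth[of xa p] by (simp add: abs_le_iff)
      have "\<mu> * H_lo ya (p /\<^sub>R \<mu>) \<le> \<mu> * (C * (1 + norm (p /\<^sub>R \<mu>)))"
        using growth[of ya "p /\<^sub>R \<mu>"] \<mu> by (intro mult_left_mono) (auto simp: abs_le_iff)
      also have "\<dots> = C * (\<mu> + norm p)"
        using \<mu> by (simp add: field_simps)
      finally have 4: "\<mu> * H_lo ya (p /\<^sub>R \<mu>) \<le> C * (\<mu> + norm p)" .
      have 5: "- Cb * norm p \<le> H_up xa p - \<mu> * H_up ya (p /\<^sub>R \<mu>)" by (rule superlinear[OF pL])
      have "C1 + C2 * norm p = (\<mu> - 1) * (C + CH) + C * (1 + norm p) + C * (\<mu> + norm p) + Cb * norm p"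
        unfolding C1_def C2_def by (simp add: algebra_simps)
      then show ?thesis unfolding e using 1 2 3 4 5 by linarith
    qed
    have "C1 + C2 * norm p < w1 * (1 + K * sqrt r) * \<nu>"
      unfolding np w1_def by (rule pen(3)[OF r])
    with upper lower show False by linarith
  qed
  moreover have "0 < \<Lambda> + 1" using \<Lambda> by simp
  ultimately show ?thesis by blast
qed

theorem lemma2p3:
  fixes \<sigma> A :: "real ^ 'n \<Rightarrow> real ^ 'n ^ 'n"
    and H_lo H_up :: "real ^ 'n \<Rightarrow> real ^ 'n \<Rightarrow> real"
  assumes sigma: "torus_W1_infty \<sigma>"
    and A: "\<And>x. A x = \<sigma> x ** transpose (\<sigma> x)"
    and H_lo: "torus_C_Hamiltonian H_lo"
    and H_up: "torus_C_Hamiltonian H_up"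
    and elliptic: "\<exists>\<nu>>0. \<forall>x. mat_le (\<nu> *\<^sub>R mat 1) (A x)"
    and growth: "\<exists>C. \<forall>x p. \<bar>H_lo x p\<bar> \<le> C * (1 + norm p)"
    and superlinear:
      "(\<exists>C>0. \<exists>L>1. \<forall>x y p \<mu>. norm p \<ge> L \<longrightarrow> \<mu> \<ge> 1 + L * torus_dist x y \<longrightarrow>
          H_up x p - \<mu> * H_up y (p /\<^sub>R \<mu>) \<ge> - C * norm p) \<or>
       (\<exists>C>0. \<exists>L>1. \<exists>\<mu>>1. \<forall>x y p. norm p \<ge> L \<longrightarrow>
          H_up x p - \<mu> * H_up y (p /\<^sub>R \<mu>) \<ge> - C * norm p)"
  shows "\<exists>K>0. \<forall>\<epsilon>>0. \<forall>\<phi>.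
    torus_viscosity_solution
      (\<lambda>x u p X. \<epsilon> * u - trace (A x ** X) + H_lo x p + H_up x p) \<phi> \<longrightarrow>
    osc \<phi> \<le> K"
proof -
  have "\<exists>C>0. \<exists>L>1. \<exists>\<mu>>1. \<forall>x y p. norm p \<ge> L \<longrightarrow>
          H_up x p - \<mu> * H_up y (p /\<^sub>R \<mu>) \<ge> - C * norm p"
    using superlinear
  proof
    assume "\<exists>C>0. \<exists>L>1. \<forall>x y p \<mu>. norm p \<ge> L \<longrightarrow> \<mu> \<ge> 1 + L * torus_dist x y \<longrightarrow>
          H_up x p - \<mu> * H_up y (p /\<^sub>R \<mu>) \<ge> - C * norm p"
    then obtain C L where C: "C > 0" and L: "L > 1" and *: "\<And>x y p \<mu>. norm p \<ge> L \<Longrightarrow>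
        \<mu> \<ge> 1 + L * torus_dist x y \<Longrightarrow> H_up x p - \<mu> * H_up y (p /\<^sub>R \<mu>) \<ge> - C * norm p"
      by blast
    \<comment> \<open>one factor that is admissible for all pairs of points\<close>
    define \<mu> where "\<mu> = 1 + L * real CARD('n)"
    have "1 < \<mu>" unfolding \<mu>_def using L by simp
    moreover have "\<mu> \<ge> 1 + L * torus_dist x y" for x y :: "real ^ 'n"
      unfolding \<mu>_def using torus_dist_le[of x y] L by simp
    ultimately show ?thesis using C L * by blast
  qed
  then obtain C L \<mu> where "C > 0" "L > 1" "\<mu> > 1" "\<And>x y p. norm p \<ge> L \<Longrightarrow>
      H_up x p - \<mu> * H_up y (p /\<^sub>R \<mu>) \<ge> - C * norm p" by blast
  moreover obtain \<nu> where "\<nu> > 0" "\<And>x. mat_le (\<nu> *\<^sub>R mat 1) (A x)" using elliptic by blast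
  moreover obtain Cg where "\<And>x p. \<bar>H_lo x p\<bar> \<le> Cg * (1 + norm p)" using growth by blast
  moreover have "torus_C \<sigma>" using sigma by (simp add: torus_W1_infty_def)
  ultimately show ?thesis
    using oscillation_bound[of \<sigma> A H_lo H_up \<nu> Cg C L \<mu>] A H_lo H_up by blast
qed

end
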